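(* Let $m\ge3$, let $d_1,\dots,d_m\ge1$ be integers, $d=d_1+\cdots+d_m$, and let $0<\eta\le1$. There are constants $c,C>0$, depending only on $m$, $d$ and $\eta$, such that the following holds. Let $\mathcal D^i$ be a dyadic cube grid in $\mathbb R^{d_i}$ for $1\le i\le m$, let $\Phi\colon\mathbb Z^{m-1}\to\mathbb Z$ be coordinatewise nondecreasing, and let $\mathcal G\subset\mathcal Z_\Phi$ be $\eta$-sparse with finite shadow, i.e. $|\mathrm{sh}(\mathcal G)|<\infty$. Then $$\int_{\mathrm{sh}(\mathcal G)}\left[\exp\left(c\,h_{\mathcal G}^{1/(m-1)}\right)-1\right]\le C|\mathrm{sh}(\mathcal G)|.$$ In particular the constants do not depend on $\Phi$ or on the dyadic grids.
   Context: A dyadic (cube) grid in $\mathbb R^n$ is a collection of half-open axis-parallel cubes with side lengths $2^k$, $k\in\mathbb Z$, such that for every $k\in\mathbb Z$ the cubes of side length $2^k$ in the collection partition $\mathbb R^n$, and any two intersecting cubes of the collection are nested. $\mathcal D=\mathcal D^1\times\cdots\times\mathcal D^m$ is the family of rectangles $I=I^1\times\cdots\times I^m\subset\mathbb R^d=\mathbb R^{d_1}\times\cdots\times\mathbb R^{d_m}$ with $I^i\in\mathcal D^i$. $\mathcal Z_\Phi\subset\mathcal D$ is the family of rectangles in $\mathcal D$ with side-length tuple $(2^{k_1},\dots,2^{k_{m-1}},2^{\Phi(k_1,\dots,k_{m-1})})$ for some $(k_1,\dots,k_{m-1})\in\mathbb Z^{m-1}$. For $\mathcal G\subset\mathcal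 D$, $h_{\mathcal G}=\sum_{I\in\mathcal G}\mathbf 1_I$ and $\mathrm{sh}(\mathcal G)=\bigcup_{I\in\mathcal G}I$. $\mathcal G$ is $\eta$-sparse if there are pairwise disjoint measurable sets $E_I\subset I$, $I\in\mathcal G$, with $|E_I|\ge\eta|I|$. *)

theory Defs
  imports "HOL-Analysis.Analysis" "HOL-Library.Disjoint_Sets"
begin

text \<open>
  \<open>\<real>\<^sup>n\<close> is the set of extensional functions \<^term>\<open>{..<n} \<rightarrow>\<^sub>E (UNIV :: real set)\<close>, and
  \<open>\<real>\<^sup>d = \<real>\<^bsup>d\<^sub>1\<^esup> \<times> \<dots> \<times> \<real>\<^bsup>d\<^sub>m\<^esup>\<close> is the space of the iterated product measure below.
  The factors are numbered \<open>0, \<dots>, m - 1\<close>; \<open>ds i\<close> is the dimension of factor \<open>i\<close>.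
  The completion makes \<open>lebesgue_prod\<close> the Lebesgue (not merely Borel) measure.
\<close>

definition lebesgue_prod :: "nat \<Rightarrow> (nat \<Rightarrow> nat) \<Rightarrow> (nat \<Rightarrow> nat \<Rightarrow> real) measure" where
  "lebesgue_prod m ds =
     completion (\<Pi>\<^sub>M i\<in>{..<m}. (\<Pi>\<^sub>M j\<in>{..<ds i}. (lborel :: real measure)))"

definition cube_of_side :: "nat \<Rightarrow> real \<Rightarrow> (nat \<Rightarrow> real) set \<Rightarrow> bool" where
  "cube_of_side n l Q \<longleftrightarrow> (\<exists>a. Q = (\<Pi>\<^sub>E j\<in>{..<n}. {a j ..< a j + l}))"

definition dyadic_grid :: "nat \<Rightarrow> (nat \<Rightarrow> real) set set \<Rightarrow> bool" where
  "dyadic_grid n D \<longleftrightarrow>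
     (\<forall>Q\<in>D. \<exists>k::int. cube_of_side n (2 powi k) Q) \<and>
     (\<forall>k::int. partition_on ({..<n} \<rightarrow>\<^sub>E UNIV) {Q\<in>D. cube_of_side n (2 powi k) Q}) \<and>
     (\<forall>Q\<in>D. \<forall>R\<in>D. Q \<inter> R \<noteq> {} \<longrightarrow> Q \<subseteq> R \<or> R \<subseteq> Q)"

definition int_tuples :: "nat \<Rightarrow> (nat \<Rightarrow> int) set" where
  "int_tuples n = ({..<n} \<rightarrow>\<^sub>E UNIV)"

definition coordwise_nondecreasing :: "nat \<Rightarrow> ((nat \<Rightarrow> int) \<Rightarrow> int) \<Rightarrow> bool" where
  "coordwise_nondecreasing n \<Phi> \<longleftrightarrow>
     (\<forall>k\<in>int_tuples n. \<forall>i<n. \<forall>t. k i \<le> t \<longrightarrow> \<Phi> k \<le> \<Phi> (k(i := t)))"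

definition zygmund_rectangles ::
  "nat \<Rightarrow> (nat \<Rightarrow> nat) \<Rightarrow> (nat \<Rightarrow> (nat \<Rightarrow> real) set set) \<Rightarrow> ((nat \<Rightarrow> int) \<Rightarrow> int)
     \<Rightarrow> (nat \<Rightarrow> nat \<Rightarrow> real) set set" where
  "zygmund_rectangles m ds D \<Phi> =
     {(\<Pi>\<^sub>E i\<in>{..<m}. Q i) | Q.
        (\<forall>i<m. Q i \<in> D i) \<and>
        (\<exists>k\<in>int_tuples (m - 1).
           (\<forall>i<m - 1. cube_of_side (ds i) (2 powi k i) (Q i)) \<and>
           cube_of_side (ds (m - 1)) (2 powi \<Phi> k) (Q (m - 1)))}"

definition sparse_family :: "'a measure \<Rightarrow> real \<Rightarrow> 'a set set \<Rightarrow> bool" where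
  "sparse_family M \<eta> G \<longleftrightarrow>
     (\<exists>E. disjoint_family_on E G \<and>
        (\<forall>I\<in>G. E I \<in> sets M \<and> E I \<subseteq> I \<and> emeasure M (E I) \<ge> ennreal \<eta> * emeasure M I))"

text \<open>An infinite family may cover a point infinitely often, so the height is extended-valued.\<close>

definition height :: "'a set set \<Rightarrow> 'a \<Rightarrow> ennreal" where
  "height G x = (\<Sum>\<^sub>\<infinity>I\<in>G. indicator I x)"

text \<open>The function \<open>exp (c h\<^sup>p) - 1\<close> on \<open>[0, \<infinity>]\<close>, with value \<open>\<infinity>\<close> at \<open>h = \<infinity>\<close> (for \<open>c, p > 0\<close>).\<close>

definition exp_powr_minus_one :: "real \<Rightarrow> real \<Rightarrow> ennreal \<Rightarrow> ennreal" where
  "exp_powr_minus_one c p h =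
     (if h = \<infinity> then \<infinity> else ennreal (exp (c * enn2real h powr p) - 1))"

end

theory Submission
  imports Defs
begin

text \<open>
  A finite family is discretized: only the pattern of cubes containing a coordinate matters, so the
  problem lives on a product of \<open>m\<close> finite weighted sets with laminar sides. Order the rectangles so
  that \<open>\<Phi> k\<close>, and then the sum of the exponents \<open>k\<close>, decreases. If \<open>s\<close> precedes \<open>r\<close> and meets it,
  then the last side of \<open>s\<close> contains that of \<open>r\<close> and, by monotonicity of \<open>\<Phi>\<close>, the first \<open>m - 1\<close> sides
  of \<open>s\<close> cannot all be strictly smaller.

  Fix a set \<open>F\<close> and rectangles in which \<open>F\<close> has density at least \<open>2\<^sup>-\<^sup>j\<close>. In each of the first
  \<open>m - 1\<close> directions measure how sparse \<open>F\<close> becomes on smaller sides; the \<open>m - 1\<close> levels of a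
  rectangle at a point, modulo a common shift, form its class. There are \<open>O((j + 1)\<^sup>m\<^sup>-\<^sup>2)\<close> classes,
  and within a class the order of the rectangles forces the order of the levels. Selecting greedily
  the rectangles whose class is mostly new costs one factor \<open>(j + 1)\<^sup>m\<^sup>-\<^sup>2\<close>, and a rectangle not
  selected is covered by the selected ones to a fixed proportion. The strong maximal estimate then gives
  \<open>|\<Union>R| \<le> C 2\<^sup>j (j + 1)\<^sup>m\<^sup>-\<^sup>2 |F|\<close>.

  Applying this to \<open>F = {h > A (l + 2)\<^sup>m\<^sup>-\<^sup>1}\<close>, split by the density of \<open>F\<close> in the rectangles, and using that
  sparse families are Carleson yields \<open>|F| \<le> 2\<^sup>-\<^sup>l |sh|\<close>. Exhausting the family by finite ones and
  summing over \<open>l\<close> gives the exponential integral.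
\<close>

section \<open>Finite weighted products\<close>

text \<open>The obstacle: a predecessor \<open>s\<close> may be much shorter than \<open>r\<close>
  in some of the first directions and longer in others. So predecessors may contain most of the part
  of \<open>F\<close> in \<open>r\<close> and still fill almost none of the volume of
  \<open>r\<close>. The levels turn mass of \<open>F\<close> into volume. If the level of
  \<open>r\<close> in a direction is at most that of \<open>s\<close> and below the cap, some side
  inside both of theirs carries \<open>F\<close> with density at most twice its density in the side
  of \<open>r\<close>. Boxes with such thin sides cannot hold a fixed share of \<open>F\<close>
  without filling a fixed share of the volume; this is \<open>box_union_mass\<close>, where the work
  lies in passing from thinness on single fibres to thinness of marginals. Only the order of the
  levels of \<open>r\<close> and \<open>s\<close> matters. Tuples that differ by a common shift are
  always ordered in all directions at once, so the \<open>m - 1\<close> levels need only be recorded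
  through their \<open>m - 2\<close> differences; this saves one power. The sum over the
  \<open>l + 1\<close> layers of density costs that power again, which gives the threshold of order
  \<open>(l + 2) ^ (m - 1)\<close> and hence the root of order \<open>m - 1\<close> in the
  exponential.\<close>

definition laminar :: "'a set \<Rightarrow> 'a set \<Rightarrow> bool" where
  "laminar P Q \<longleftrightarrow> P \<inter> Q = {} \<or> P \<subseteq> Q \<or> Q \<subseteq> P"

text \<open>The maximal members are pairwise disjoint and have the same union, so the inequality
  adds up over them without any loss of constant. Every one-dimensional covering argument below is
  an instance.\<close>

lemma laminar_covering:
  fixes u v :: "'a \<Rightarrow> real"
  assumes "finite \<L>" "\<And>L. L \<in> \<L> \<Longrightarrow> finite L"
    and "\<And>P Q. P \<in> \<L> \<Longrightarrow> Q \<in> \<L> \<Longrightarrow> laminar P Q"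
    and "\<And>L. L \<in> \<L> \<Longrightarrow> sum u L \<le> sum v L"
  shows "sum u (\<Union>\<L>) \<le> sum v (\<Union>\<L>)"
proof -
  define \<M> where "\<M> = {L\<in>\<L>. \<forall>K\<in>\<L>. L \<subseteq> K \<longrightarrow> K = L}"
  have "\<exists>M\<in>\<M>. L \<subseteq> M" if L: "L \<in> \<L>" for L
  proof -
    obtain M where "M \<in> \<L>" "L \<subseteq> M" "\<forall>K\<in>\<L>. M \<subseteq> K \<longrightarrow> M = K"
      using finite_has_maximal2[OF assms(1) L] by auto
    then show ?thesis unfolding \<M>_def by (intro bexI[of _ M]) auto
  qed
  moreover have "\<M> \<subseteq> \<L>" by (auto simp: \<M>_def)
  ultimately have U: "\<Union>\<L> = \<Union>\<M>" by blast
  have fin: "finite \<M>" "\<forall>L\<in>\<M>. finite L" and sub: "\<M> \<subseteq> \<L>"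
    using assms(1,2) by (auto simp: \<M>_def)
  have dj: "\<forall>P\<in>\<M>. \<forall>Q\<in>\<M>. P \<noteq> Q \<longrightarrow> P \<inter> Q = {}"
  proof (intro ballI impI)
    fix P Q assume PQ: "P \<in> \<M>" "Q \<in> \<M>" "P \<noteq> Q"
    then have "laminar P Q" "\<not> P \<subseteq> Q" "\<not> Q \<subseteq> P"
      using assms(3)[of P Q] by (auto simp: \<M>_def)
    then show "P \<inter> Q = {}" by (simp add: laminar_def)
  qed
  have "sum u (\<Union>\<M>) = (\<Sum>L\<in>\<M>. sum u L)" "sum v (\<Union>\<M>) = (\<Sum>L\<in>\<M>. sum v L)"
    using sum.Union_disjoint[OF fin(2) dj] by auto
  then show ?thesis
    unfolding U using sub assms(4) by (simp add: sum_mono subset_iff)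
qed

text \<open>The integral of \<open>f\<close> over a finite product, for the product of the measures
  with point masses \<open>w i\<close>. Keeping \<open>S\<close> and \<open>X\<close> as parameters
  allows integration over slices and over subboxes with the same weights.\<close>

definition psum ::
  "'i set \<Rightarrow> ('i \<Rightarrow> 'a set) \<Rightarrow> ('i \<Rightarrow> 'a \<Rightarrow> real) \<Rightarrow> (('i \<Rightarrow> 'a) \<Rightarrow> real) \<Rightarrow> real" where
  "psum S X w f = (\<Sum>y\<in>Pi\<^sub>E S X. (\<Prod>i\<in>S. w i (y i)) * f y)"

lemma psum_empty [simp]: "psum {} X w f = f (\<lambda>_. undefined)"
  by (simp add: psum_def)

text \<open>Fubini with the new coordinate outermost; \<open>psum_insert'\<close> has it
  innermost.\<close>

lemma psum_insert:
  assumes "finite S" "i \<notin> S"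
  shows "psum (insert i S) X w f = (\<Sum>a\<in>X i. w i a * psum S X w (\<lambda>z. f (z(i:=a))))"
proof -
  have "psum (insert i S) X w f
      = (\<Sum>(a,z)\<in>X i \<times> Pi\<^sub>E S X. (\<Prod>j\<in>insert i S. w j ((z(i:=a)) j)) * f (z(i:=a)))"
    unfolding psum_def PiE_insert_eq
    by (subst sum.reindex[OF inj_combinator[OF assms(2)]])
       (auto intro!: sum.cong simp: case_prod_unfold)
  also have "\<dots> = (\<Sum>(a,z)\<in>X i \<times> Pi\<^sub>E S X. w i a * ((\<Prod>j\<in>S. w j (z j)) * f (z(i:=a))))"
  proof -
    have "(\<Prod>j\<in>insert i S. w j ((z(i:=a)) j)) = w i a * (\<Prod>j\<in>S. w j (z j))" for a z
    proof -
      have "(\<Prod>j\<in>S. w j ((z(i:=a)) j)) = (\<Prod>j\<in>S. w j (z j))"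
        using assms(2) by (intro prod.cong) auto
      then show ?thesis using assms by simp
    qed
    then show ?thesis by (simp only: mult.assoc)
  qed
  also have "\<dots> = (\<Sum>a\<in>X i. w i a * psum S X w (\<lambda>z. f (z(i:=a))))"
    unfolding psum_def sum_distrib_left
    by (simp add: sum.cartesian_product)
  finally show ?thesis .
qed

lemma psum_mono:
  assumes "\<And>i a. i \<in> S \<Longrightarrow> a \<in> X i \<Longrightarrow> w i a \<ge> 0"
    and "\<And>y. y \<in> Pi\<^sub>E S X \<Longrightarrow> f y \<le> g y"
  shows "psum S X w f \<le> psum S X w g"
  unfolding psum_def
  by (intro sum_mono mult_left_mono assms prod_nonneg) (auto intro: assms)

lemma psum_of_bool_mono:
  assumes "\<And>i a. i \<in> S \<Longrightarrow> a \<in> X i \<Longrightarrow> w i a \<ge> 0"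
    and "\<And>y. y \<in> Pi\<^sub>E S X \<Longrightarrow> P y \<Longrightarrow> Q y"
  shows "psum S X w (\<lambda>y. of_bool (P y)) \<le> psum S X w (\<lambda>y. of_bool (Q y))"
  using assms by (intro psum_mono) auto

lemma psum_nonneg:
  assumes "\<And>i a. i \<in> S \<Longrightarrow> a \<in> X i \<Longrightarrow> w i a \<ge> 0"
    and "\<And>y. y \<in> Pi\<^sub>E S X \<Longrightarrow> f y \<ge> 0"
  shows "psum S X w f \<ge> 0"
  unfolding psum_def
  by (intro sum_nonneg mult_nonneg_nonneg assms prod_nonneg) (auto intro: assms)

lemma psum_cong:
  assumes "\<And>y. y \<in> Pi\<^sub>E S X \<Longrightarrow> f y = g y"
  shows "psum S X w f = psum S X w g"
  unfolding psum_def using assms by (auto intro: sum.cong)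

lemma psum_add: "psum S X w (\<lambda>y. f y + g y) = psum S X w f + psum S X w g"
  unfolding psum_def by (simp add: algebra_simps sum.distrib)

lemma psum_cmult: "psum S X w (\<lambda>y. c * f y) = c * psum S X w f"
  unfolding psum_def by (simp add: algebra_simps sum_distrib_left)

lemma psum_sum: "psum S X w (\<lambda>y. \<Sum>k\<in>K. f k y) = (\<Sum>k\<in>K. psum S X w (f k))"
  unfolding psum_def sum_distrib_left by (rule sum.swap)

lemma psum_insert':
  assumes "finite S" "i \<notin> S"
  shows "psum (insert i S) X w f = psum S X w (\<lambda>z. \<Sum>a\<in>X i. w i a * f (z(i:=a)))"
  by (simp add: psum_insert[OF assms] psum_sum psum_cmult)

lemma psum_remove:
  assumes "finite S" "i \<in> S"
  shows "psum S X w f = psum (S - {i}) X w (\<lambda>z. \<Sum>a\<in>X i. w i a * f (z(i:=a)))"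
  using psum_insert'[of "S - {i}" i X w f] assms by (simp add: insert_absorb)

text \<open>By covering, the large marginal makes the union of all sides \<open>L a b\<close> a \<open>1/Q\<close> fraction of
  \<open>Y\<close>; covering on each fibre then bounds the mass of \<open>g\<close> over that union.\<close>

lemma bad_pairs_mass:
  fixes g :: "'a \<Rightarrow> 'b \<Rightarrow> real" and u :: "'a \<Rightarrow> real" and v :: "'b \<Rightarrow> real"
  assumes fin: "finite X" "finite Y"
    and nn: "\<And>a. a \<in> X \<Longrightarrow> u a \<ge> 0" "\<And>b. b \<in> Y \<Longrightarrow> v b \<ge> 0"
      "\<And>a b. a \<in> X \<Longrightarrow> b \<in> Y \<Longrightarrow> g a b \<ge> 0"
    and A: "A > 0" and Q: "Q > 0"
    and L: "\<And>a b. a \<in> X \<Longrightarrow> b \<in> Y \<Longrightarrow> B a b \<Longrightarrow> b \<in> L a b \<and> L a b \<subseteq> Y"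
    and lam: "\<And>a b a' b'. a \<in> X \<Longrightarrow> b \<in> Y \<Longrightarrow> B a b \<Longrightarrow> a' \<in> X \<Longrightarrow> b' \<in> Y \<Longrightarrow> B a' b' \<Longrightarrow>
        laminar (L a b) (L a' b')"
    and fib: "\<And>a b. a \<in> X \<Longrightarrow> b \<in> Y \<Longrightarrow> B a b \<Longrightarrow>
        (\<Sum>b'\<in>L a b. v b' * g a b') * sum v Y \<le> A * sum v (L a b) * (\<Sum>b'\<in>Y. v b' * g a b')"
    and big: "\<And>a b. a \<in> X \<Longrightarrow> b \<in> Y \<Longrightarrow> B a b \<Longrightarrow>
        (\<Sum>b'\<in>L a b. v b' * (\<Sum>a'\<in>X. u a' * g a' b')) * sum v Y
          \<ge> Q * sum v (L a b) * (\<Sum>b'\<in>Y. v b' * (\<Sum>a'\<in>X. u a' * g a' b'))"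
  shows "(\<Sum>a\<in>X. u a * (\<Sum>b\<in>Y. v b * (of_bool (B a b) * g a b)))
     \<le> A / Q * (\<Sum>a\<in>X. u a * (\<Sum>b\<in>Y. v b * g a b))"
proof -
  define G where "G = (\<Sum>a\<in>X. u a * (\<Sum>b\<in>Y. v b * g a b))"
  define V where "V = sum v Y"
  have V0: "V \<ge> 0" unfolding V_def using nn by (auto intro: sum_nonneg)
  have G': "(\<Sum>b'\<in>Y. v b' * (\<Sum>a'\<in>X. u a' * g a' b')) = G"
    unfolding G_def sum_distrib_left by (subst sum.swap) (simp add: algebra_simps)
  have G0: "G \<ge> 0" unfolding G_def using nn by (auto intro!: sum_nonneg mult_nonneg_nonneg)
  have le: "(\<Sum>a\<in>X. u a * (\<Sum>b\<in>Y. v b * (of_bool (B a b) * g a b))) \<le> G"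
    unfolding G_def by (intro sum_mono mult_left_mono) (auto simp: nn)
  show ?thesis
  proof (cases "G = 0")
    case True
    then show ?thesis using le by (simp add: G_def)
  next
    case False
    with G0 have Gp: "G > 0" by simp
    define \<Lambda> where "\<Lambda> = (\<lambda>(a,b). L a b) ` {(a,b)\<in>X \<times> Y. B a b}"
    have \<Lambda>Y: "\<Union>\<Lambda> \<subseteq> Y" using L by (auto simp: \<Lambda>_def)
    have f\<Lambda>: "finite \<Lambda>" unfolding \<Lambda>_def
      by (intro finite_imageI finite_subset[OF _ finite_cartesian_product[OF fin]]) auto
    have "(\<Sum>b\<in>\<Union>\<Lambda>. Q * G * v b) \<le> (\<Sum>b\<in>\<Union>\<Lambda>. V * (v b * (\<Sum>a'\<in>X. u a' * g a' b)))"
    proof (rule laminar_covering[OF f\<Lambda>])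
      fix K assume K: "K \<in> \<Lambda>"
      then show "finite K" using \<Lambda>Y fin(2) by (auto intro: finite_subset)
      show "(\<Sum>b\<in>K. Q * G * v b) \<le> (\<Sum>b\<in>K. V * (v b * (\<Sum>a'\<in>X. u a' * g a' b)))"
        using K big unfolding \<Lambda>_def G' V_def sum_distrib_left[symmetric]
        by (auto simp: mult_ac)
    qed (use lam in \<open>auto simp: \<Lambda>_def\<close>)
    also have "\<dots> \<le> (\<Sum>b\<in>Y. V * (v b * (\<Sum>a'\<in>X. u a' * g a' b)))"
      by (intro sum_mono2 \<Lambda>Y fin) (auto intro!: mult_nonneg_nonneg sum_nonneg V0 nn)
    also have "\<dots> = V * G" by (simp add: G'[symmetric] sum_distrib_left)
    finally have "Q * G * sum v (\<Union>\<Lambda>) \<le> V * G" by (simp add: sum_distrib_left)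
    then have QV: "Q * sum v (\<Union>\<Lambda>) \<le> V" using Gp by (simp add: mult.assoc mult.left_commute)
    have Vp: "V > 0"
    proof (rule ccontr)
      assume "\<not> V > 0"
      then have "sum v Y = 0" using V0 by (simp add: V_def)
      then have "\<forall>b\<in>Y. v b = 0" using sum_nonneg_eq_0_iff[OF fin(2)] nn by auto
      then have "G = 0" by (simp add: G_def)
      with Gp show False by simp
    qed
    have "(\<Sum>b\<in>Y. v b * (of_bool (B a b) * g a b)) \<le> A / Q * (\<Sum>b\<in>Y. v b * g a b)"
      if a: "a \<in> X" for a
    proof -
      define \<Lambda>a where "\<Lambda>a = L a ` {b\<in>Y. B a b}"
      define Ga where "Ga = (\<Sum>b\<in>Y. v b * g a b)"
      have Ga0: "Ga \<ge> 0" unfolding Ga_def using nn a by (auto intro!: sum_nonneg)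
      have sub: "\<Union>\<Lambda>a \<subseteq> \<Union>\<Lambda>" using a by (auto simp: \<Lambda>a_def \<Lambda>_def)
      have "(\<Sum>b\<in>\<Union>\<Lambda>a. V * (v b * g a b)) \<le> (\<Sum>b\<in>\<Union>\<Lambda>a. A * Ga * v b)"
      proof (rule laminar_covering)
        show "finite \<Lambda>a" using fin by (simp add: \<Lambda>a_def)
        fix K assume K: "K \<in> \<Lambda>a"
        then have "K \<subseteq> Y" using sub \<Lambda>Y by auto
        then show "finite K" using fin(2) by (auto intro: finite_subset)
        show "(\<Sum>b\<in>K. V * (v b * g a b)) \<le> (\<Sum>b\<in>K. A * Ga * v b)"
          using K fib[OF a] unfolding \<Lambda>a_def Ga_def V_def sum_distrib_left[symmetric]
          by (auto simp: mult_ac)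
      qed (use lam a in \<open>auto simp: \<Lambda>a_def\<close>)
      also have "\<dots> = A * Ga * sum v (\<Union>\<Lambda>a)" by (simp add: sum_distrib_left)
      also have "\<dots> \<le> A * Ga * sum v (\<Union>\<Lambda>)"
        using A Ga0 sub \<Lambda>Y fin(2) nn
        by (intro mult_left_mono sum_mono2 finite_subset[OF \<Lambda>Y]) auto
      also have "\<dots> \<le> A * Ga * (V / Q)"
        using QV Q A Ga0 by (intro mult_left_mono) (auto simp: field_simps)
      finally have "V * (\<Sum>b\<in>\<Union>\<Lambda>a. v b * g a b) \<le> V * (A / Q * Ga)"
        by (simp add: sum_distrib_left mult_ac)
      then have 1: "(\<Sum>b\<in>\<Union>\<Lambda>a. v b * g a b) \<le> A / Q * Ga"
        using Vp by (rule mult_left_le_imp_le)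
      have "(\<Sum>b\<in>Y. v b * (of_bool (B a b) * g a b)) = (\<Sum>b\<in>{b\<in>Y. B a b}. v b * g a b)"
        by (rule sum.mono_neutral_cong_right) (use fin in auto)
      also have "\<dots> \<le> (\<Sum>b\<in>\<Union>\<Lambda>a. v b * g a b)"
      proof (rule sum_mono2)
        show "finite (\<Union>\<Lambda>a)" using sub \<Lambda>Y fin(2) by (meson finite_subset)
        show "{b \<in> Y. B a b} \<subseteq> \<Union>\<Lambda>a" using L[OF a] by (auto simp: \<Lambda>a_def)
        fix b assume "b \<in> \<Union>\<Lambda>a - {b \<in> Y. B a b}"
        then have "b \<in> Y" using sub \<Lambda>Y by blast
        then show "0 \<le> v b * g a b" using a nn by simp
      qed
      finally show ?thesis using 1 by (simp add: Ga_def)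
    qed
    then have "(\<Sum>a\<in>X. u a * (\<Sum>b\<in>Y. v b * (of_bool (B a b) * g a b)))
       \<le> (\<Sum>a\<in>X. u a * (A / Q * (\<Sum>b\<in>Y. v b * g a b)))"
      by (intro sum_mono mult_left_mono) (auto simp: nn)
    then show ?thesis by (simp add: sum_distrib_left mult_ac)
  qed
qed

text \<open>Cross-multiplied, so that null sides do no harm: in each direction the average of \<open>g\<close> over the
  side \<open>L y i\<close> through \<open>y\<close> is at most \<open>A\<close> times its average over the whole fibre.\<close>

definition thin_fibres ::
  "'i set \<Rightarrow> ('i \<Rightarrow> 'a set) \<Rightarrow> ('i \<Rightarrow> 'a \<Rightarrow> real) \<Rightarrow> real \<Rightarrow> (('i \<Rightarrow> 'a) \<Rightarrow> real)
     \<Rightarrow> ('i \<Rightarrow> 'a) set \<Rightarrow> (('i \<Rightarrow> 'a) \<Rightarrow> 'i \<Rightarrow> 'a set) \<Rightarrow> bool" where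
  "thin_fibres S X w A g F L \<longleftrightarrow>
     (\<forall>y\<in>F. \<forall>i\<in>S. y i \<in> L y i \<and> L y i \<subseteq> X i \<and>
        (\<Sum>a\<in>L y i. w i a * g (y(i:=a))) * sum (w i) (X i)
          \<le> A * sum (w i) (L y i) * (\<Sum>a\<in>X i. w i a * g (y(i:=a)))) \<and>
     (\<forall>y\<in>F. \<forall>z\<in>F. \<forall>i\<in>S. laminar (L y i) (L z i))"

definition weighted :: "'i set \<Rightarrow> ('i \<Rightarrow> 'a set) \<Rightarrow> ('i \<Rightarrow> 'a \<Rightarrow> real) \<Rightarrow> bool" where
  "weighted S X w \<longleftrightarrow> (\<forall>i\<in>S. finite (X i) \<and> (\<forall>a\<in>X i. w i a \<ge> 0))"

text \<open>A predicate, so that one constant \<open>c\<close> can be fixed before all the data.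
  \<open>L y\<close> lists the sides of a box around \<open>y\<close>.\<close>

definition box_union_bound ::
  "'i set \<Rightarrow> real \<Rightarrow> real \<Rightarrow> real \<Rightarrow> ('i \<Rightarrow> 'a set) \<Rightarrow> ('i \<Rightarrow> 'a \<Rightarrow> real) \<Rightarrow> (('i \<Rightarrow> 'a) \<Rightarrow> real)
     \<Rightarrow> ('i \<Rightarrow> 'a) set \<Rightarrow> (('i \<Rightarrow> 'a) \<Rightarrow> 'i \<Rightarrow> 'a set) \<Rightarrow> bool" where
  "box_union_bound S A \<beta> c X w g F L \<longleftrightarrow>
     (weighted S X w \<longrightarrow> (\<forall>y. g y \<ge> 0) \<longrightarrow> F \<subseteq> Pi\<^sub>E S X \<longrightarrow> thin_fibres S X w A g F L \<longrightarrow>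
      psum S X w (\<lambda>y. of_bool (y \<in> F) * g y) \<ge> \<beta> * psum S X w g \<longrightarrow> psum S X w g > 0 \<longrightarrow>
      psum S X w (\<lambda>z. of_bool (\<exists>y\<in>F. \<forall>i\<in>S. z i \<in> L y i)) \<ge> c * psum S X w (\<lambda>_. 1))"

text \<open>Induction on the directions. In direction \<open>i0\<close> a covering of each fibre
  shows that the sides there are not small compared with the mass of \<open>F\<close> above them.
  Hence many slices carry a good share of the marginal of \<open>g\<close>, and the induction
  hypothesis fills a fixed share of each of them. Before slicing, the points whose sides are not
  thin for the marginal are removed by \<open>bad_pairs_mass\<close>.\<close>

lemma box_union_mass:
  assumes "finite S" "A > 0" "\<beta> > 0"
  shows "\<exists>c>0. \<forall>(X :: 'i \<Rightarrow> 'a set) w g F L. box_union_bound S A \<beta> c X w g F L"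
  using assms
proof (induction S arbitrary: A \<beta> rule: finite_induct)
  case empty
  show ?case
    unfolding box_union_bound_def
  proof (intro exI[of _ 1] conjI allI impI)
    fix X :: "'i \<Rightarrow> 'a set" and w g F and L :: "('i \<Rightarrow> 'a) \<Rightarrow> 'i \<Rightarrow> 'a set"
    assume *: "\<beta> * psum {} X w g \<le> psum {} X w (\<lambda>y. of_bool (y \<in> F) * g y)" "0 < psum {} X w g"
    then have "F \<noteq> {}" using empty(2) by (auto simp: psum_def mult_le_0_iff)
    then show "1 * psum {} X w (\<lambda>_. 1)
        \<le> psum {} X w (\<lambda>z. of_bool (\<exists>y\<in>F. \<forall>i\<in>{}. z i \<in> L y i))"
      by (auto simp: psum_def)
  qed simp
next
  case (insert i0 S)
  \<comment> \<open>Each of the \<open>card S\<close> directions is bad on mass at most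
    \<open>A / Q\<close> times the total, so this \<open>Q\<close> costs at most half of
    \<open>\<beta>\<close>. In \<open>\<beta>'\<close> one factor 2 is that loss, \<open>A\<close>
    is the covering loss in direction \<open>i0\<close>, and the other 2 is spent on the choice of
    good slices.\<close>
  define Q where "Q = 2 * (real (card S) + 1) * A / \<beta>"
  define \<beta>' where "\<beta>' = \<beta> / (4 * A)"
  have Q: "Q > 0" and \<beta>': "\<beta>' > 0" using insert.prems by (simp_all add: Q_def \<beta>'_def)
  obtain c where c: "c > 0" and IH:
   "\<And>(X :: 'i \<Rightarrow> 'a set) w g F L. weighted S X w \<Longrightarrow> (\<forall>y. g y \<ge> 0) \<Longrightarrow> F \<subseteq> Pi\<^sub>E S X \<Longrightarrow>
    thin_fibres S X w Q g F L \<Longrightarrow>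
    psum S X w (\<lambda>y. of_bool (y \<in> F) * g y) \<ge> \<beta>' * psum S X w g \<Longrightarrow> psum S X w g > 0 \<Longrightarrow>
    psum S X w (\<lambda>z. of_bool (\<exists>y\<in>F. \<forall>i\<in>S. z i \<in> L y i)) \<ge> c * psum S X w (\<lambda>_. 1)"
    using insert.IH[OF Q \<beta>'] unfolding box_union_bound_def by meson
  show ?case
    unfolding box_union_bound_def
  proof (intro exI[of _ "\<beta>' * c"] conjI allI impI)
    show "\<beta>' * c > 0" using c \<beta>' by simp
    fix X :: "'i \<Rightarrow> 'a set" and w g F and L :: "('i \<Rightarrow> 'a) \<Rightarrow> 'i \<Rightarrow> 'a set"
    let ?S = "insert i0 S"
    assume wX: "weighted ?S X w"
      and g0: "\<forall>y. g y \<ge> 0" and F: "F \<subseteq> Pi\<^sub>E ?S X" and thin: "thin_fibres ?S X w A g F L"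
      and mass: "\<beta> * psum ?S X w g \<le> psum ?S X w (\<lambda>y. of_bool (y \<in> F) * g y)"
      and pos: "0 < psum ?S X w g"
    have fin: "\<forall>i\<in>?S. finite (X i)" and w: "\<forall>i\<in>?S. \<forall>a\<in>X i. w i a \<ge> 0"
      using wX by (auto simp: weighted_def)
    have L: "\<forall>y\<in>F. \<forall>i\<in>?S. y i \<in> L y i \<and> L y i \<subseteq> X i \<and>
         (\<Sum>a\<in>L y i. w i a * g (y(i:=a))) * sum (w i) (X i)
           \<le> A * sum (w i) (L y i) * (\<Sum>a\<in>X i. w i a * g (y(i:=a)))"
      and lam: "\<forall>y\<in>F. \<forall>z\<in>F. \<forall>i\<in>?S. laminar (L y i) (L z i)"
      using thin unfolding thin_fibres_def by blast+
    define M where "M = psum ?S X w g"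
    define W where "W = sum (w i0) (X i0)"
    define g' where "g' = (\<lambda>z. \<Sum>a\<in>X i0. w i0 a * g (z(i0:=a)))"
    have g'0: "\<forall>z. g' z \<ge> 0" unfolding g'_def using w g0 by (auto intro!: sum_nonneg)
    have W0: "W \<ge> 0" unfolding W_def using w by (auto intro: sum_nonneg)
    have Mg': "M = psum S X w g'"
      unfolding M_def g'_def by (rule psum_insert'[OF insert.hyps(1,2)])
    \<comment> \<open>Thinness is known for \<open>g\<close> on each fibre, but the slices carry the
      marginal \<open>g'\<close>. A point is bad in direction \<open>j\<close> if its side there is
      too heavy for \<open>g'\<close>, with \<open>Q\<close> in place of \<open>A\<close>.\<close>
    define bad where "bad = (\<lambda>j y. (\<Sum>a\<in>L y j. w j a * g' (y(j:=a))) * sum (w j) (X j)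
         > Q * sum (w j) (L y j) * (\<Sum>a\<in>X j. w j a * g' (y(j:=a))))"
    have bad_mass: "psum ?S X w (\<lambda>y. of_bool (y \<in> F \<and> bad j y) * g y) \<le> A / Q * M"
      if j: "j \<in> S" for j
    proof -
      have ij: "i0 \<noteq> j" using j insert.hyps(2) by auto
      \<comment> \<open>Fubini with the directions \<open>i0\<close> and \<open>j\<close> isolated:
        for the other coordinates frozen, this is the two-variable setting of
        \<open>bad_pairs_mass\<close>.\<close>
      have rem: "psum ?S X w f = psum (S - {j}) X w
          (\<lambda>z. \<Sum>a\<in>X i0. w i0 a * (\<Sum>b\<in>X j. w j b * f (z(i0:=a, j:=b))))" for f
      proof -
        have "psum ?S X w f = psum S X w (\<lambda>z. \<Sum>a\<in>X i0. w i0 a * f (z(i0:=a)))"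
          by (rule psum_insert'[OF insert.hyps(1,2)])
        also have "\<dots> = psum (S - {j}) X w
            (\<lambda>z. \<Sum>b\<in>X j. w j b * (\<Sum>a\<in>X i0. w i0 a * f (z(i0:=a, j:=b))))"
          using ij by (subst psum_remove[OF insert.hyps(1) j]) (simp add: fun_upd_twist)
        also have "\<dots> = psum (S - {j}) X w
            (\<lambda>z. \<Sum>a\<in>X i0. w i0 a * (\<Sum>b\<in>X j. w j b * f (z(i0:=a, j:=b))))"
          by (intro psum_cong, simp add: sum_distrib_left, subst sum.swap) (simp add: mult_ac)
        finally show ?thesis .
      qed
      have "psum ?S X w (\<lambda>y. of_bool (y \<in> F \<and> bad j y) * g y)
          \<le> psum (S - {j}) X w (\<lambda>z. A / Q *
              (\<Sum>a\<in>X i0. w i0 a * (\<Sum>b\<in>X j. w j b * g (z(i0:=a, j:=b)))))"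
        unfolding rem
      proof (rule psum_mono)
        fix z assume z: "z \<in> Pi\<^sub>E (S - {j}) X"
        let ?y = "\<lambda>a b. z(i0:=a, j:=b)"
        have upd: "(?y a b)(j:=b') = ?y a b'" "(?y a b)(i0:=a') = ?y a' b" for a b a' b'
          using ij by (auto simp: fun_upd_twist)
        have yj: "?y a b j = b" for a b by simp
        show "(\<Sum>a\<in>X i0. w i0 a * (\<Sum>b\<in>X j. w j b * (of_bool (?y a b \<in> F \<and> bad j (?y a b)) * g (?y a b))))
          \<le> A / Q * (\<Sum>a\<in>X i0. w i0 a * (\<Sum>b\<in>X j. w j b * g (?y a b)))"
        proof (rule bad_pairs_mass[where L = "\<lambda>a b. L (?y a b) j"], goal_cases)
          case (8 a b)
          then show ?case using L j yj[of a b] by (metis insert_iff)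
        next
          case (9 a b a' b')
          then show ?case using lam j by auto
        next
          case (10 a b)
          then have y: "?y a b \<in> F" by simp
          with L j have "(\<Sum>b'\<in>L (?y a b) j. w j b' * g ((?y a b)(j:=b'))) * sum (w j) (X j)
              \<le> A * sum (w j) (L (?y a b) j) * (\<Sum>b'\<in>X j. w j b' * g ((?y a b)(j:=b')))"
            by blast
          then show ?case by (simp only: upd)
        next
          case (11 a b)
          then have "bad j (?y a b)" by simp
          then show ?case unfolding bad_def g'_def upd by simp
        qed (use fin w g0 insert.prems Q j in auto)
      qed (use w in auto)
      then show ?thesis by (simp only: psum_cmult rem[of g] M_def)
    qed
    define F' where "F' = {y\<in>F. \<forall>j\<in>S. \<not> bad j y}"
    have "psum ?S X w (\<lambda>y. of_bool (y \<in> F) * g y)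
       \<le> psum ?S X w (\<lambda>y. of_bool (y \<in> F') * g y + (\<Sum>j\<in>S. of_bool (y \<in> F \<and> bad j y) * g y))"
    proof (rule psum_mono)
      fix y
      have nn: "(\<Sum>j\<in>S. of_bool (y \<in> F \<and> bad j y) * g y) \<ge> 0"
        using g0 by (intro sum_nonneg) auto
      show "of_bool (y \<in> F) * g y \<le> of_bool (y \<in> F') * g y + (\<Sum>j\<in>S. of_bool (y \<in> F \<and> bad j y) * g y)"
      proof (cases "y \<in> F \<and> y \<notin> F'")
        case True
        then obtain j where j: "j \<in> S" "bad j y" by (auto simp: F'_def)
        have "of_bool (y \<in> F \<and> bad j y) * g y \<le> (\<Sum>j\<in>S. of_bool (y \<in> F \<and> bad j y) * g y)"
          using g0 by (intro member_le_sum insert.hyps j) auto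
        then show ?thesis using True j by simp
      next
        case False
        then show ?thesis using nn g0 by auto
      qed
    qed (use w in auto)
    also have "\<dots> \<le> psum ?S X w (\<lambda>y. of_bool (y \<in> F') * g y) + real (card S) * (A / Q * M)"
      unfolding psum_add psum_sum using bad_mass by (intro add_left_mono sum_bounded_above) auto
    finally have "\<beta> * M - real (card S) * (A / Q * M) \<le> psum ?S X w (\<lambda>y. of_bool (y \<in> F') * g y)"
      using mass by (simp add: M_def)
    moreover have "real (card S) * (A / Q * M) \<le> \<beta> / 2 * M"
    proof -
      have eq: "A / (2 * k * A / \<beta>) = (\<beta> / 2) / k" if "k > 0" for k
        using that insert.prems by (simp add: field_simps)
      have "A / Q = (\<beta> / 2) / (real (card S) + 1)" unfolding Q_def by (rule eq) simp
      then have "real (card S) * (A / Q * M) = (real (card S) / (real (card S) + 1)) * (\<beta> / 2 * M)"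
        by simp
      also have "\<dots> \<le> 1 * (\<beta> / 2 * M)"
        using insert.prems pos by (intro mult_right_mono) (auto simp: M_def)
      finally show ?thesis by simp
    qed
    ultimately have mF': "\<beta> / 2 * M \<le> psum ?S X w (\<lambda>y. of_bool (y \<in> F') * g y)" by simp
    have F'F: "F' \<subseteq> F" by (auto simp: F'_def)
    \<comment> \<open>The slice at \<open>x\<close> contains \<open>z\<close> if some point of
      \<open>F'\<close> above \<open>z\<close> has \<open>x\<close> in its side in direction
      \<open>i0\<close>. The chosen point \<open>Y x z\<close> lends its other sides to
      \<open>z\<close>, so a point of the slice in these sides lies, once \<open>x\<close> is added,
      in the box of \<open>Y x z\<close>.\<close>
    define R where "R = (\<lambda>x z y. y \<in> F' \<and> y(i0:=undefined) = z \<and> x \<in> L y i0)"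
    define Fx where "Fx = (\<lambda>x. {z \<in> Pi\<^sub>E S X. \<exists>y. R x z y})"
    define Y where "Y = (\<lambda>x z. SOME y. R x z y)"
    have Y: "R x z (Y x z)" if z: "z \<in> Fx x" for x z
    proof -
      obtain y where "R x z y" using z by (auto simp: Fx_def)
      then show ?thesis unfolding Y_def by (rule someI[of "R x z"])
    qed
    have Yu: "(Y x z)(i0:=undefined) = z" if "z \<in> Fx x" for x z
      using Y[OF that] by (simp add: R_def)
    have Yupd: "(Y x z)(i0:=a) = z(i0:=a)" if "z \<in> Fx x" for x z a
      using arg_cong[OF Yu[OF that], of "\<lambda>f. f(i0:=a)"] by simp
    have Yi: "Y x z i = z i" if "z \<in> Fx x" "i \<noteq> i0" for x z i
      using fun_cong[OF Yu[OF that(1)], of i] that(2) by simp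
    define \<phi> where "\<phi> = (\<lambda>x. psum S X w (\<lambda>z. of_bool (z \<in> Fx x) * g' z))"
    \<comment> \<open>For fixed \<open>z\<close>, the sides in direction \<open>i0\<close> through
      the points of \<open>F'\<close> above \<open>z\<close> fill a share of \<open>X i0\<close>
      that is at least \<open>1 / A\<close> times the share of \<open>g' z\<close> carried by
      \<open>F'\<close>. Integration over \<open>z\<close> gives a lower bound for the average of
      \<open>\<phi>\<close>.\<close>
    have sum\<phi>: "W * (\<beta> / 2 * M) \<le> A * (\<Sum>x\<in>X i0. w i0 x * \<phi> x)"
    proof -
      have "W * psum ?S X w (\<lambda>y. of_bool (y \<in> F') * g y)
          = psum S X w (\<lambda>z. W * (\<Sum>a\<in>X i0. w i0 a * (of_bool (z(i0:=a) \<in> F') * g (z(i0:=a)))))"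
        by (simp add: psum_insert'[OF insert.hyps(1,2)] psum_cmult)
      also have "\<dots> \<le> psum S X w (\<lambda>z. A * (\<Sum>x\<in>X i0. w i0 x * (of_bool (z \<in> Fx x) * g' z)))"
      proof (rule psum_mono)
        fix z assume z: "z \<in> Pi\<^sub>E S X"
        have zu: "z(i0:=undefined) = z" using z insert.hyps(2) by (auto simp: PiE_def extensional_def)
        define K where "K = {a\<in>X i0. z(i0:=a) \<in> F'}"
        define \<Lambda> where "\<Lambda> = (\<lambda>a. L (z(i0:=a)) i0) ` K"
        have sub: "\<Union>\<Lambda> \<subseteq> X i0" using L F'F by (auto simp: \<Lambda>_def K_def)
        have fi: "finite (X i0)" using fin by simp
        have KL: "K \<subseteq> \<Union>\<Lambda>"
        proof
          fix a assume a: "a \<in> K"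
          then have "(z(i0:=a)) i0 \<in> L (z(i0:=a)) i0" using L F'F by (force simp: K_def)
          then show "a \<in> \<Union>\<Lambda>" using a by (auto simp: \<Lambda>_def)
        qed
        have Fxz: "z \<in> Fx x" if x: "x \<in> \<Union>\<Lambda>" for x
        proof -
          obtain a where "z(i0:=a) \<in> F'" "x \<in> L (z(i0:=a)) i0"
            using x by (auto simp: \<Lambda>_def K_def)
          then have "R x z (z(i0:=a))" using zu by (simp add: R_def)
          then show ?thesis using z by (auto simp: Fx_def)
        qed
        have "W * (\<Sum>a\<in>X i0. w i0 a * (of_bool (z(i0:=a) \<in> F') * g (z(i0:=a))))
            = (\<Sum>a\<in>K. W * (w i0 a * g (z(i0:=a))))"
          unfolding sum_distrib_left
          by (rule sum.mono_neutral_cong_right) (use fi in \<open>auto simp: K_def\<close>)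
        also have "\<dots> \<le> (\<Sum>a\<in>\<Union>\<Lambda>. W * (w i0 a * g (z(i0:=a))))"
          using KL sub fi w g0 W0 by (intro sum_mono2 finite_subset[OF sub]) (auto intro!: mult_nonneg_nonneg)
        also have "\<dots> \<le> (\<Sum>a\<in>\<Union>\<Lambda>. A * g' z * w i0 a)"
        proof (rule laminar_covering)
          show "finite \<Lambda>" using fi by (simp add: \<Lambda>_def K_def)
          fix P assume P: "P \<in> \<Lambda>"
          then show "finite P" using sub fi by (meson Union_upper finite_subset)
          obtain a where a: "a \<in> K" "P = L (z(i0:=a)) i0" using P by (auto simp: \<Lambda>_def)
          have "z(i0:=a) \<in> F" using a(1) F'F by (auto simp: K_def)
          with L have "(\<Sum>b\<in>P. w i0 b * g ((z(i0:=a))(i0:=b))) * sum (w i0) (X i0)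
           \<le> A * sum (w i0) P * (\<Sum>b\<in>X i0. w i0 b * g ((z(i0:=a))(i0:=b)))"
            unfolding a(2) by blast
          then show "(\<Sum>a\<in>P. W * (w i0 a * g (z(i0:=a)))) \<le> (\<Sum>a\<in>P. A * g' z * w i0 a)"
            unfolding sum_distrib_left[symmetric] W_def g'_def by (simp add: mult_ac)
        next
          fix P P' assume "P \<in> \<Lambda>" "P' \<in> \<Lambda>"
          then show "laminar P P'" using lam F'F by (auto simp: \<Lambda>_def K_def)
        qed
        also have "\<dots> = (\<Sum>x\<in>\<Union>\<Lambda>. A * (w i0 x * (of_bool (z \<in> Fx x) * g' z)))"
          using Fxz by (intro sum.cong) (auto simp: mult_ac)
        also have "\<dots> \<le> (\<Sum>x\<in>X i0. A * (w i0 x * (of_bool (z \<in> Fx x) * g' z)))"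
          using sub fi w g'0 insert.prems by (intro sum_mono2) (auto intro!: mult_nonneg_nonneg)
        finally show "W * (\<Sum>a\<in>X i0. w i0 a * (of_bool (z(i0:=a) \<in> F') * g (z(i0:=a))))
            \<le> A * (\<Sum>x\<in>X i0. w i0 x * (of_bool (z \<in> Fx x) * g' z))"
          by (simp add: sum_distrib_left)
      qed (use w in auto)
      also have "\<dots> = A * (\<Sum>x\<in>X i0. w i0 x * \<phi> x)"
        by (simp add: psum_cmult psum_sum \<phi>_def)
      finally show ?thesis using mult_left_mono[OF mF' W0] by linarith
    qed
    have \<phi>M: "\<phi> x \<le> M" for x
      unfolding \<phi>_def Mg' using w g'0 by (intro psum_mono) auto
    \<comment> \<open>Chebyshev: no slice carries more than \<open>M\<close> and the average is at
      least \<open>2 * \<beta>' * M\<close>, so the slices with at least \<open>\<beta>' * M\<close>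
      have share at least \<open>\<beta>'\<close>.\<close>
    define Gd where "Gd = {x\<in>X i0. \<phi> x \<ge> \<beta>' * M}"
    have Gd: "W * \<beta>' \<le> sum (w i0) Gd"
    proof -
      have fi: "finite (X i0)" using fin by simp
      have "(\<Sum>x\<in>X i0. w i0 x * \<phi> x) \<le> (\<Sum>x\<in>X i0. of_bool (x \<in> Gd) * w i0 x * M + w i0 x * (\<beta>' * M))"
      proof (rule sum_mono)
        fix x assume x: "x \<in> X i0"
        show "w i0 x * \<phi> x \<le> of_bool (x \<in> Gd) * w i0 x * M + w i0 x * (\<beta>' * M)"
        proof (cases "x \<in> Gd")
          case True
          have "w i0 x * \<phi> x \<le> w i0 x * M" using \<phi>M w x by (intro mult_left_mono) auto
          moreover have "w i0 x * (\<beta>' * M) \<ge> 0" using w x \<beta>' pos by (simp add: M_def)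
          ultimately show ?thesis using True by simp
        next
          case False
          then have "\<phi> x \<le> \<beta>' * M" using x by (simp add: Gd_def)
          then show ?thesis using False w x by (auto intro: mult_left_mono)
        qed
      qed
      also have "\<dots> = sum (w i0) Gd * M + W * \<beta>' * M"
      proof -
        have "(\<Sum>x\<in>X i0. of_bool (x \<in> Gd) * w i0 x * M) = (\<Sum>x\<in>Gd. w i0 x * M)"
          by (rule sum.mono_neutral_cong_right) (use fi in \<open>auto simp: Gd_def\<close>)
        also have "\<dots> = sum (w i0) Gd * M" by (simp only: sum_distrib_right)
        moreover have "(\<Sum>x\<in>X i0. w i0 x * (\<beta>' * M)) = W * (\<beta>' * M)"
          by (simp only: W_def sum_distrib_right)
        ultimately show ?thesis by (simp only: sum.distrib mult.assoc)
      qed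
      finally have "A * (\<Sum>x\<in>X i0. w i0 x * \<phi> x) \<le> A * (sum (w i0) Gd * M + W * \<beta>' * M)"
        using insert.prems by (intro mult_left_mono) auto
      with sum\<phi> have "W * (\<beta> / 2 * M) \<le> A * (sum (w i0) Gd * M + W * \<beta>' * M)" by linarith
      moreover have "W * (\<beta> / 2 * M) = 2 * ((A * M) * (W * \<beta>'))"
      proof -
        have "\<beta> = 4 * A * \<beta>'" using insert.prems by (simp add: \<beta>'_def)
        then show ?thesis by simp
      qed
      moreover have "A * (sum (w i0) Gd * M + W * \<beta>' * M)
          = (A * M) * sum (w i0) Gd + (A * M) * (W * \<beta>')"
        by (simp add: algebra_simps)
      ultimately have "(A * M) * (W * \<beta>') \<le> (A * M) * sum (w i0) Gd" by linarith
      then show ?thesis using insert.prems pos by (simp add: M_def)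
    qed
    have Gdmass: "c * psum S X w (\<lambda>_. 1)
        \<le> psum S X w (\<lambda>z. of_bool (\<exists>y\<in>F. \<forall>i\<in>?S. (z(i0:=x)) i \<in> L y i))"
      if x: "x \<in> Gd" for x
    proof -
      have "c * psum S X w (\<lambda>_. 1)
        \<le> psum S X w (\<lambda>z. of_bool (\<exists>y\<in>Fx x. \<forall>i\<in>S. z i \<in> L (Y x y) i))"
      proof (rule IH)
        have fib: "\<forall>y\<in>Fx x. \<forall>i\<in>S. y i \<in> L (Y x y) i \<and> L (Y x y) i \<subseteq> X i \<and>
          (\<Sum>a\<in>L (Y x y) i. w i a * g' (y(i:=a))) * sum (w i) (X i)
          \<le> Q * sum (w i) (L (Y x y) i) * (\<Sum>a\<in>X i. w i a * g' (y(i:=a)))"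
        proof (intro ballI)
          fix z i assume z: "z \<in> Fx x" and i: "i \<in> S"
          have ii: "i \<noteq> i0" using i insert.hyps(2) by auto
          have YF': "Y x z \<in> F'" using Y[OF z] by (simp add: R_def)
          then have YF: "Y x z \<in> F" using F'F by auto
          have 1: "z i \<in> L (Y x z) i \<and> L (Y x z) i \<subseteq> X i"
            using L YF i Yi[OF z ii] by (metis insertCI)
          have "\<not> bad i (Y x z)" using YF' i by (simp add: F'_def)
          moreover have "g' ((Y x z)(i:=a)) = g' (z(i:=a))" for a
            unfolding g'_def using ii Yupd[OF z] by (simp add: fun_upd_twist)
          ultimately show "z i \<in> L (Y x z) i \<and> L (Y x z) i \<subseteq> X i \<and>
            (\<Sum>a\<in>L (Y x z) i. w i a * g' (z(i:=a))) * sum (w i) (X i)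
            \<le> Q * sum (w i) (L (Y x z) i) * (\<Sum>a\<in>X i. w i a * g' (z(i:=a)))"
            using 1 by (simp add: bad_def)
        qed
        have "\<forall>y\<in>Fx x. \<forall>z\<in>Fx x. \<forall>i\<in>S. laminar (L (Y x y) i) (L (Y x z) i)"
        proof (intro ballI)
          fix y z i assume "y \<in> Fx x" "z \<in> Fx x" and i: "i \<in> S"
          then have "Y x y \<in> F" "Y x z \<in> F" using Y F'F unfolding R_def by blast+
          then show "laminar (L (Y x y) i) (L (Y x z) i)" using lam i by blast
        qed
        with fib show "thin_fibres S X w Q g' (Fx x) (\<lambda>z. L (Y x z))"
          unfolding thin_fibres_def by blast
        show "\<beta>' * psum S X w g' \<le> psum S X w (\<lambda>y. of_bool (y \<in> Fx x) * g' y)"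
          using x by (simp add: Gd_def \<phi>_def Mg')
        show "psum S X w g' > 0" using pos Mg' by (simp add: M_def)
      qed (use fin w g'0 in \<open>auto simp: Fx_def weighted_def\<close>)
      also have "\<dots> \<le> psum S X w (\<lambda>z. of_bool (\<exists>y\<in>F. \<forall>i\<in>?S. (z(i0:=x)) i \<in> L y i))"
      proof (rule psum_of_bool_mono)
        fix z assume "\<exists>y\<in>Fx x. \<forall>i\<in>S. z i \<in> L (Y x y) i"
        then obtain y where y: "y \<in> Fx x" "\<forall>i\<in>S. z i \<in> L (Y x y) i" by blast
        have "Y x y \<in> F" "x \<in> L (Y x y) i0" using Y[OF y(1)] F'F by (auto simp: R_def)
        then show "\<exists>y\<in>F. \<forall>i\<in>?S. (z(i0:=x)) i \<in> L y i"
          using y(2) insert.hyps(2) by (intro bexI[of _ "Y x y"]) auto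
      qed (use w in auto)
      finally show ?thesis .
    qed
    have P1: "psum S X w (\<lambda>_. 1) \<ge> 0" using w by (intro psum_nonneg) auto
    have "\<beta>' * c * psum ?S X w (\<lambda>_. 1) = W * \<beta>' * (c * psum S X w (\<lambda>_. 1))"
      by (simp add: psum_insert[OF insert.hyps(1,2)] W_def sum_distrib_right sum_distrib_left mult_ac)
    also have "\<dots> \<le> sum (w i0) Gd * (c * psum S X w (\<lambda>_. 1))"
      using Gd c P1 by (intro mult_right_mono) auto
    also have "\<dots> \<le> (\<Sum>x\<in>Gd. w i0 x * psum S X w (\<lambda>z. of_bool (\<exists>y\<in>F. \<forall>i\<in>?S. (z(i0:=x)) i \<in> L y i)))"
      unfolding sum_distrib_right using Gdmass w by (intro sum_mono mult_left_mono) (auto simp: Gd_def)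
    also have "\<dots> \<le> (\<Sum>x\<in>X i0. w i0 x * psum S X w (\<lambda>z. of_bool (\<exists>y\<in>F. \<forall>i\<in>?S. (z(i0:=x)) i \<in> L y i)))"
      using fin w by (intro sum_mono2) (auto simp: Gd_def intro!: mult_nonneg_nonneg psum_nonneg)
    also have "\<dots> = psum ?S X w (\<lambda>z. of_bool (\<exists>y\<in>F. \<forall>i\<in>?S. z i \<in> L y i))"
      by (simp only: psum_insert[OF insert.hyps(1,2)])
    finally show "\<beta>' * c * psum ?S X w (\<lambda>_. 1)
       \<le> psum ?S X w (\<lambda>z. of_bool (\<exists>y\<in>F. \<forall>i\<in>?S. z i \<in> L y i))" .
  qed
qed

section \<open>The strong maximal estimate at a fixed density\<close>

definition dense_union_bound ::
  "'i set \<Rightarrow> real \<Rightarrow> real \<Rightarrow> ('i \<Rightarrow> 'a set) \<Rightarrow> ('i \<Rightarrow> 'a \<Rightarrow> real) \<Rightarrow> ('i \<Rightarrow> 'a set) set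
     \<Rightarrow> (('i \<Rightarrow> 'a) \<Rightarrow> bool) \<Rightarrow> bool" where
  "dense_union_bound S c C X w \<U> P \<longleftrightarrow>
     (weighted S X w \<longrightarrow> finite \<U> \<longrightarrow> (\<forall>U\<in>\<U>. \<forall>i\<in>S. U i \<subseteq> X i) \<longrightarrow>
      (\<forall>U\<in>\<U>. \<forall>V\<in>\<U>. \<forall>i\<in>S. laminar (U i) (V i)) \<longrightarrow>
      (\<forall>U\<in>\<U>. psum S U w (\<lambda>y. of_bool (P y)) \<ge> c * psum S U w (\<lambda>_. 1)) \<longrightarrow>
      psum S X w (\<lambda>y. of_bool (\<exists>U\<in>\<U>. \<forall>i\<in>S. y i \<in> U i)) \<le> C * psum S X w (\<lambda>y. of_bool (P y)))"

text \<open>One-dimensional coverings are iterated. Half of the density is used to enlarge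
  \<open>P\<close> in direction \<open>i0\<close> to \<open>P'\<close>, at the price of a factor
  \<open>2 / c\<close>; the other half survives as density of \<open>P'\<close> in the slices of the
  boxes. Since \<open>c\<close> is fixed, the loss is a constant.\<close>

lemma dense_union:
  assumes "finite S" "c > 0"
  shows "\<exists>C>0. \<forall>(X :: 'i \<Rightarrow> 'a set) w \<U> P. dense_union_bound S c C X w \<U> P"
  using assms
proof (induction S arbitrary: c rule: finite_induct)
  case empty
  show ?case
    unfolding dense_union_bound_def
  proof (intro exI[of _ 1] conjI allI impI)
    fix X :: "'i \<Rightarrow> 'a set" and w and \<U> :: "('i \<Rightarrow> 'a set) set" and P
    assume "\<forall>U\<in>\<U>. c * psum {} U w (\<lambda>_. 1) \<le> psum {} U w (\<lambda>y. of_bool (P y))"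
    then have "\<U> \<noteq> {} \<Longrightarrow> P (\<lambda>_. undefined)" using empty by auto
    then show "psum {} X w (\<lambda>y. of_bool (\<exists>U\<in>\<U>. \<forall>i\<in>{}. y i \<in> U i))
        \<le> 1 * psum {} X w (\<lambda>y. of_bool (P y))"
      by auto
  qed simp
next
  case (insert i0 S)
  have "c / 2 > 0" using insert.prems by simp
  from insert.IH[OF this] obtain C where C: "C > 0"
    and bound: "\<forall>(X :: 'i \<Rightarrow> 'a set) w \<U> P. dense_union_bound S (c / 2) C X w \<U> P"
    by blast
  have IH: "psum S X w (\<lambda>y. of_bool (\<exists>U\<in>\<U>. \<forall>i\<in>S. y i \<in> U i)) \<le> C * psum S X w (\<lambda>y. of_bool (P y))"
    if "weighted S X w" "finite \<U>" "\<forall>U\<in>\<U>. \<forall>i\<in>S. U i \<subseteq> X i"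
      "\<forall>U\<in>\<U>. \<forall>V\<in>\<U>. \<forall>i\<in>S. laminar (U i) (V i)"
      "\<forall>U\<in>\<U>. c / 2 * psum S U w (\<lambda>_. 1) \<le> psum S U w (\<lambda>y. of_bool (P y))"
    for X :: "'i \<Rightarrow> 'a set" and w \<U> P
    using bound[rule_format, of X w \<U> P] that unfolding dense_union_bound_def by (elim impE)
  let ?S = "insert i0 S"
  show ?case
    unfolding dense_union_bound_def
  proof (intro exI[of _ "C * (2 / c)"] conjI allI impI)
    show "C * (2 / c) > 0" using C insert.prems by simp
    fix X :: "'i \<Rightarrow> 'a set" and w and \<U> :: "('i \<Rightarrow> 'a set) set" and P
    assume wX: "weighted ?S X w" and fU: "finite \<U>" and UX: "\<forall>U\<in>\<U>. \<forall>i\<in>?S. U i \<subseteq> X i"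
      and lam: "\<forall>U\<in>\<U>. \<forall>V\<in>\<U>. \<forall>i\<in>?S. laminar (U i) (V i)"
      and dense: "\<forall>U\<in>\<U>. c * psum ?S U w (\<lambda>_. 1) \<le> psum ?S U w (\<lambda>y. of_bool (P y))"
    have fin: "finite (X i)" and w: "\<And>a. a \<in> X i \<Longrightarrow> w i a \<ge> 0" if "i \<in> ?S" for i
      using wX that by (auto simp: weighted_def)
    define D where "D = (\<lambda>(U::'i \<Rightarrow> 'a set) y. \<Sum>a\<in>U i0. w i0 a * of_bool (P (y(i0:=a))))"
    \<comment> \<open>\<open>P'\<close> collects the sides in direction \<open>i0\<close>, of boxes
      from \<open>\<U>\<close>, along which \<open>P\<close> has density at least
      \<open>c / 2\<close>. As \<open>D U y\<close> does not depend on \<open>y i0\<close>, such a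
      side lies in \<open>P'\<close> entirely.\<close>
    define P' where "P' = (\<lambda>y. \<exists>U\<in>\<U>. y i0 \<in> U i0 \<and> c / 2 * sum (w i0) (U i0) \<le> D U y)"
    have D_upd: "D U (z(i0:=a)) = D U z" for U z a by (simp add: D_def)
    have P'P: "psum ?S X w (\<lambda>y. of_bool (P' y)) \<le> 2 / c * psum ?S X w (\<lambda>y. of_bool (P y))"
    proof -
      have "psum S X w (\<lambda>z. \<Sum>a\<in>X i0. w i0 a * of_bool (P' (z(i0:=a))))
         \<le> psum S X w (\<lambda>z. 2 / c * (\<Sum>a\<in>X i0. w i0 a * of_bool (P (z(i0:=a)))))"
      proof (rule psum_mono)
        fix z assume "z \<in> Pi\<^sub>E S X"
        define \<L> where "\<L> = (\<lambda>U. U i0) ` {U\<in>\<U>. c / 2 * sum (w i0) (U i0) \<le> D U z}"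
        have sub: "\<Union>\<L> \<subseteq> X i0" using UX by (auto simp: \<L>_def)
        have P': "P' (z(i0:=a)) \<longleftrightarrow> a \<in> \<Union>\<L>" for a
          unfolding P'_def D_upd \<L>_def by auto
        have "(\<Sum>a\<in>X i0. w i0 a * of_bool (P' (z(i0:=a)))) = (\<Sum>a\<in>\<Union>\<L>. w i0 a)"
          by (rule sum.mono_neutral_cong_right) (use fin[of i0] sub in \<open>auto simp: P'\<close>)
        also have "\<dots> \<le> (\<Sum>a\<in>\<Union>\<L>. 2 / c * (w i0 a * of_bool (P (z(i0:=a)))))"
        proof (rule laminar_covering)
          show "finite \<L>" using fU by (simp add: \<L>_def)
          fix Q assume Q: "Q \<in> \<L>"
          then show "finite Q" using sub fin[of i0] by (meson Union_upper finite_subset insertI1)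
          from Q obtain U where "U \<in> \<U>" "Q = U i0" "c / 2 * sum (w i0) (U i0) \<le> D U z"
            by (auto simp: \<L>_def)
          then show "sum (w i0) Q \<le> (\<Sum>a\<in>Q. 2 / c * (w i0 a * of_bool (P (z(i0:=a)))))"
            using insert.prems unfolding D_def sum_distrib_left[symmetric] by (simp add: field_simps)
        next
          fix Q R assume "Q \<in> \<L>" "R \<in> \<L>"
          then show "laminar Q R" using lam by (auto simp: \<L>_def)
        qed
        also have "\<dots> \<le> (\<Sum>a\<in>X i0. 2 / c * (w i0 a * of_bool (P (z(i0:=a)))))"
          using sub fin w insert.prems by (intro sum_mono2) auto
        finally show "(\<Sum>a\<in>X i0. w i0 a * of_bool (P' (z(i0:=a))))
           \<le> 2 / c * (\<Sum>a\<in>X i0. w i0 a * of_bool (P (z(i0:=a))))"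
          by (simp only: sum_distrib_left)
      qed (use w in auto)
      then show ?thesis by (simp only: psum_insert'[OF insert.hyps(1,2)] psum_cmult)
    qed
    \<comment> \<open>\<open>D U\<close> is at most \<open>W\<close> and has average at least
      \<open>c * W\<close> over the remaining sides of \<open>U\<close>, so it reaches
      \<open>c / 2 * W\<close> on a share of at least \<open>c / 2\<close> of them.\<close>
    have fibre: "c / 2 * psum S U w (\<lambda>_. 1) \<le> psum S U w (\<lambda>z. of_bool (P' (z(i0:=a))))"
      if U: "U \<in> \<U>" and a: "a \<in> U i0" and wa: "w i0 a > 0" for U a
    proof -
      define W where "W = sum (w i0) (U i0)"
      have finU: "finite (U i0)" using U UX fin[of i0] by (auto intro: finite_subset)
      have wU: "\<And>i b. i \<in> ?S \<Longrightarrow> b \<in> U i \<Longrightarrow> w i b \<ge> 0" using U UX w by blast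
      have "w i0 a \<le> W" unfolding W_def using a finU wU by (intro member_le_sum) auto
      with wa have W: "W > 0" by simp
      have "W * (c * psum S U w (\<lambda>_. 1)) = c * psum ?S U w (\<lambda>_. 1)"
        by (simp only: psum_insert[OF insert.hyps(1,2)] W_def sum_distrib_right mult_ac)
      also have "\<dots> \<le> psum S U w (D U)"
        using dense U unfolding D_def by (simp only: psum_insert'[OF insert.hyps(1,2)])
      also have "\<dots> \<le> psum S U w (\<lambda>z. W * of_bool (P' (z(i0:=a))) + W * (c / 2) * 1)"
      proof (rule psum_mono)
        fix z
        show "D U z \<le> W * of_bool (P' (z(i0:=a))) + W * (c / 2) * 1"
        proof (cases "P' (z(i0:=a))")
          case True
          have "D U z \<le> W" unfolding D_def W_def using wU by (intro sum_mono) auto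
          then show ?thesis using True W insert.prems by (simp add: add_increasing2)
        next
          case False
          then have "\<not> c / 2 * W \<le> D U z"
            using U a unfolding P'_def D_upd W_def by auto
          then show ?thesis using False by (simp add: mult.commute)
        qed
      qed (use wU in auto)
      also have "\<dots> = W * psum S U w (\<lambda>z. of_bool (P' (z(i0:=a)))) + W * (c / 2) * psum S U w (\<lambda>_. 1)"
        by (simp only: psum_add psum_cmult)
      finally have "W * (c / 2 * psum S U w (\<lambda>_. 1)) \<le> W * psum S U w (\<lambda>z. of_bool (P' (z(i0:=a))))"
        by (simp add: algebra_simps)
      then show ?thesis using W by simp
    qed
    have "psum ?S X w (\<lambda>y. of_bool (\<exists>U\<in>\<U>. \<forall>i\<in>?S. y i \<in> U i))
        = (\<Sum>a\<in>X i0. w i0 a * psum S X w (\<lambda>z. of_bool (\<exists>U\<in>{U\<in>\<U>. a \<in> U i0}. \<forall>i\<in>S. z i \<in> U i)))"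
    proof -
      have "(\<forall>i\<in>S. (z(i0:=a)) i \<in> U i) \<longleftrightarrow> (\<forall>i\<in>S. z i \<in> U i)" for z a and U :: "'i \<Rightarrow> 'a set"
        by (rule ball_cong) (use insert.hyps(2) in auto)
      then have "(\<exists>U\<in>\<U>. \<forall>i\<in>?S. (z(i0:=a)) i \<in> U i) \<longleftrightarrow> (\<exists>U\<in>{U\<in>\<U>. a \<in> U i0}. \<forall>i\<in>S. z i \<in> U i)" for z a
        by (simp add: Bex_def conj_assoc)
      then show ?thesis by (simp only: psum_insert[OF insert.hyps(1,2)])
    qed
    also have "\<dots> \<le> (\<Sum>a\<in>X i0. w i0 a * (C * psum S X w (\<lambda>z. of_bool (P' (z(i0:=a))))))"
    proof (rule sum_mono)
      fix a assume a: "a \<in> X i0"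
      show "w i0 a * psum S X w (\<lambda>z. of_bool (\<exists>U\<in>{U\<in>\<U>. a \<in> U i0}. \<forall>i\<in>S. z i \<in> U i))
         \<le> w i0 a * (C * psum S X w (\<lambda>z. of_bool (P' (z(i0:=a)))))"
      proof (cases "w i0 a = 0")
        case False
        then have wa: "w i0 a > 0" using w[of i0 a] a by simp
        show ?thesis
          by (intro mult_left_mono IH)
             (use wX fU UX lam fibre[OF _ _ wa] wa in \<open>auto simp: weighted_def\<close>)
      qed simp
    qed
    also have "\<dots> = C * psum ?S X w (\<lambda>y. of_bool (P' y))"
      by (simp add: psum_insert[OF insert.hyps(1,2)] sum_distrib_left mult_ac)
    also have "\<dots> \<le> C * (2 / c * psum ?S X w (\<lambda>y. of_bool (P y)))"
      using P'P C by (intro mult_left_mono) auto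
    finally show "psum ?S X w (\<lambda>y. of_bool (\<exists>U\<in>\<U>. \<forall>i\<in>?S. y i \<in> U i))
        \<le> C * (2 / c) * psum ?S X w (\<lambda>y. of_bool (P y))"
      by (simp add: mult.assoc)
  qed
qed

lemma psum_box:
  assumes "weighted S X w" "finite S" "\<forall>i\<in>S. U i \<subseteq> X i"
  shows "psum S U w f = psum S X w (\<lambda>y. of_bool (\<forall>i\<in>S. y i \<in> U i) * f y)"
  unfolding psum_def
proof (rule sum.mono_neutral_cong_left)
  show "finite (Pi\<^sub>E S X)" using assms by (intro finite_PiE) (auto simp: weighted_def)
  show "Pi\<^sub>E S U \<subseteq> Pi\<^sub>E S X" using assms(3) by (intro PiE_mono) auto
  show "\<forall>i\<in>Pi\<^sub>E S X - Pi\<^sub>E S U. (\<Prod>j\<in>S. w j (i j)) * (of_bool (\<forall>j\<in>S. i j \<in> U j) * f i) = 0"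
    by (auto simp: PiE_iff)
qed (auto simp: PiE_iff)

definition fmass :: "('i \<Rightarrow> 'a \<Rightarrow> real) \<Rightarrow> (('i \<Rightarrow> 'a) \<Rightarrow> bool) \<Rightarrow> 'i \<Rightarrow> 'a set \<Rightarrow> ('i \<Rightarrow> 'a) \<Rightarrow> real" where
  "fmass w F i Q y = (\<Sum>a\<in>Q. w i a * of_bool (F (y(i:=a))))"

lemma fmass_upd [simp]: "fmass w F i Q (y(i:=a)) = fmass w F i Q y"
  by (simp add: fmass_def)

text \<open>Let \<open>j\<close> be least with density \<open>x / R\<close> at least
  \<open>2 ^ -(j + 1)\<close>; then \<open>x\<close> is at most \<open>2 ^ -j * R\<close>. If no
  \<open>j \<le> l\<close> qualifies, the last summand suffices. It is applied with \<open>R\<close>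
  the measure of a rectangle and \<open>x\<close> that of its part in \<open>F\<close>.\<close>

lemma layer_split:
  fixes x R :: real
  assumes "0 \<le> x" "x \<le> R"
  shows "x \<le> (\<Sum>j\<le>l. (1/2) ^ j * (of_bool (R \<le> 2 ^ (j + 1) * x) * R)) + (1/2) ^ l * R"
proof (cases "R \<le> 2 ^ (l + 1) * x")
  case False
  then have "x \<le> (1/2) ^ l * R" using assms by (simp add: field_simps)
  moreover have "(\<Sum>j\<le>l. (1/2) ^ j * (of_bool (R \<le> 2 ^ (j + 1) * x) * R)) \<ge> 0"
    using assms by (intro sum_nonneg) auto
  ultimately show ?thesis by simp
next
  case True
  define j where "j = (LEAST j. R \<le> 2 ^ (j + 1) * x)"
  have j: "R \<le> 2 ^ (j + 1) * x" unfolding j_def using True by (rule LeastI)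
  have jl: "j \<le> l" unfolding j_def using True by (rule Least_le)
  have "x \<le> (1/2) ^ j * R"
  proof (cases j)
    case 0
    then show ?thesis using assms by simp
  next
    case (Suc i)
    then have "\<not> R \<le> 2 ^ (i + 1) * x" using not_less_Least[of i "\<lambda>j. R \<le> 2 ^ (j + 1) * x"] by (simp add: j_def)
    then show ?thesis using Suc by (simp add: field_simps)
  qed
  also have "\<dots> \<le> (\<Sum>j\<le>l. (1/2) ^ j * (of_bool (R \<le> 2 ^ (j + 1) * x) * R))"
  proof -
    have "(1/2) ^ j * (of_bool (R \<le> 2 ^ (j + 1) * x) * R) \<le> (\<Sum>j\<le>l. (1/2) ^ j * (of_bool (R \<le> 2 ^ (j + 1) * x) * R))"
      using jl assms by (intro member_le_sum) auto
    then show ?thesis using j by simp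
  qed
  also have "\<dots> \<le> \<dots> + (1/2) ^ l * R" using assms by simp
  finally show ?thesis .
qed

section \<open>Zygmund rectangles on a product of finite spaces\<close>

text \<open>Atomic model of a family of Zygmund rectangles. In the application \<open>key\<close> orders the side
  exponents \<open>k\<close> by decreasing \<open>\<Phi> k\<close>, ties by decreasing sum; the two order assumptions are all that
  remains of the monotonicity of \<open>\<Phi>\<close>.\<close>

locale rectangles =
  fixes n :: nat and X :: "nat \<Rightarrow> 'a set" and w :: "nat \<Rightarrow> 'a \<Rightarrow> real"
    and \<G> :: "'r set" and c :: "'r \<Rightarrow> nat \<Rightarrow> 'a set" and key :: "'r \<Rightarrow> 'k::linorder"
  assumes n: "n \<ge> 1" and wX: "weighted {..n} X w" and fin\<G>: "finite \<G>"
    and cX: "\<And>r i. r \<in> \<G> \<Longrightarrow> i \<le> n \<Longrightarrow> c r i \<subseteq> X i"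
    and cpos: "\<And>r i. r \<in> \<G> \<Longrightarrow> i \<le> n \<Longrightarrow> sum (w i) (c r i) > 0"
    and lam: "\<And>r s i. r \<in> \<G> \<Longrightarrow> s \<in> \<G> \<Longrightarrow> i \<le> n \<Longrightarrow> laminar (c r i) (c s i)"
    and order_last: "\<And>r s. r \<in> \<G> \<Longrightarrow> s \<in> \<G> \<Longrightarrow> key s \<le> key r \<Longrightarrow>
        (\<And>i. i \<le> n \<Longrightarrow> c s i \<inter> c r i \<noteq> {}) \<Longrightarrow> c r n \<subseteq> c s n"
    and order_first: "\<And>r s. r \<in> \<G> \<Longrightarrow> s \<in> \<G> \<Longrightarrow> key s \<le> key r \<Longrightarrow>
        (\<And>i. i \<le> n \<Longrightarrow> c s i \<inter> c r i \<noteq> {}) \<Longrightarrow> \<exists>i<n. \<not> c s i \<subset> c r i"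
begin

definition rect :: "'r \<Rightarrow> (nat \<Rightarrow> 'a) \<Rightarrow> bool" where
  "rect r y \<longleftrightarrow> (\<forall>i\<le>n. y i \<in> c r i)"

definition \<mu> :: "((nat \<Rightarrow> 'a) \<Rightarrow> bool) \<Rightarrow> real" where
  "\<mu> P = psum {..n} X w (\<lambda>y. of_bool (P y))"

text \<open>The largest sparsity exponent, capped at \<open>L\<close>, of \<open>F\<close> on the fibre in direction \<open>i\<close>
  through \<open>y\<close>, among the sides of \<open>\<G>\<close> inside \<open>c r i\<close>.\<close>

definition level :: "nat \<Rightarrow> ((nat \<Rightarrow> 'a) \<Rightarrow> bool) \<Rightarrow> nat \<Rightarrow> 'r \<Rightarrow> (nat \<Rightarrow> 'a) \<Rightarrow> nat" where
  "level L F i r y = Max {q. q \<le> L \<and>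
     (\<exists>s\<in>\<G>. y i \<in> c s i \<and> c s i \<subseteq> c r i \<and> 2 ^ q * fmass w F i (c s i) y \<le> sum (w i) (c s i))}"

lemma w_nonneg: "i \<le> n \<Longrightarrow> a \<in> X i \<Longrightarrow> w i a \<ge> 0"
  using wX by (auto simp: weighted_def)

lemma finX: "i \<le> n \<Longrightarrow> finite (X i)"
  using wX by (auto simp: weighted_def)

lemma finc: "r \<in> \<G> \<Longrightarrow> i \<le> n \<Longrightarrow> finite (c r i)"
  using cX finX by (meson finite_subset)

lemma fmass_le: "r \<in> \<G> \<Longrightarrow> i \<le> n \<Longrightarrow> fmass w F i (c r i) y \<le> sum (w i) (c r i)"
  unfolding fmass_def using cX w_nonneg by (intro sum_mono) (auto simp: subset_iff)

lemma fmass_nonneg: "r \<in> \<G> \<Longrightarrow> i \<le> n \<Longrightarrow> fmass w F i (c r i) y \<ge> 0"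
  unfolding fmass_def using cX w_nonneg by (intro sum_nonneg) (auto simp: subset_iff)

lemma \<mu>_mono: "(\<And>y. y \<in> Pi\<^sub>E {..n} X \<Longrightarrow> P y \<Longrightarrow> Q y) \<Longrightarrow> \<mu> P \<le> \<mu> Q"
  unfolding \<mu>_def using w_nonneg by (intro psum_of_bool_mono) auto

lemma \<mu>_nonneg: "\<mu> P \<ge> 0"
  unfolding \<mu>_def using w_nonneg by (intro psum_nonneg) auto

lemma \<mu>_rect_box: "r \<in> \<G> \<Longrightarrow> psum {..n} (c r) w (\<lambda>y. of_bool (P y)) = \<mu> (\<lambda>y. P y \<and> rect r y)"
  using cX by (subst psum_box[OF wX]) (auto simp: \<mu>_def rect_def Ball_def intro!: psum_cong)

lemma \<mu>_or_le: "\<mu> (\<lambda>y. P y \<or> Q y) \<le> \<mu> P + \<mu> Q"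
  unfolding \<mu>_def psum_add[symmetric] using w_nonneg by (intro psum_mono) auto

lemma \<mu>_Ex_le: "finite K \<Longrightarrow> \<mu> (\<lambda>y. \<exists>k\<in>K. P k y) \<le> (\<Sum>k\<in>K. \<mu> (P k))"
proof (induction K rule: finite_induct)
  case empty
  then show ?case by (simp add: \<mu>_def psum_def)
next
  case (insert k K)
  have "\<mu> (\<lambda>y. \<exists>k\<in>insert k K. P k y) \<le> \<mu> (\<lambda>y. P k y \<or> (\<exists>k\<in>K. P k y))"
    by (intro \<mu>_mono) auto
  with \<mu>_or_le[of "P k" "\<lambda>y. \<exists>k\<in>K. P k y"] insert show ?case by simp
qed

section \<open>Comparison of sparsity levels\<close>

context
  fixes L :: nat and F :: "(nat \<Rightarrow> 'a) \<Rightarrow> bool"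
begin

text \<open>The set under \<open>Max\<close> is nonempty: exponent 0 is always attained by the side
  of \<open>r\<close> itself.\<close>

lemma level_witness:
  assumes "r \<in> \<G>" "i \<le> n" "y i \<in> c r i"
  obtains s where "s \<in> \<G>" "y i \<in> c s i" "c s i \<subseteq> c r i"
    "2 ^ level L F i r y * fmass w F i (c s i) y \<le> sum (w i) (c s i)"
proof -
  let ?Q = "{q. q \<le> L \<and> (\<exists>s\<in>\<G>. y i \<in> c s i \<and> c s i \<subseteq> c r i \<and>
      2 ^ q * fmass w F i (c s i) y \<le> sum (w i) (c s i))}"
  have "0 \<in> ?Q" using assms fmass_le[of r i F y] by auto
  then have "Max ?Q \<in> ?Q" by (intro Max_in) (simp, blast)
  then show ?thesis using that by (auto simp: level_def)
qed

lemma level_ge: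
  assumes "q \<le> L" "s \<in> \<G>" "y i \<in> c s i" "c s i \<subseteq> c r i"
    "2 ^ q * fmass w F i (c s i) y \<le> sum (w i) (c s i)"
  shows "q \<le> level L F i r y"
  unfolding level_def using assms by (intro Max_ge) auto

lemma level_le:
  assumes "r \<in> \<G>" "i \<le> n" "y i \<in> c r i"
  shows "level L F i r y \<le> L"
proof -
  let ?Q = "{q. q \<le> L \<and> (\<exists>s\<in>\<G>. y i \<in> c s i \<and> c s i \<subseteq> c r i \<and>
      2 ^ q * fmass w F i (c s i) y \<le> sum (w i) (c s i))}"
  have "0 \<in> ?Q" using assms fmass_le[of r i F y] by auto
  then have "Max ?Q \<in> ?Q" by (intro Max_in) (simp, blast)
  then show ?thesis by (simp add: level_def)
qed

lemma level_mono:
  assumes "r \<in> \<G>" "s \<in> \<G>" "i \<le> n" "y i \<in> c s i" "c s i \<subseteq> c r i"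
  shows "level L F i s y \<le> level L F i r y"
proof -
  obtain t where "t \<in> \<G>" "y i \<in> c t i" "c t i \<subseteq> c s i"
    "2 ^ level L F i s y * fmass w F i (c t i) y \<le> sum (w i) (c t i)"
    by (rule level_witness[of s i y]) (use assms in auto)
  with assms show ?thesis by (intro level_ge[of _ t] level_le) auto
qed

text \<open>Take the side \<open>t\<close> that attains the level of \<open>s\<close>. If it lies in
  \<open>c r i\<close>, then \<open>F\<close> has density at most \<open>2 ^ -q\<close> in
  \<open>t\<close>, with \<open>q\<close> the level of \<open>r\<close>, but more than
  \<open>2 ^ -(q + 1)\<close> in \<open>c r i\<close>, as \<open>q + 1\<close> is below the cap and
  not attained. Otherwise laminarity puts \<open>c r i\<close> inside \<open>t\<close>, hence inside
  \<open>c s i\<close>, and \<open>c r i\<close> itself serves.\<close>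

lemma level_side:
  assumes rs: "r \<in> \<G>" "s \<in> \<G>" and i: "i \<le> n" and y: "y i \<in> c r i" "y i \<in> c s i"
    and le: "level L F i r y \<le> level L F i s y" and small: "level L F i r y < L"
  obtains t where "t \<in> \<G>" "y i \<in> c t i" "c t i \<subseteq> c r i" "c t i \<subseteq> c s i"
    "fmass w F i (c t i) y * sum (w i) (c r i)
       \<le> 2 * sum (w i) (c t i) * fmass w F i (c r i) y"
proof -
  obtain t where t: "t \<in> \<G>" "y i \<in> c t i" "c t i \<subseteq> c s i"
    "2 ^ level L F i s y * fmass w F i (c t i) y \<le> sum (w i) (c t i)"
    by (rule level_witness[of s i y]) (use rs i y in auto)
  show ?thesis
  proof (cases "c t i \<subseteq> c r i")
    case True
    define q where "q = level L F i r y"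
    have "\<not> 2 ^ Suc q * fmass w F i (c r i) y \<le> sum (w i) (c r i)"
      using level_ge[of "Suc q" r y i r] rs y small by (auto simp: q_def)
    then have "sum (w i) (c r i) \<le> 2 * 2 ^ q * fmass w F i (c r i) y" by simp
    then have "fmass w F i (c t i) y * sum (w i) (c r i)
        \<le> fmass w F i (c t i) y * (2 * 2 ^ q * fmass w F i (c r i) y)"
      using fmass_nonneg[OF t(1) i] by (intro mult_left_mono) auto
    also have "\<dots> = (2 ^ q * fmass w F i (c t i) y) * (2 * fmass w F i (c r i) y)" by simp
    also have "\<dots> \<le> sum (w i) (c t i) * (2 * fmass w F i (c r i) y)"
    proof (rule mult_right_mono)
      have "2 ^ q * fmass w F i (c t i) y \<le> 2 ^ level L F i s y * fmass w F i (c t i) y"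
        using le fmass_nonneg[OF t(1) i] by (intro mult_right_mono power_increasing) (auto simp: q_def)
      then show "2 ^ q * fmass w F i (c t i) y \<le> sum (w i) (c t i)" using t(4) by simp
    qed (use fmass_nonneg[OF rs(1) i] in auto)
    finally show ?thesis using that[of t] t True by (simp add: mult_ac)
  next
    case False
    with lam[OF t(1) rs(1) i] t y have "c r i \<subseteq> c t i" by (auto simp: laminar_def)
    with t have "c r i \<subseteq> c s i" by simp
    moreover have "fmass w F i (c r i) y * sum (w i) (c r i)
        \<le> 2 * sum (w i) (c r i) * fmass w F i (c r i) y"
      using fmass_nonneg[OF rs(1) i, of F y] cpos[OF rs(1) i] by simp
    ultimately show ?thesis using that[of r] rs y by simp
  qed
qed

text \<open>The price of the cap. On each fibre the points of level \<open>L\<close> are covered by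
  sides in which \<open>F\<close> has density at most \<open>2 ^ -L\<close>, and laminar covering
  adds these up.\<close>

lemma top_level_mass:
  assumes r: "r \<in> \<G>" and i: "i \<le> n"
  shows "2 ^ L * \<mu> (\<lambda>y. F y \<and> rect r y \<and> level L F i r y = L) \<le> \<mu> (rect r)"
proof -
  define P where "P = (\<lambda>y. F y \<and> level L F i r y = L)"
  define S where "S = {..n} - {i}"
  have iS: "i \<notin> S" "finite S" and S: "{..n} = insert i S" using i by (auto simp: S_def)
  have "2 ^ L * psum S (c r) w (\<lambda>z. \<Sum>a\<in>c r i. w i a * of_bool (P (z(i:=a))))
    = psum S (c r) w (\<lambda>z. 2 ^ L * (\<Sum>a\<in>c r i. w i a * of_bool (P (z(i:=a)))))"
    by (simp only: psum_cmult)
  also have "\<dots> \<le> psum S (c r) w (\<lambda>z. \<Sum>a\<in>c r i. w i a * 1)"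
  proof (rule psum_mono)
    fix z
    define \<L> where "\<L> = (\<lambda>s. c s i) `
      {s\<in>\<G>. c s i \<subseteq> c r i \<and> 2 ^ L * fmass w F i (c s i) z \<le> sum (w i) (c s i)}"
    have sub: "\<Union>\<L> \<subseteq> c r i" by (auto simp: \<L>_def)
    have PL: "a \<in> \<Union>\<L>" if a: "a \<in> c r i" "P (z(i:=a))" for a
    proof -
      obtain s where "s \<in> \<G>" "(z(i:=a)) i \<in> c s i" "c s i \<subseteq> c r i"
        "2 ^ level L F i r (z(i:=a)) * fmass w F i (c s i) (z(i:=a)) \<le> sum (w i) (c s i)"
        by (rule level_witness[of r i "z(i:=a)"]) (use r i a in auto)
      then show ?thesis using a by (auto simp: \<L>_def P_def)
    qed
    have w0: "a \<in> c r i \<Longrightarrow> w i a \<ge> 0" for a using cX[OF r i] w_nonneg[OF i] by auto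
    have "(\<Sum>a\<in>c r i. w i a * of_bool (P (z(i:=a)))) = (\<Sum>a\<in>{a\<in>c r i. P (z(i:=a))}. w i a * of_bool (F (z(i:=a))))"
      by (rule sum.mono_neutral_cong_right) (use finc[OF r i] in \<open>auto simp: P_def\<close>)
    also have "\<dots> \<le> (\<Sum>a\<in>\<Union>\<L>. w i a * of_bool (F (z(i:=a))))"
      using PL w0 sub finc[OF r i] by (intro sum_mono2 finite_subset[OF sub]) auto
    finally have "2 ^ L * (\<Sum>a\<in>c r i. w i a * of_bool (P (z(i:=a)))) \<le> 2 ^ L * (\<Sum>a\<in>\<Union>\<L>. w i a * of_bool (F (z(i:=a))))"
      by (intro mult_left_mono) auto
    also have "\<dots> = (\<Sum>a\<in>\<Union>\<L>. 2 ^ L * (w i a * of_bool (F (z(i:=a)))))" by (rule sum_distrib_left)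
    also have "\<dots> \<le> sum (w i) (\<Union>\<L>)"
    proof (rule laminar_covering)
      show "finite \<L>" using fin\<G> by (simp add: \<L>_def)
      fix Q assume Q: "Q \<in> \<L>"
      then show "finite Q" using sub finc[OF r i] by (meson Union_upper finite_subset)
      show "(\<Sum>a\<in>Q. 2 ^ L * (w i a * of_bool (F (z(i:=a))))) \<le> sum (w i) Q"
        using Q by (auto simp: \<L>_def fmass_def sum_distrib_left)
    next
      fix Q R assume "Q \<in> \<L>" "R \<in> \<L>"
      then show "laminar Q R" using lam i by (auto simp: \<L>_def)
    qed
    also have "\<dots> \<le> (\<Sum>a\<in>c r i. w i a * 1)"
      using sub w0 finc[OF r i] by (auto intro!: sum_mono2)
    finally show "2 ^ L * (\<Sum>a\<in>c r i. w i a * of_bool (P (z(i:=a)))) \<le> (\<Sum>a\<in>c r i. w i a * 1)" .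
  next
    fix j a assume "j \<in> S" "a \<in> c r j"
    then show "0 \<le> w j a" using cX[OF r, of j] w_nonneg[of j a] by (auto simp: S_def)
  qed
  finally have "2 ^ L * psum {..n} (c r) w (\<lambda>y. of_bool (P y)) \<le> psum {..n} (c r) w (\<lambda>y. of_bool True)"
    unfolding S psum_insert'[OF iS(2,1)] by simp
  then show ?thesis unfolding \<mu>_rect_box[OF r] by (simp add: P_def conj_ac)
qed

end

text \<open>The shift is factored out by measuring against direction \<open>n - 1\<close>, the last
  of the first \<open>n\<close>. The remaining \<open>n - 1\<close> differences lie between
  \<open>- L\<close> and \<open>L\<close>, which gives the count of classes.\<close>

definition level_class :: "nat \<Rightarrow> ((nat \<Rightarrow> 'a) \<Rightarrow> bool) \<Rightarrow> 'r \<Rightarrow> (nat \<Rightarrow> 'a) \<Rightarrow> nat \<Rightarrow> int" where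
  "level_class L F r y = (\<lambda>i\<in>{..<n - 1}. int (level L F i r y) - int (level L F (n - 1) r y))"

lemma level_class_range:
  assumes "r \<in> \<G>" "rect r y"
  shows "level_class L F r y \<in> {..<n - 1} \<rightarrow>\<^sub>E {- int L..int L}"
proof -
  have "level L F i r y \<le> L" if "i \<le> n" for i
    using assms that by (intro level_le) (auto simp: rect_def)
  then have "int (level L F i r y) - int (level L F (n - 1) r y) \<in> {- int L..int L}" if "i < n - 1" for i
  proof -
    have "level L F i r y \<le> L" "level L F (n - 1) r y \<le> L"
      using \<open>\<And>i. i \<le> n \<Longrightarrow> level L F i r y \<le> L\<close> that by auto
    then show ?thesis by simp
  qed
  then show ?thesis
    unfolding level_class_def by (intro PiE_I) (auto simp: restrict_def)
qed

text \<open>Within one class the levels are totally ordered by a common shift. A downward shift from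
  \<open>r\<close> to a predecessor \<open>s\<close> would make all first sides of \<open>s\<close> strictly smaller.\<close>

lemma same_class_level:
  assumes rs: "r \<in> \<G>" "s \<in> \<G>" "key s \<le> key r" and y: "rect r y" "rect s y"
    and cl: "level_class L F s y = level_class L F r y" and i: "i < n"
  shows "level L F i r y \<le> level L F i s y"
proof (rule ccontr)
  let ?l = "\<lambda>j r. int (level L F j r y)"
  assume neg: "\<not> level L F i r y \<le> level L F i s y"
  have shift: "?l j s - ?l (n - 1) s = ?l j r - ?l (n - 1) r" if "j < n" for j
  proof (cases "j < n - 1")
    case True
    then show ?thesis using fun_cong[OF cl, of j] by (simp add: level_class_def)
  next
    case False
    then have "j = n - 1" using that by simp
    then show ?thesis by simp
  qed
  have "c s j \<subset> c r j" if j: "j < n" for j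
  proof -
    have "level L F j s y < level L F j r y" using shift[OF i] shift[OF j] neg by linarith
    moreover have "level L F j r y \<le> level L F j s y" if "c r j \<subseteq> c s j"
      using rs y j that by (intro level_mono) (auto simp: rect_def)
    moreover have "laminar (c r j) (c s j)" "y j \<in> c r j" "y j \<in> c s j"
      using lam rs y j by (auto simp: rect_def)
    ultimately show ?thesis by (auto simp: laminar_def)
  qed
  moreover have "\<exists>j<n. \<not> c s j \<subset> c r j"
    using rs y by (intro order_first) (auto simp: rect_def)
  ultimately show False by blast
qed

text \<open>Greedy selection in increasing order of \<open>key\<close>: a rectangle is taken if on at least half of
  its part of \<open>F\<close> its class \<open>cls\<close> is new.\<close>

lemma selection:
  assumes "finite H"
  shows "\<exists>sel\<subseteq>H.
    (\<Sum>r\<in>sel. \<mu> (\<lambda>y. F y \<and> rect r y))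
      \<le> 2 * psum {..n} X w (\<lambda>y. of_bool (F y) * real (card {cls s y |s. s \<in> sel \<and> rect s y})) \<and>
    (\<forall>r\<in>H - sel. \<mu> (\<lambda>y. F y \<and> rect r y)
      \<le> 2 * \<mu> (\<lambda>y. F y \<and> rect r y \<and> (\<exists>s\<in>sel. key s \<le> key r \<and> rect s y \<and> cls s y = cls r y)))"
  using assms
\<comment> \<open>The rule adds elements in increasing order of \<open>key\<close>, so all of
  \<open>sel\<close> precedes \<open>x\<close>.\<close>
proof (induction H rule: finite_ranking_induct[where f = key])
  case empty
  show ?case by (auto simp: psum_def)
next
  case (insert x H)
  then obtain sel where sel: "sel \<subseteq> H"
    and a: "(\<Sum>r\<in>sel. \<mu> (\<lambda>y. F y \<and> rect r y))
      \<le> 2 * psum {..n} X w (\<lambda>y. of_bool (F y) * real (card {cls s y |s. s \<in> sel \<and> rect s y}))"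
    and b: "\<And>r. r \<in> H - sel \<Longrightarrow> \<mu> (\<lambda>y. F y \<and> rect r y)
      \<le> 2 * \<mu> (\<lambda>y. F y \<and> rect r y \<and> (\<exists>s\<in>sel. key s \<le> key r \<and> rect s y \<and> cls s y = cls r y))"
    by blast
  define old where "old = (\<lambda>y. \<exists>s\<in>sel. key s \<le> key x \<and> rect s y \<and> cls s y = cls x y)"
  show ?case
  proof (cases "x \<in> sel \<or> \<mu> (\<lambda>y. F y \<and> rect x y) \<le> 2 * \<mu> (\<lambda>y. F y \<and> rect x y \<and> old y)")
    case True
    then show ?thesis using sel a b unfolding old_def by (intro exI[of _ sel]) blast
  next
    case False
    have fsel: "finite sel" using sel insert.hyps(1) by (rule finite_subset)
    let ?N = "\<lambda>sel y. of_bool (F y) * real (card {cls s y |s. s \<in> sel \<and> rect s y})"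
    have new: "\<mu> (\<lambda>y. F y \<and> rect x y) \<le> 2 * \<mu> (\<lambda>y. F y \<and> rect x y \<and> \<not> old y)"
    proof -
      have "\<mu> (\<lambda>y. F y \<and> rect x y) \<le> \<mu> (\<lambda>y. (F y \<and> rect x y \<and> old y) \<or> (F y \<and> rect x y \<and> \<not> old y))"
        by (intro \<mu>_mono) auto
      also have "\<dots> \<le> \<mu> (\<lambda>y. F y \<and> rect x y \<and> old y) + \<mu> (\<lambda>y. F y \<and> rect x y \<and> \<not> old y)"
        by (rule \<mu>_or_le)
      finally show ?thesis using False by linarith
    qed
    \<comment> \<open>At a point of the new part of \<open>x\<close> the class of \<open>x\<close>
      is not yet represented, so selecting \<open>x\<close> raises the number of classes there by
      one. By \<open>new\<close> this pays for half of the mass of \<open>F\<close> in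
      \<open>x\<close>.\<close>
    have "psum {..n} X w (?N sel) + \<mu> (\<lambda>y. F y \<and> rect x y \<and> \<not> old y) \<le> psum {..n} X w (?N (insert x sel))"
      unfolding \<mu>_def psum_add[symmetric]
    proof (rule psum_mono)
      fix y
      let ?A = "{cls s y |s. s \<in> sel \<and> rect s y}"
      have ins: "{cls s y |s. s \<in> insert x sel \<and> rect s y} = (if rect x y then insert (cls x y) ?A else ?A)"
        by auto
      have fA: "finite ?A" using fsel by simp
      have nin: "cls x y \<notin> ?A" if "\<not> old y"
      proof
        assume "cls x y \<in> ?A"
        then obtain s where "s \<in> sel" "rect s y" "cls s y = cls x y" by auto
        moreover have "key s \<le> key x" using \<open>s \<in> sel\<close> sel insert.hyps(2) by blast
        ultimately show False using that by (auto simp: old_def)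
      qed
      show "?N sel y + of_bool (F y \<and> rect x y \<and> \<not> old y) \<le> ?N (insert x sel) y"
        unfolding ins using fA nin card_insert_le[of ?A "cls x y"] by (auto simp: card_insert_if)
    qed (use w_nonneg in auto)
    moreover have "(\<Sum>r\<in>insert x sel. \<mu> (\<lambda>y. F y \<and> rect r y))
        = \<mu> (\<lambda>y. F y \<and> rect x y) + (\<Sum>r\<in>sel. \<mu> (\<lambda>y. F y \<and> rect r y))"
      using False fsel by simp
    ultimately have A: "(\<Sum>r\<in>insert x sel. \<mu> (\<lambda>y. F y \<and> rect r y)) \<le> 2 * psum {..n} X w (?N (insert x sel))"
      using a new by linarith
    have B: "\<mu> (\<lambda>y. F y \<and> rect r y) \<le> 2 * \<mu> (\<lambda>y. F y \<and> rect r y \<and>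
        (\<exists>s\<in>insert x sel. key s \<le> key r \<and> rect s y \<and> cls s y = cls r y))"
      if "r \<in> insert x H - insert x sel" for r
    proof -
      have "\<mu> (\<lambda>y. F y \<and> rect r y)
        \<le> 2 * \<mu> (\<lambda>y. F y \<and> rect r y \<and> (\<exists>s\<in>sel. key s \<le> key r \<and> rect s y \<and> cls s y = cls r y))"
        using that by (intro b) auto
      also have "\<dots> \<le> 2 * \<mu> (\<lambda>y. F y \<and> rect r y \<and>
        (\<exists>s\<in>insert x sel. key s \<le> key r \<and> rect s y \<and> cls s y = cls r y))"
        by (intro mult_left_mono \<mu>_mono) auto
      finally show ?thesis .
    qed
    show ?thesis using sel A B by (intro exI[of _ "insert x sel"]) auto
  qed
qed

text \<open>At least a quarter of \<open>F\<close> in \<open>r\<close> consists of points below the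
  cap that lie in a selected predecessor of the same class. Some slice in the last direction
  inherits this share. There \<open>level_side\<close> yields thin boxes inside both rectangles, and
  \<open>box_union_mass\<close> makes them fill a share \<open>c0\<close> of the first sides of
  \<open>r\<close>. The last side of each predecessor contains that of \<open>r\<close>, so the
  whole cylinder over such a box is covered.\<close>

lemma dense_in_selected:
  fixes L :: nat
  assumes c0: "\<And>(X::nat\<Rightarrow>'a set) w g F S. box_union_bound {..<n} 2 (1/4) c0 X w g F S"
    and r: "r \<in> \<G>" and sel: "sel \<subseteq> \<G>"
    and dens: "\<mu> (rect r) \<le> 2 ^ j * \<mu> (\<lambda>y. F y \<and> rect r y)" and L: "L = j + n + 2"
    and old: "\<mu> (\<lambda>y. F y \<and> rect r y) \<le> 2 * \<mu> (\<lambda>y. F y \<and> rect r y \<and>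
        (\<exists>s\<in>sel. key s \<le> key r \<and> rect s y \<and> level_class L F s y = level_class L F r y))"
  shows "c0 * psum {..n} (c r) w (\<lambda>_. 1) \<le> psum {..n} (c r) w (\<lambda>y. of_bool (\<exists>s\<in>sel. rect s y))"
proof -
  define m where "m = \<mu> (\<lambda>y. F y \<and> rect r y)"
  define F1 where "F1 = (\<lambda>y. F y \<and> rect r y \<and> (\<forall>i<n. level L F i r y < L) \<and>
      (\<exists>s\<in>sel. key s \<le> key r \<and> rect s y \<and> level_class L F s y = level_class L F r y))"
  have wr: "weighted {..n} (c r) w"
    using finc[OF r] cX[OF r] w_nonneg by (auto simp: weighted_def subset_iff)
  have wr': "weighted {..<n} (c r) w" using wr by (auto simp: weighted_def)
  have w0: "i \<le> n \<Longrightarrow> a \<in> c r i \<Longrightarrow> w i a \<ge> 0" for i a using wr by (auto simp: weighted_def)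
  have insS: "{..n} = insert n {..<n}" "finite {..<n}" "n \<notin> {..<n}" by auto
  have m_pos: "m > 0"
  proof -
    have "\<mu> (rect r) = psum {..n} (c r) w (\<lambda>y. of_bool True)" by (simp only: \<mu>_rect_box[OF r] simp_thms)
    also have "\<dots> = (\<Prod>i\<in>{..n}. sum (w i) (c r i))"
      unfolding psum_def using finc[OF r] by (subst prod_sum_PiE) auto
    also have "\<dots> > 0" using cpos[OF r] by (intro prod_pos) auto
    finally have "2 ^ j * m > 0" using dens by (simp add: m_def)
    then show ?thesis by (simp add: zero_less_mult_iff)
  qed
  have "m \<le> 2 * \<mu> (\<lambda>y. F1 y \<or> (\<exists>i\<in>{..<n}. F y \<and> rect r y \<and> level L F i r y = L))"
  proof -
    have "m \<le> 2 * \<mu> (\<lambda>y. F y \<and> rect r y \<and>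
        (\<exists>s\<in>sel. key s \<le> key r \<and> rect s y \<and> level_class L F s y = level_class L F r y))"
      using old by (simp add: m_def)
    also have "\<dots> \<le> 2 * \<mu> (\<lambda>y. F1 y \<or> (\<exists>i\<in>{..<n}. F y \<and> rect r y \<and> level L F i r y = L))"
    proof (intro mult_left_mono \<mu>_mono)
      fix y assume *: "F y \<and> rect r y \<and>
        (\<exists>s\<in>sel. key s \<le> key r \<and> rect s y \<and> level_class L F s y = level_class L F r y)"
      have "level L F i r y \<le> L" if "i < n" for i
        using * that r by (intro level_le) (auto simp: rect_def)
      then show "F1 y \<or> (\<exists>i\<in>{..<n}. F y \<and> rect r y \<and> level L F i r y = L)"
        using * unfolding F1_def by (metis le_neq_implies_less lessThan_iff)
    qed auto
    finally show ?thesis .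
  qed
  also have "\<dots> \<le> 2 * (\<mu> F1 + (\<Sum>i\<in>{..<n}. \<mu> (\<lambda>y. F y \<and> rect r y \<and> level L F i r y = L)))"
    by (intro mult_left_mono order_trans[OF \<mu>_or_le] add_left_mono \<mu>_Ex_le) auto
  finally have m1: "m \<le> 2 * (\<mu> F1 + (\<Sum>i\<in>{..<n}. \<mu> (\<lambda>y. F y \<and> rect r y \<and> level L F i r y = L)))" .
  \<comment> \<open>With \<open>L = j + n + 2\<close>, density and \<open>top_level_mass\<close>
    bound each capped part by \<open>m / 2 ^ (n + 2)\<close>. As \<open>n < 2 ^ n\<close>, all of
    them take at most \<open>m / 4\<close> of the \<open>m / 2\<close> provided by
    \<open>old\<close>.\<close>
  have "(\<Sum>i\<in>{..<n}. \<mu> (\<lambda>y. F y \<and> rect r y \<and> level L F i r y = L)) \<le> (\<Sum>i\<in>{..<n}. m / 2 ^ (n + 2))"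
  proof (rule sum_mono)
    fix i assume "i \<in> {..<n}"
    then have "2 ^ L * \<mu> (\<lambda>y. F y \<and> rect r y \<and> level L F i r y = L) \<le> 2 ^ j * m"
      using top_level_mass[OF r, of i L F] dens by (simp add: m_def)
    then show "\<mu> (\<lambda>y. F y \<and> rect r y \<and> level L F i r y = L) \<le> m / 2 ^ (n + 2)"
      unfolding L by (simp add: field_simps power_add)
  qed
  also have "\<dots> = real n / 2 ^ n * (m / 4)" by (simp add: power_add field_simps)
  also have "\<dots> \<le> 1 * (m / 4)"
    using m_pos of_nat_less_two_power[of n, where 'a=real] by (intro mult_right_mono) (auto simp: field_simps)
  finally have mF1: "m / 4 \<le> \<mu> F1" using m1 by simp
  have slice: "\<mu> (\<lambda>y. P y \<and> rect r y) = (\<Sum>b\<in>c r n. w n b * psum {..<n} (c r) w (\<lambda>z. of_bool (P (z(n:=b)))))" for P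
    unfolding \<mu>_rect_box[OF r, symmetric] insS(1) by (rule psum_insert[OF insS(2,3)])
  \<comment> \<open>Averaging over the last coordinate. Positivity of the slice has to be secured as
    well: a slice without \<open>F\<close> satisfies the second inequality trivially.\<close>
  have "\<exists>b\<in>c r n. psum {..<n} (c r) w (\<lambda>z. of_bool (F (z(n:=b)))) > 0 \<and>
     1/4 * psum {..<n} (c r) w (\<lambda>z. of_bool (F (z(n:=b)))) \<le> psum {..<n} (c r) w (\<lambda>z. of_bool (F1 (z(n:=b))))"
  proof (rule ccontr)
    assume neg: "\<not> ?thesis"
    let ?f = "\<lambda>b. psum {..<n} (c r) w (\<lambda>z. of_bool (F (z(n:=b))))"
    let ?f1 = "\<lambda>b. psum {..<n} (c r) w (\<lambda>z. of_bool (F1 (z(n:=b))))"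
    have f0: "?f b \<ge> 0" and f10: "?f1 b \<ge> 0" for b using w0 by (auto intro!: psum_nonneg)
    have f1f: "?f1 b \<le> ?f b" for b using w0 by (intro psum_of_bool_mono) (auto simp: F1_def)
    have lt: "?f1 b < 1/4 * ?f b \<or> ?f b = 0 \<and> ?f1 b = 0" if "b \<in> c r n" for b
      using neg that f0[of b] f10[of b] f1f[of b] by force
    have m4: "(\<Sum>b\<in>c r n. w n b * (1/4 * ?f b)) = m / 4"
      unfolding m_def slice sum_divide_distrib by (intro sum.cong) auto
    have "\<exists>b\<in>c r n. w n b * ?f b > 0"
    proof (rule ccontr)
      assume "\<not> ?thesis"
      then have "(\<Sum>b\<in>c r n. w n b * ?f b) \<le> 0" by (intro sum_nonpos) (auto simp: not_less)
      then show False using m_pos unfolding m_def slice by simp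
    qed
    then obtain b0 where b0: "b0 \<in> c r n" "w n b0 * ?f b0 > 0" by blast
    have wb0: "w n b0 > 0" "?f b0 > 0"
      using b0 w0[of n b0] f0[of b0] by (auto simp: zero_less_mult_iff)
    have "(\<Sum>b\<in>c r n. w n b * ?f1 b) < (\<Sum>b\<in>c r n. w n b * (1/4 * ?f b))"
    proof (rule sum_strict_mono_ex1)
      show "\<forall>b\<in>c r n. w n b * ?f1 b \<le> w n b * (1/4 * ?f b)"
        using lt w0[of n] by (intro ballI mult_left_mono) force+
      show "\<exists>b\<in>c r n. w n b * ?f1 b < w n b * (1/4 * ?f b)"
        using b0(1) wb0 lt[OF b0(1)] by (intro bexI[of _ b0] mult_strict_left_mono) auto
    qed (use finc[OF r] in auto)
    moreover have "(\<Sum>b\<in>c r n. w n b * ?f1 b) = \<mu> F1"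
      unfolding slice[symmetric] by (rule arg_cong[of _ _ \<mu>]) (auto simp: F1_def)
    ultimately show False using mF1 m4 by simp
  qed
  then obtain b where b: "b \<in> c r n" and fpos: "psum {..<n} (c r) w (\<lambda>z. of_bool (F (z(n:=b)))) > 0"
    and f1: "1/4 * psum {..<n} (c r) w (\<lambda>z. of_bool (F (z(n:=b))))
       \<le> psum {..<n} (c r) w (\<lambda>z. of_bool (F1 (z(n:=b))))"
    by blast
  define F2 where "F2 = {z \<in> Pi\<^sub>E {..<n} (c r). F1 (z(n:=b))}"
  have "\<forall>z\<in>F2. \<exists>s\<in>sel. key s \<le> key r \<and> rect s (z(n:=b)) \<and>
      level_class L F s (z(n:=b)) = level_class L F r (z(n:=b))"
    by (auto simp: F2_def F1_def)
  then obtain \<sigma> where \<sigma>: "\<And>z. z \<in> F2 \<Longrightarrow> \<sigma> z \<in> sel \<and> key (\<sigma> z) \<le> key r \<and> rect (\<sigma> z) (z(n:=b)) \<and>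
      level_class L F (\<sigma> z) (z(n:=b)) = level_class L F r (z(n:=b))"
    by metis
  have \<sigma>\<G>: "\<sigma> z \<in> \<G>" if "z \<in> F2" for z using \<sigma>[OF that] sel by auto
  have rz: "rect r (z(n:=b))" if "z \<in> F2" for z using that by (auto simp: F2_def F1_def)
  \<comment> \<open>Equal classes order the levels, and those of \<open>r\<close> are below the cap
    on \<open>F2\<close>, so \<open>level_side\<close> applies in each of the first directions. Its
    factor 2 is the thinness constant in \<open>c0\<close>.\<close>
  have "\<exists>t\<in>\<G>. z i \<in> c t i \<and> c t i \<subseteq> c r i \<and> c t i \<subseteq> c (\<sigma> z) i \<and>
      fmass w F i (c t i) (z(n:=b)) * sum (w i) (c r i)
        \<le> 2 * sum (w i) (c t i) * fmass w F i (c r i) (z(n:=b))"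
    if z: "z \<in> F2" and i: "i < n" for z i
  proof -
    obtain t where "t \<in> \<G>" "(z(n:=b)) i \<in> c t i" "c t i \<subseteq> c r i" "c t i \<subseteq> c (\<sigma> z) i"
      "fmass w F i (c t i) (z(n:=b)) * sum (w i) (c r i)
         \<le> 2 * sum (w i) (c t i) * fmass w F i (c r i) (z(n:=b))"
    proof (rule level_side[OF r \<sigma>\<G>[OF z]])
      show "level L F i r (z(n:=b)) \<le> level L F i (\<sigma> z) (z(n:=b))"
        using same_class_level[OF r \<sigma>\<G>[OF z]] \<sigma>[OF z] rz[OF z] i by blast
      show "level L F i r (z(n:=b)) < L" using z i by (auto simp: F2_def F1_def)
      show "(z(n:=b)) i \<in> c r i" using rz[OF z] i unfolding rect_def by (meson less_imp_le)
      show "(z(n:=b)) i \<in> c (\<sigma> z) i" using \<sigma>[OF z] i unfolding rect_def by (meson less_imp_le)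
    qed (use i in auto)
    then show ?thesis using i by auto
  qed
  then obtain \<tau> where \<tau>: "\<And>z i. z \<in> F2 \<Longrightarrow> i < n \<Longrightarrow> \<tau> z i \<in> \<G> \<and> z i \<in> c (\<tau> z i) i \<and>
      c (\<tau> z i) i \<subseteq> c r i \<and> c (\<tau> z i) i \<subseteq> c (\<sigma> z) i \<and>
      fmass w F i (c (\<tau> z i) i) (z(n:=b)) * sum (w i) (c r i)
        \<le> 2 * sum (w i) (c (\<tau> z i) i) * fmass w F i (c r i) (z(n:=b))"
    by metis
  have fm: "fmass w F i Q (z(n:=b)) = (\<Sum>a\<in>Q. w i a * of_bool (F ((z(i:=a))(n:=b))))" if "i < n" for i Q z
    using that by (simp add: fmass_def fun_upd_twist)
  have "c0 * psum {..<n} (c r) w (\<lambda>_. 1)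
     \<le> psum {..<n} (c r) w (\<lambda>z. of_bool (\<exists>y\<in>F2. \<forall>i\<in>{..<n}. z i \<in> c (\<tau> y i) i))"
  proof (rule c0[unfolded box_union_bound_def, rule_format])
    show "thin_fibres {..<n} (c r) w 2 (\<lambda>z. of_bool (F (z(n:=b)))) F2 (\<lambda>z i. c (\<tau> z i) i)"
      unfolding thin_fibres_def
    proof (intro conjI ballI)
      fix y z i assume "y \<in> F2" "z \<in> F2" "i \<in> {..<n}"
      then show "laminar (c (\<tau> y i) i) (c (\<tau> z i) i)" using \<tau> lam by auto
    next
      fix y i assume "y \<in> F2" "i \<in> {..<n}"
      then show "(\<Sum>a\<in>c (\<tau> y i) i. w i a * of_bool (F ((y(i:=a))(n:=b)))) * sum (w i) (c r i)
        \<le> 2 * sum (w i) (c (\<tau> y i) i) * (\<Sum>a\<in>c r i. w i a * of_bool (F ((y(i:=a))(n:=b))))"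
        using \<tau>[of y i] by (auto simp: fm)
    qed (use \<tau> in auto)
    have "psum {..<n} (c r) w (\<lambda>z. of_bool (F1 (z(n:=b))))
        = psum {..<n} (c r) w (\<lambda>y. of_bool (y \<in> F2) * of_bool (F (y(n:=b))))"
      by (intro psum_cong) (auto simp: F2_def F1_def)
    then show "1/4 * psum {..<n} (c r) w (\<lambda>z. of_bool (F (z(n:=b))))
        \<le> psum {..<n} (c r) w (\<lambda>y. of_bool (y \<in> F2) * of_bool (F (y(n:=b))))"
      using f1 by simp
  qed (use wr' fpos in \<open>auto simp: F2_def\<close>)
  \<comment> \<open>\<open>order_last\<close> makes the dependence on the slice \<open>b\<close>
    disappear: a predecessor found there contains the points above its box for every
    \<open>b'\<close> in \<open>c r n\<close>.\<close>
  also have "\<dots> \<le> psum {..<n} (c r) w (\<lambda>z. of_bool (\<forall>b'\<in>c r n. \<exists>s\<in>sel. rect s (z(n:=b'))))"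
  proof (rule psum_of_bool_mono)
    fix z assume "\<exists>y\<in>F2. \<forall>i\<in>{..<n}. z i \<in> c (\<tau> y i) i"
    then obtain y where y: "y \<in> F2" "\<And>i. i < n \<Longrightarrow> z i \<in> c (\<tau> y i) i" by auto
    have "c r n \<subseteq> c (\<sigma> y) n"
      using r \<sigma>\<G>[OF y(1)] \<sigma>[OF y(1)] rz[OF y(1)] by (intro order_last) (auto simp: rect_def)
    then have "rect (\<sigma> y) (z(n:=b'))" if "b' \<in> c r n" for b'
      using y(2) \<tau>[OF y(1)] that by (auto simp: rect_def) (metis le_neq_implies_less subsetD)
    then show "\<forall>b'\<in>c r n. \<exists>s\<in>sel. rect s (z(n:=b'))" using \<sigma>[OF y(1)] by blast
  qed (use w0 in auto)
  finally have *: "c0 * psum {..<n} (c r) w (\<lambda>_. 1)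
    \<le> psum {..<n} (c r) w (\<lambda>z. of_bool (\<forall>b'\<in>c r n. \<exists>s\<in>sel. rect s (z(n:=b'))))" .
  have "c0 * psum {..n} (c r) w (\<lambda>_. 1) = (\<Sum>b\<in>c r n. w n b * (c0 * psum {..<n} (c r) w (\<lambda>_. 1)))"
    unfolding insS(1) psum_insert[OF insS(2,3)] sum_distrib_left by (simp add: mult_ac)
  also have "\<dots> \<le> (\<Sum>b\<in>c r n. w n b * psum {..<n} (c r) w (\<lambda>z. of_bool (\<exists>s\<in>sel. rect s (z(n:=b)))))"
    using w0 by (intro sum_mono mult_left_mono order_trans[OF *] psum_of_bool_mono) auto
  also have "\<dots> = psum {..n} (c r) w (\<lambda>y. of_bool (\<exists>s\<in>sel. rect s y))"
    unfolding insS(1) by (rule psum_insert[OF insS(2,3), symmetric])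
  finally show ?thesis .
qed

text \<open>Every rectangle of \<open>H\<close> has a share \<open>c0\<close> in the selected union,
  so \<open>dense_union\<close> reduces the claim to that union. The latter is bounded by the sum of
  its measures: density converts this into mass of \<open>F\<close>, at cost \<open>2 ^ j\<close>,
  and the selection bounds that mass by the number of classes at each point of
  \<open>F\<close>.\<close>

lemma weak_type:
  assumes c0: "\<And>(X::nat\<Rightarrow>'a set) w g F S. box_union_bound {..<n} 2 (1/4) c0 X w g F S"
    and c0_le: "0 < c0" "c0 \<le> 1"
    and C0: "\<And>(X::nat\<Rightarrow>'a set) w \<U> P. dense_union_bound {..n} c0 C0 X w \<U> P" and C0_pos: "0 < C0"
    and H: "H \<subseteq> \<G>" and dens: "\<And>r. r \<in> H \<Longrightarrow> \<mu> (rect r) \<le> 2 ^ j * \<mu> (\<lambda>y. F y \<and> rect r y)"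
  shows "\<mu> (\<lambda>y. \<exists>r\<in>H. rect r y) \<le> C0 * 2 ^ j * (2 * (2 * real (j + n + 2) + 1) ^ (n - 1) * \<mu> F)"
proof -
  define L where "L = j + n + 2"
  have fH: "finite H" using H fin\<G> by (rule finite_subset)
  have HG: "r \<in> \<G>" if "r \<in> H" for r using H that by auto
  obtain sel where sel: "sel \<subseteq> H"
    and a: "(\<Sum>r\<in>sel. \<mu> (\<lambda>y. F y \<and> rect r y)) \<le> 2 * psum {..n} X w
       (\<lambda>y. of_bool (F y) * real (card {level_class L F s y |s. s \<in> sel \<and> rect s y}))"
    and b: "\<And>r. r \<in> H - sel \<Longrightarrow> \<mu> (\<lambda>y. F y \<and> rect r y) \<le> 2 * \<mu> (\<lambda>y. F y \<and> rect r y \<and>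
       (\<exists>s\<in>sel. key s \<le> key r \<and> rect s y \<and> level_class L F s y = level_class L F r y))"
    using selection[OF fH, of F "level_class L F"] by blast
  define P where "P = (\<lambda>y. \<exists>s\<in>sel. rect s y)"
  have "\<mu> (\<lambda>y. \<exists>U\<in>c ` H. \<forall>i\<in>{..n}. y i \<in> U i) \<le> C0 * \<mu> P"
    unfolding \<mu>_def
  proof (rule C0[unfolded dense_union_bound_def, rule_format])
    fix U assume "U \<in> c ` H"
    then obtain r where r: "r \<in> H" "U = c r" by auto
    have rG: "r \<in> \<G>" using r H by auto
    show "c0 * psum {..n} U w (\<lambda>_. 1) \<le> psum {..n} U w (\<lambda>y. of_bool (P y))"
    proof (cases "r \<in> sel")
      case True
      have w0: "w i a \<ge> 0" if "i \<in> {..n}" "a \<in> c r i" for i a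
        using that cX[OF rG, of i] w_nonneg[of i a] by auto
      have "psum {..n} (c r) w (\<lambda>_. 1) \<le> psum {..n} (c r) w (\<lambda>y. of_bool (P y))"
        using True w0 by (intro psum_mono) (auto simp: P_def rect_def PiE_iff)
      moreover have "c0 * psum {..n} (c r) w (\<lambda>_. 1) \<le> 1 * psum {..n} (c r) w (\<lambda>_. 1)"
        using c0_le w0 by (intro mult_right_mono psum_nonneg) auto
      ultimately show ?thesis by (simp add: r)
    next
      case False
      then show ?thesis
        unfolding r P_def using dense_in_selected[OF c0 rG _ dens[OF r(1)] L_def b] sel H r(1) by blast
    qed
  qed (use wX fH HG cX lam in auto)
  also have "(\<lambda>y. \<exists>U\<in>c ` H. \<forall>i\<in>{..n}. y i \<in> U i) = (\<lambda>y. \<exists>r\<in>H. rect r y)"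
    by (auto simp: rect_def)
  finally have 1: "\<mu> (\<lambda>y. \<exists>r\<in>H. rect r y) \<le> C0 * \<mu> P" .
  have "\<mu> P \<le> (\<Sum>r\<in>sel. \<mu> (rect r))"
    unfolding P_def using finite_subset[OF sel fH] by (rule \<mu>_Ex_le)
  also have "\<dots> \<le> (\<Sum>r\<in>sel. 2 ^ j * \<mu> (\<lambda>y. F y \<and> rect r y))"
    using sel dens by (intro sum_mono) auto
  also have "\<dots> \<le> 2 ^ j * (2 * psum {..n} X w
       (\<lambda>y. of_bool (F y) * real (card {level_class L F s y |s. s \<in> sel \<and> rect s y})))"
    unfolding sum_distrib_left[symmetric] using a by (intro mult_left_mono) auto
  also have "\<dots> \<le> 2 ^ j * (2 * psum {..n} X w (\<lambda>y. (2 * real L + 1) ^ (n - 1) * of_bool (F y)))"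
  proof (intro mult_left_mono psum_mono)
    fix y
    have "{level_class L F s y |s. s \<in> sel \<and> rect s y} \<subseteq> {..<n - 1} \<rightarrow>\<^sub>E {- int L..int L}"
    proof
      fix \<kappa> assume "\<kappa> \<in> {level_class L F s y |s. s \<in> sel \<and> rect s y}"
      then obtain s where "s \<in> sel" "rect s y" "\<kappa> = level_class L F s y" by auto
      then show "\<kappa> \<in> {..<n - 1} \<rightarrow>\<^sub>E {- int L..int L}"
        using level_class_range[of s y L F] sel HG by auto
    qed
    then have "card {level_class L F s y |s. s \<in> sel \<and> rect s y} \<le> card ({..<n - 1} \<rightarrow>\<^sub>E {- int L..int L})"
      by (intro card_mono finite_PiE) auto
    also have "\<dots> = (2 * L + 1) ^ (n - 1)" by (simp add: card_PiE nat_add_distrib nat_mult_distrib)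
    finally have "real (card {level_class L F s y |s. s \<in> sel \<and> rect s y}) \<le> real ((2 * L + 1) ^ (n - 1))"
      by (rule of_nat_mono)
    then show "of_bool (F y) * real (card {level_class L F s y |s. s \<in> sel \<and> rect s y})
        \<le> (2 * real L + 1) ^ (n - 1) * of_bool (F y)" by (auto simp: add.commute)
  qed (use w_nonneg in auto)
  also have "\<dots> = 2 ^ j * (2 * (2 * real L + 1) ^ (n - 1) * \<mu> F)"
    by (simp only: psum_cmult \<mu>_def mult.assoc)
  finally have "C0 * \<mu> P \<le> C0 * (2 ^ j * (2 * (2 * real L + 1) ^ (n - 1) * \<mu> F))"
    using C0_pos by (intro mult_left_mono) auto
  with 1 show ?thesis unfolding L_def by (simp only: mult.assoc)
qed

section \<open>Distribution of the overlap\<close>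

definition overlap :: "(nat \<Rightarrow> 'a) \<Rightarrow> nat" where
  "overlap y = card {r\<in>\<G>. rect r y}"

text \<open>The overlap is integrated over the superlevel set \<open>F\<close>. In layer
  \<open>j\<close> the weight \<open>2 ^ -j\<close> cancels the \<open>2 ^ j\<close> of
  \<open>weak_type\<close>, so each of the \<open>l + 1\<close> layers contributes at most a
  multiple of \<open>(l + 2) ^ (n - 1) * \<mu> F\<close>. The sparse remainder is controlled by the
  shadow, hence by \<open>\<mu> F\<close> if the claim fails.\<close>

lemma overlap_tail:
  fixes l :: nat
  assumes c0: "\<And>(X::nat\<Rightarrow>'a set) w g F S. box_union_bound {..<n} 2 (1/4) c0 X w g F S"
    and c0_le: "0 < c0" "c0 \<le> 1"
    and C0: "\<And>(X::nat\<Rightarrow>'a set) w \<U> P. dense_union_bound {..n} c0 C0 X w \<U> P" and C0_pos: "0 < C0"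
    and \<Lambda>: "\<Lambda> > 0"
    and carleson: "\<And>H. H \<subseteq> \<G> \<Longrightarrow> (\<Sum>r\<in>H. \<mu> (rect r)) \<le> \<Lambda> * \<mu> (\<lambda>y. \<exists>r\<in>H. rect r y)"
  shows "\<mu> (\<lambda>y. \<Lambda> * (4 * C0 * (2 * real n + 7) ^ (n - 1) + 1) * (real l + 2) ^ n < real (overlap y))
    \<le> (1/2) ^ l * \<mu> (\<lambda>y. \<exists>r\<in>\<G>. rect r y)"
proof (rule ccontr)
  \<comment> \<open>The 4 joins the 2 of \<open>weak_type\<close> with the 2 in
    \<open>2 ^ (j + 1) = 2 * 2 ^ j\<close>. The class count at density exponent \<open>j + 1\<close>
    has base \<open>2 * j + 2 * n + 7\<close>, at most \<open>(2 * n + 7) * (l + 2)\<close>.\<close>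
  define D where "D = 4 * C0 * (2 * real n + 7) ^ (n - 1)"
  define F where "F = (\<lambda>y. \<Lambda> * (D + 1) * (real l + 2) ^ n < real (overlap y))"
  define sh where "sh = \<mu> (\<lambda>y. \<exists>r\<in>\<G>. rect r y)"
  assume "\<not> ?thesis"
  then have F_big: "(1/2) ^ l * sh < \<mu> F" by (simp add: F_def D_def sh_def)
  have sh0: "sh \<ge> 0" by (simp add: sh_def \<mu>_nonneg)
  have F0: "\<mu> F > 0" using F_big sh0 by (meson le_less_trans mult_nonneg_nonneg zero_le_power zero_le_divide_1_iff zero_le_numeral)
  have D0: "D \<ge> 0" using C0_pos by (simp add: D_def)
  define HH where "HH = (\<lambda>j. {r\<in>\<G>. \<mu> (rect r) \<le> 2 ^ (j + 1) * \<mu> (\<lambda>y. F y \<and> rect r y)})"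
  have "\<Lambda> * (D + 1) * (real l + 2) ^ n * \<mu> F \<le> psum {..n} X w (\<lambda>y. \<Sum>r\<in>\<G>. of_bool (F y \<and> rect r y))"
    unfolding \<mu>_def psum_cmult[symmetric]
  proof (rule psum_mono)
    fix y
    have "(\<Sum>r\<in>\<G>. of_bool (F y \<and> rect r y)) = (of_bool (F y) * real (overlap y) :: real)"
      unfolding overlap_def using fin\<G> by (auto simp: sum.If_cases Int_def of_bool_def)
    then show "\<Lambda> * (D + 1) * (real l + 2) ^ n * of_bool (F y) \<le> (\<Sum>r\<in>\<G>. of_bool (F y \<and> rect r y))"
      by (auto simp: F_def)
  qed (use w_nonneg in auto)
  also have "\<dots> = (\<Sum>r\<in>\<G>. \<mu> (\<lambda>y. F y \<and> rect r y))" by (simp only: psum_sum \<mu>_def)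
  also have "\<dots> \<le> (\<Sum>r\<in>\<G>. (\<Sum>j\<le>l. (1/2) ^ j * (of_bool (r \<in> HH j) * \<mu> (rect r))) + (1/2) ^ l * \<mu> (rect r))"
  proof (rule sum_mono)
    fix r assume "r \<in> \<G>"
    have le: "\<mu> (\<lambda>y. F y \<and> rect r y) \<le> \<mu> (rect r)" by (rule \<mu>_mono) simp
    show "\<mu> (\<lambda>y. F y \<and> rect r y) \<le> (\<Sum>j\<le>l. (1/2) ^ j * (of_bool (r \<in> HH j) * \<mu> (rect r))) + (1/2) ^ l * \<mu> (rect r)"
      using layer_split[OF \<mu>_nonneg le, of l] \<open>r \<in> \<G>\<close> by (simp add: HH_def)
  qed
  also have "\<dots> = (\<Sum>j\<le>l. (1/2) ^ j * (\<Sum>r\<in>HH j. \<mu> (rect r))) + (1/2) ^ l * (\<Sum>r\<in>\<G>. \<mu> (rect r))"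
  proof -
    have "(\<Sum>r\<in>\<G>. of_bool (r \<in> HH j) * \<mu> (rect r)) = (\<Sum>r\<in>HH j. \<mu> (rect r))" for j
      by (rule sum.mono_neutral_cong_right) (use fin\<G> in \<open>auto simp: HH_def\<close>)
    then have "(\<Sum>r\<in>\<G>. \<Sum>j\<le>l. (1/2) ^ j * (of_bool (r \<in> HH j) * \<mu> (rect r))) = (\<Sum>j\<le>l. (1/2) ^ j * (\<Sum>r\<in>HH j. \<mu> (rect r)))"
      by (subst sum.swap) (simp only: sum_distrib_left[symmetric])
    then show ?thesis by (simp only: sum.distrib sum_distrib_left)
  qed
  also have "\<dots> \<le> (\<Sum>j\<le>l. \<Lambda> * D * (real l + 2) ^ (n - 1) * \<mu> F) + (1/2) ^ l * (\<Lambda> * sh)"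
  proof (intro add_mono sum_mono mult_left_mono)
    fix j assume j: "j \<in> {..l}"
    have "(\<Sum>r\<in>HH j. \<mu> (rect r)) \<le> \<Lambda> * \<mu> (\<lambda>y. \<exists>r\<in>HH j. rect r y)"
      by (rule carleson) (auto simp: HH_def)
    also have "\<dots> \<le> \<Lambda> * (C0 * 2 ^ (j + 1) * (2 * (2 * real (j + 1 + n + 2) + 1) ^ (n - 1) * \<mu> F))"
      using \<Lambda> by (intro mult_left_mono weak_type[OF c0 c0_le C0 C0_pos]) (auto simp: HH_def)
    also have "\<dots> \<le> \<Lambda> * (C0 * 2 ^ (j + 1) * (2 * ((2 * real n + 7) * (real l + 2)) ^ (n - 1) * \<mu> F))"
    proof -
      have "2 * real (j + 1 + n + 2) + 1 \<le> 2 * real l + 2 * real n + 7" using j by simp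
      also have "\<dots> \<le> (2 * real n + 7) * (real l + 2)" by (simp add: algebra_simps)
      finally show ?thesis
        using \<Lambda> C0_pos \<mu>_nonneg by (intro mult_left_mono mult_right_mono power_mono) auto
    qed
    also have "\<dots> = 2 ^ j * (\<Lambda> * D * (real l + 2) ^ (n - 1) * \<mu> F)"
      by (simp add: D_def power_mult_distrib)
    finally show "(1/2) ^ j * (\<Sum>r\<in>HH j. \<mu> (rect r)) \<le> \<Lambda> * D * (real l + 2) ^ (n - 1) * \<mu> F"
      by (simp add: power_one_over field_simps)
  qed (use carleson[of \<G>] in \<open>auto simp: sh_def\<close>)
  also have "\<dots> = (real l + 1) * (\<Lambda> * D * (real l + 2) ^ (n - 1) * \<mu> F) + \<Lambda> * ((1/2) ^ l * sh)"
    by simp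
  \<comment> \<open>The negated claim, \<open>2 ^ -l * sh < \<mu> F\<close>, absorbs the remainder;
    this is what the \<open>+ 1\<close> next to \<open>D\<close> pays for.\<close>
  also have "\<dots> < (real l + 2) * (\<Lambda> * D * (real l + 2) ^ (n - 1) * \<mu> F) + \<Lambda> * ((real l + 2) ^ n * \<mu> F)"
  proof (rule add_le_less_mono)
    show "(real l + 1) * (\<Lambda> * D * (real l + 2) ^ (n - 1) * \<mu> F) \<le> (real l + 2) * (\<Lambda> * D * (real l + 2) ^ (n - 1) * \<mu> F)"
      using \<Lambda> D0 F0 by (intro mult_right_mono) auto
    have "1 * \<mu> F \<le> (real l + 2) ^ n * \<mu> F"
      using F0 by (intro mult_right_mono one_le_power) auto
    then show "\<Lambda> * ((1/2) ^ l * sh) < \<Lambda> * ((real l + 2) ^ n * \<mu> F)"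
      using F_big \<Lambda> by (intro mult_strict_left_mono) auto
  qed
  also have "\<dots> = \<Lambda> * (D + 1) * (real l + 2) ^ n * \<mu> F"
  proof -
    have "(real l + 2) ^ n = (real l + 2) * (real l + 2) ^ (n - 1)" using n by (cases n) auto
    then show ?thesis by (simp add: algebra_simps)
  qed
  finally show False by simp
qed

end

text \<open>The constants are assembled outside the locale, since \<open>A\<close> has to be fixed
  before spaces, weights and rectangles.\<close>

lemma rectangles_tail:
  assumes "\<Lambda> > 0"
  shows "\<exists>A>0. \<forall>(X :: nat \<Rightarrow> 'a set) w (\<G> :: 'r set) c (key :: 'r \<Rightarrow> 'k::linorder) (l::nat).
    rectangles n X w \<G> c key \<longrightarrow>
    (\<forall>H\<subseteq>\<G>. (\<Sum>r\<in>H. psum {..n} X w (\<lambda>y. of_bool (\<forall>i\<le>n. y i \<in> c r i)))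
        \<le> \<Lambda> * psum {..n} X w (\<lambda>y. of_bool (\<exists>r\<in>H. \<forall>i\<le>n. y i \<in> c r i))) \<longrightarrow>
    psum {..n} X w (\<lambda>y. of_bool (A * (real l + 2) ^ n < real (card {r\<in>\<G>. \<forall>i\<le>n. y i \<in> c r i})))
      \<le> (1/2) ^ l * psum {..n} X w (\<lambda>y. of_bool (\<exists>r\<in>\<G>. \<forall>i\<le>n. y i \<in> c r i))"
proof -
  obtain c1 where c1: "c1 > 0" "\<forall>(X :: nat \<Rightarrow> 'a set) w g F L. box_union_bound {..<n} 2 (1/4) c1 X w g F L"
    using box_union_mass[of "{..<n}" 2 "1/4"] by auto
  \<comment> \<open>Capped at 1 because a selected rectangle passes the density test only through
    its full density 1.\<close>
  define c0 where "c0 = min c1 1"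
  have c0: "0 < c0" "c0 \<le> 1" "c0 \<le> c1" using c1(1) by (auto simp: c0_def)
  have bub: "box_union_bound {..<n} 2 (1/4) c0 X w g F L" for X :: "nat \<Rightarrow> 'a set" and w g F L
    unfolding box_union_bound_def
  proof (intro impI)
    assume *: "weighted {..<n} X w" "\<forall>y. 0 \<le> g y" "F \<subseteq> Pi\<^sub>E {..<n} X" "thin_fibres {..<n} X w 2 g F L"
      "1 / 4 * psum {..<n} X w g \<le> psum {..<n} X w (\<lambda>y. of_bool (y \<in> F) * g y)" "0 < psum {..<n} X w g"
    have "c0 * psum {..<n} X w (\<lambda>_. 1) \<le> c1 * psum {..<n} X w (\<lambda>_. 1)"
      using c0(3) *(1) by (intro mult_right_mono psum_nonneg) (auto simp: weighted_def)
    also have "\<dots> \<le> psum {..<n} X w (\<lambda>z. of_bool (\<exists>y\<in>F. \<forall>i\<in>{..<n}. z i \<in> L y i))"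
      using c1(2)[rule_format, of X w g F L] * unfolding box_union_bound_def by (elim impE)
    finally show "c0 * psum {..<n} X w (\<lambda>_. 1) \<le> psum {..<n} X w (\<lambda>z. of_bool (\<exists>y\<in>F. \<forall>i\<in>{..<n}. z i \<in> L y i))" .
  qed
  obtain C0 where C0: "C0 > 0" "\<forall>(X :: nat \<Rightarrow> 'a set) w \<U> P. dense_union_bound {..n} c0 C0 X w \<U> P"
    using dense_union[of "{..n}" c0] c0 by auto
  show ?thesis
  proof (intro exI[of _ "\<Lambda> * (4 * C0 * (2 * real n + 7) ^ (n - 1) + 1)"] conjI allI impI)
    show "0 < \<Lambda> * (4 * C0 * (2 * real n + 7) ^ (n - 1) + 1)"
      using assms C0(1) by (intro mult_pos_pos add_nonneg_pos) auto
    fix X :: "nat \<Rightarrow> 'a set" and w and \<G> :: "'r set" and c and key :: "'r \<Rightarrow> 'k" and l :: nat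
    assume R: "rectangles n X w \<G> c key"
      and carl: "\<forall>H\<subseteq>\<G>. (\<Sum>r\<in>H. psum {..n} X w (\<lambda>y. of_bool (\<forall>i\<le>n. y i \<in> c r i)))
        \<le> \<Lambda> * psum {..n} X w (\<lambda>y. of_bool (\<exists>r\<in>H. \<forall>i\<le>n. y i \<in> c r i))"
    interpret rectangles n X w \<G> c key by (rule R)
    have rect': "rect r = (\<lambda>y. \<forall>i\<le>n. y i \<in> c r i)" for r by (simp add: rect_def fun_eq_iff)
    show "psum {..n} X w (\<lambda>y. of_bool (\<Lambda> * (4 * C0 * (2 * real n + 7) ^ (n - 1) + 1) * (real l + 2) ^ n
        < real (card {r\<in>\<G>. \<forall>i\<le>n. y i \<in> c r i})))
      \<le> (1/2) ^ l * psum {..n} X w (\<lambda>y. of_bool (\<exists>r\<in>\<G>. \<forall>i\<le>n. y i \<in> c r i))"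
      using overlap_tail[OF bub c0(1,2) C0(2)[rule_format] C0(1) assms, of l] carl
      unfolding \<mu>_def overlap_def rect' by blast
  qed
qed

section \<open>Discretization by membership patterns\<close>

definition signature :: "'b set set \<Rightarrow> 'b \<Rightarrow> 'b set set" where
  "signature \<T> x = {Q\<in>\<T>. x \<in> Q}"

locale test_sets = product_sigma_finite N for N :: "'i \<Rightarrow> 'b measure" +
  fixes S :: "'i set" and \<T> :: "'i \<Rightarrow> 'b set set"
  assumes fin_S: "finite S" and fin_T: "\<And>i. i \<in> S \<Longrightarrow> finite (\<T> i)"
    and T_sets: "\<And>i Q. i \<in> S \<Longrightarrow> Q \<in> \<T> i \<Longrightarrow> Q \<in> sets (N i)"
    and T_fin: "\<And>i Q. i \<in> S \<Longrightarrow> Q \<in> \<T> i \<Longrightarrow> emeasure (N i) Q < \<infinity>"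
begin

text \<open>Points in no test set are left out: the fibre of the empty pattern may have infinite
  measure, and the weights must be real.\<close>

definition atoms :: "'i \<Rightarrow> 'b set set set" where
  "atoms i = signature (\<T> i) ` \<Union> (\<T> i)"

definition mass :: "'i \<Rightarrow> 'b set set \<Rightarrow> real" where
  "mass i \<sigma> = measure (N i) {x\<in>space (N i). signature (\<T> i) x = \<sigma>}"

abbreviation fibre :: "'i \<Rightarrow> 'b set set \<Rightarrow> 'b set" where
  "fibre i \<sigma> \<equiv> {x\<in>space (N i). signature (\<T> i) x = \<sigma>}"

lemma atoms_nonempty: "\<sigma> \<in> atoms i \<Longrightarrow> \<exists>Q\<in>\<T> i. Q \<in> \<sigma>"
  by (auto simp: atoms_def signature_def)

lemma finite_atoms: assumes "i \<in> S" shows "finite (atoms i)"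
proof (rule finite_subset)
  show "atoms i \<subseteq> Pow (\<T> i)" by (auto simp: atoms_def signature_def)
qed (use fin_T[OF assms] in simp)

lemma fibre_sets: assumes "i \<in> S" shows "fibre i \<sigma> \<in> sets (N i)"
proof (cases "\<sigma> \<subseteq> \<T> i")
  case True
  then have "fibre i \<sigma> = {x\<in>space (N i). \<forall>Q\<in>\<T> i. x \<in> (if Q \<in> \<sigma> then Q else space (N i) - Q)}"
    by (auto simp: signature_def split: if_splits)
  also have "\<dots> \<in> sets (N i)"
  proof (rule sets.sets_Collect_finite_All[OF _ fin_T[OF assms]])
    fix Q assume "Q \<in> \<T> i"
    then have Q: "Q \<in> sets (N i)" by (rule T_sets[OF assms])
    then have "{x\<in>space (N i). x \<in> (if Q \<in> \<sigma> then Q else space (N i) - Q)} = (if Q \<in> \<sigma> then Q else space (N i) - Q)"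
      using sets.sets_into_space[OF Q] by auto
    then show "{x\<in>space (N i). x \<in> (if Q \<in> \<sigma> then Q else space (N i) - Q)} \<in> sets (N i)"
      using Q by simp
  qed
  finally show ?thesis .
next
  case False
  then have "fibre i \<sigma> = {}" by (auto simp: signature_def)
  then show ?thesis by (metis sets.empty_sets)
qed

lemma fibre_finite: assumes "i \<in> S" "\<sigma> \<in> atoms i" shows "emeasure (N i) (fibre i \<sigma>) = ennreal (mass i \<sigma>)"
proof -
  obtain Q where Q: "Q \<in> \<T> i" "Q \<in> \<sigma>" using atoms_nonempty[OF assms(2)] by auto
  have "emeasure (N i) (fibre i \<sigma>) \<le> emeasure (N i) Q"
    using Q T_sets[OF assms(1)] by (intro emeasure_mono) (auto simp: signature_def)
  also have "\<dots> < \<infinity>" using T_fin[OF assms(1) Q(1)] .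
  finally show ?thesis unfolding mass_def
    by (intro emeasure_eq_ennreal_measure) auto
qed

lemma mass_nonneg: "mass i \<sigma> \<ge> 0"
  by (simp add: mass_def)

lemma weighted_atoms: "weighted S atoms mass"
  by (simp add: weighted_def finite_atoms mass_nonneg)

lemma sum_mass: assumes "i \<in> S" "Q \<in> \<T> i"
  shows "ennreal (\<Sum>\<sigma>\<in>{\<sigma>\<in>atoms i. Q \<in> \<sigma>}. mass i \<sigma>) = emeasure (N i) Q"
proof -
  let ?A = "{\<sigma>\<in>atoms i. Q \<in> \<sigma>}"
  have fin: "finite ?A" using finite_atoms[OF assms(1)] by simp
  have "ennreal (\<Sum>\<sigma>\<in>?A. mass i \<sigma>) = (\<Sum>\<sigma>\<in>?A. emeasure (N i) (fibre i \<sigma>))"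
  proof -
    have "(\<Sum>\<sigma>\<in>?A. emeasure (N i) (fibre i \<sigma>)) = (\<Sum>\<sigma>\<in>?A. ennreal (mass i \<sigma>))"
      using fibre_finite[OF assms(1)] by (intro sum.cong) simp_all
    then show ?thesis by (simp only: sum_ennreal mass_nonneg)
  qed
  also have "\<dots> = emeasure (N i) (\<Union>\<sigma>\<in>?A. fibre i \<sigma>)"
    using fin fibre_sets[OF assms(1)] by (intro sum_emeasure) (simp_all add: disjoint_family_on_def image_subset_iff Int_def)
  also have "(\<Union>\<sigma>\<in>?A. fibre i \<sigma>) = Q"
  proof (intro set_eqI iffI)
    fix x assume "x \<in> Q"
    moreover from this have "x \<in> space (N i)" using sets.sets_into_space[OF T_sets[OF assms]] by blast
    ultimately show "x \<in> (\<Union>\<sigma>\<in>?A. fibre i \<sigma>)"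
      using assms(2) by (intro UN_I[of "signature (\<T> i) x"]) (auto simp: signature_def atoms_def)
  next
    fix x assume "x \<in> (\<Union>\<sigma>\<in>?A. fibre i \<sigma>)"
    then show "x \<in> Q" by (simp add: signature_def)
  qed
  finally show ?thesis .
qed

text \<open>\<open>B\<close> is a finite disjoint union of products of fibres, one for each tuple of
  atoms satisfying \<open>P\<close>. The condition on \<open>\<Union> (\<T> i)\<close> reflects the
  exclusion of the empty pattern from the atoms.\<close>

lemma emeasure_psum:
  assumes "B \<subseteq> space (PiM S N)"
    and B: "\<And>x. x \<in> space (PiM S N) \<Longrightarrow>
      x \<in> B \<longleftrightarrow> (\<forall>i\<in>S. x i \<in> \<Union> (\<T> i)) \<and> P (\<lambda>i\<in>S. signature (\<T> i) (x i))"
  shows "B \<in> sets (PiM S N)" and "emeasure (PiM S N) B = ennreal (psum S atoms mass (\<lambda>y. of_bool (P y)))"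
proof -
  let ?Y = "{y\<in>Pi\<^sub>E S atoms. P y}"
  let ?F = "\<lambda>y. Pi\<^sub>E S (\<lambda>i. fibre i (y i))"
  have fin: "finite (Pi\<^sub>E S atoms)" using fin_S finite_atoms by (intro finite_PiE) auto
  have B_eq: "B = (\<Union>y\<in>?Y. ?F y)"
  proof (intro set_eqI iffI)
    fix x assume x: "x \<in> B"
    then have sp: "x \<in> space (PiM S N)" using assms(1) by auto
    let ?y = "\<lambda>i\<in>S. signature (\<T> i) (x i)"
    have "?y \<in> ?Y" using B[OF sp] x by (auto simp: atoms_def)
    moreover have "x \<in> ?F ?y" using sp by (auto simp: space_PiM PiE_iff)
    ultimately show "x \<in> (\<Union>y\<in>?Y. ?F y)" by blast
  next
    fix x assume "x \<in> (\<Union>y\<in>?Y. ?F y)"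
    then obtain y where y: "y \<in> Pi\<^sub>E S atoms" "P y" "x \<in> ?F y" by auto
    have sp: "x \<in> space (PiM S N)" using y(3) by (auto simp: space_PiM PiE_iff)
    have "y = (\<lambda>i\<in>S. signature (\<T> i) (x i))"
      using y(1,3) by (auto simp: fun_eq_iff PiE_iff extensional_def)
    moreover have "x i \<in> \<Union> (\<T> i)" if "i \<in> S" for i
    proof -
      have "signature (\<T> i) (x i) \<in> atoms i" using y(1,3) that by (auto simp: PiE_iff)
      from atoms_nonempty[OF this] show ?thesis by (auto simp: signature_def)
    qed
    ultimately show "x \<in> B" using B[OF sp] y(2) by auto
  qed
  have meas: "?F y \<in> sets (PiM S N)" for y
    using fin_S fibre_sets by (intro sets_PiM_I_finite) auto
  show "B \<in> sets (PiM S N)"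
    unfolding B_eq using fin meas by (intro sets.finite_UN) auto
  have "emeasure (PiM S N) B = (\<Sum>y\<in>?Y. emeasure (PiM S N) (?F y))"
    unfolding B_eq
  proof (rule sum_emeasure[symmetric])
    show "disjoint_family_on ?F ?Y"
      unfolding disjoint_family_on_def
    proof (intro ballI impI)
      fix y z assume y: "y \<in> ?Y" and z: "z \<in> ?Y" and "y \<noteq> z"
      then obtain i where "i \<in> S" "y i \<noteq> z i" by (metis (lifting) PiE_ext mem_Collect_eq)
      then show "?F y \<inter> ?F z = {}" by (auto simp: PiE_iff)
    qed
  qed (use fin meas in auto)
  also have "\<dots> = (\<Sum>y\<in>?Y. ennreal (\<Prod>i\<in>S. mass i (y i)))"
  proof (rule sum.cong[OF refl])
    fix y assume y: "y \<in> ?Y"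
    have "emeasure (PiM S N) (?F y) = (\<Prod>i\<in>S. emeasure (N i) (fibre i (y i)))"
      using fin_S fibre_sets by (intro emeasure_PiM) auto
    also have "\<dots> = (\<Prod>i\<in>S. ennreal (mass i (y i)))"
      using y fibre_finite by (intro prod.cong) (auto simp: PiE_iff)
    also have "\<dots> = ennreal (\<Prod>i\<in>S. mass i (y i))" by (intro prod_ennreal) (simp add: mass_nonneg)
    finally show "emeasure (PiM S N) (?F y) = ennreal (\<Prod>i\<in>S. mass i (y i))" .
  qed
  also have "\<dots> = ennreal (\<Sum>y\<in>?Y. \<Prod>i\<in>S. mass i (y i))"
    by (intro sum_ennreal prod_nonneg ballI) (simp add: mass_nonneg)
  also have "(\<Sum>y\<in>?Y. \<Prod>i\<in>S. mass i (y i)) = psum S atoms mass (\<lambda>y. of_bool (P y))"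
    unfolding psum_def using fin by (auto simp: sum.inter_filter of_bool_def if_distrib cong: if_cong)
  finally show "emeasure (PiM S N) B = ennreal (psum S atoms mass (\<lambda>y. of_bool (P y)))" .
qed

end

section \<open>Geometry of dyadic grids\<close>

lemma cube_of_side_subset:
  assumes "cube_of_side n l Q" "cube_of_side n l' R" "Q \<subseteq> R" "l > 0" "n \<ge> 1"
  shows "l \<le> l'"
proof -
  obtain a b where a: "Q = (\<Pi>\<^sub>E j\<in>{..<n}. {a j ..< a j + l})" and b: "R = (\<Pi>\<^sub>E j\<in>{..<n}. {b j ..< b j + l'})"
    using assms(1,2) unfolding cube_of_side_def by blast
  have "{a j ..< a j + l} \<noteq> {}" for j using assms(4) by auto
  then have "Q \<noteq> {}" unfolding a PiE_eq_empty_iff by auto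
  then have "\<forall>j\<in>{..<n}. {a j ..< a j + l} \<subseteq> {b j ..< b j + l'}"
    using assms(3) unfolding a b subset_PiE by blast
  \<comment> \<open>Lengths are compared in coordinate 0; in dimension 0 all cubes coincide and have
    no definite side.\<close>
  moreover have "0 \<in> {..<n}" using assms(5) by simp
  ultimately have "{a 0 ..< a 0 + l} \<subseteq> {b 0 ..< b 0 + l'}" by blast
  then have "b 0 \<le> a 0 \<and> a 0 + l \<le> b 0 + l'"
    using assms(4) atLeastLessThan_subset_iff by fastforce
  then show ?thesis by simp
qed

text \<open>If the grid axiom gives the wrong inclusion, the side lengths agree, and two
  intersecting cells of one partition are equal.\<close>

lemma dyadic_grid_nested:
  assumes D: "dyadic_grid n D" and Q: "Q \<in> D" "cube_of_side n (2 powi k) Q"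
    and R: "R \<in> D" "cube_of_side n (2 powi k') R"
    and "Q \<inter> R \<noteq> {}" "k \<le> k'" "n \<ge> 1"
  shows "Q \<subseteq> R"
proof (rule ccontr)
  assume no: "\<not> Q \<subseteq> R"
  then have "R \<subseteq> Q" using D Q(1) R(1) assms(6) unfolding dyadic_grid_def by blast
  then have "(2::real) powi k' \<le> 2 powi k"
    using cube_of_side_subset[OF R(2) Q(2)] assms(8) by simp
  then have "k' \<le> k" using power_int_strict_increasing[of k k' "2::real"] by linarith
  then have "k = k'" using assms(7) by simp
  then have "Q \<in> {Q\<in>D. cube_of_side n (2 powi k) Q}" "R \<in> {Q\<in>D. cube_of_side n (2 powi k) Q}"
    using Q R by auto
  moreover have "partition_on ({..<n} \<rightarrow>\<^sub>E UNIV) {Q\<in>D. cube_of_side n (2 powi k) Q}"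
    using D by (simp add: dyadic_grid_def)
  ultimately have "Q = R" using assms(6) by (meson disjointD partition_onD2)
  then show False using no by simp
qed

text \<open>The coordinates are raised one at a time along the hybrids \<open>f j\<close>.\<close>

lemma coordwise_nondecreasing_mono:
  assumes \<Phi>: "coordwise_nondecreasing n \<Phi>" and k: "k \<in> int_tuples n" "k' \<in> int_tuples n"
    and le: "\<And>i. i < n \<Longrightarrow> k i \<le> k' i"
  shows "\<Phi> k \<le> \<Phi> k'"
proof -
  define f where "f = (\<lambda>j i. if i < j then k' i else k i)"
  have "\<Phi> k \<le> \<Phi> (f j)" if "j \<le> n" for j
    using that
  proof (induction j)
    case 0
    then show ?case by (simp add: f_def)
  next
    case (Suc j)
    have f: "f (Suc j) = (f j)(j := k' j)" by (auto simp: f_def fun_eq_iff less_Suc_eq)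
    have "f j \<in> int_tuples n" using k Suc.prems by (auto simp: f_def int_tuples_def PiE_iff extensional_def)
    moreover have "f j j \<le> k' j" using le[of j] Suc.prems by (simp add: f_def)
    ultimately have "\<Phi> (f j) \<le> \<Phi> ((f j)(j := k' j))"
      using \<Phi> Suc.prems unfolding coordwise_nondecreasing_def by auto
    then show ?case using Suc.IH Suc.prems unfolding f by (metis Suc_leD order_trans)
  qed
  from this[of n] have "\<Phi> k \<le> \<Phi> (f n)" by simp
  also have "f n = k'" using k by (auto simp: f_def fun_eq_iff int_tuples_def PiE_iff extensional_def)
  finally show ?thesis .
qed

section \<open>Measures of cubes and the Carleson bound\<close>

lemma cube_of_side_sets:
  assumes "cube_of_side n l Q"
  shows "Q \<in> sets (\<Pi>\<^sub>M j\<in>{..<n}. (lborel :: real measure))"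
proof -
  obtain a where a: "Q = (\<Pi>\<^sub>E j\<in>{..<n}. {a j ..< a j + l})" using assms by (auto simp: cube_of_side_def)
  show ?thesis unfolding a by (intro sets_PiM_I_finite) auto
qed

lemma product_sigma_finite_lborel: "product_sigma_finite (\<lambda>_::nat. lborel :: real measure)"
  by (simp add: product_sigma_finite_def sigma_finite_lborel)

lemma emeasure_cube_of_side:
  assumes "cube_of_side n l Q" "l \<ge> 0"
  shows "emeasure (\<Pi>\<^sub>M j\<in>{..<n}. (lborel :: real measure)) Q = ennreal (l ^ n)"
proof -
  interpret product_sigma_finite "\<lambda>_::nat. lborel :: real measure" by (rule product_sigma_finite_lborel)
  obtain a where a: "Q = (\<Pi>\<^sub>E j\<in>{..<n}. {a j ..< a j + l})" using assms by (auto simp: cube_of_side_def)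
  show ?thesis unfolding a using assms(2) by (subst emeasure_PiM) (auto simp: ennreal_power)
qed

lemma sparse_family_carleson:
  assumes "sparse_family M \<eta> G" "H \<subseteq> G" "finite H" "\<Union>H \<in> sets M"
  shows "ennreal \<eta> * (\<Sum>I\<in>H. emeasure M I) \<le> emeasure M (\<Union>H)"
proof -
  obtain E where E: "disjoint_family_on E G" "\<And>I. I \<in> G \<Longrightarrow> E I \<in> sets M" "\<And>I. I \<in> G \<Longrightarrow> E I \<subseteq> I"
    "\<And>I. I \<in> G \<Longrightarrow> emeasure M (E I) \<ge> ennreal \<eta> * emeasure M I"
    using assms(1) unfolding sparse_family_def by blast
  have "ennreal \<eta> * (\<Sum>I\<in>H. emeasure M I) \<le> (\<Sum>I\<in>H. emeasure M (E I))"
    unfolding sum_distrib_left using E(4) assms(2) by (intro sum_mono) auto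
  also have "\<dots> = emeasure M (\<Union>I\<in>H. E I)"
    using E(1,2) assms(2,3) by (intro sum_emeasure disjoint_family_on_mono[OF assms(2)]) auto
  also have "\<dots> \<le> emeasure M (\<Union>H)"
    using E(3) assms(2,4) by (intro emeasure_mono) auto
  finally show ?thesis .
qed

lemma sparse_family_subset: "sparse_family M \<eta> G \<Longrightarrow> H \<subseteq> G \<Longrightarrow> sparse_family M \<eta> H"
  unfolding sparse_family_def by (meson disjoint_family_on_mono in_mono)

text \<open>Discretization takes place before completion; on these sets both measures agree.\<close>

definition base_prod :: "nat \<Rightarrow> (nat \<Rightarrow> nat) \<Rightarrow> (nat \<Rightarrow> nat \<Rightarrow> real) measure" where
  "base_prod m ds = (\<Pi>\<^sub>M i\<in>{..<m}. (\<Pi>\<^sub>M j\<in>{..<ds i}. (lborel :: real measure)))"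

lemma lebesgue_prod_eq: "lebesgue_prod m ds = completion (base_prod m ds)"
  by (simp add: lebesgue_prod_def base_prod_def)

lemma emeasure_lebesgue_prod:
  "B \<in> sets (base_prod m ds) \<Longrightarrow> emeasure (lebesgue_prod m ds) B = emeasure (base_prod m ds) B"
  by (simp add: lebesgue_prod_eq)

text \<open>Instantiates the atomic model with the patterns of the finitely many sides that occur.
  Sparseness enters as the Carleson bound with constant \<open>1 / \<eta>\<close>.\<close>

lemma finite_zygmund_tail:
  assumes n: "n \<ge> 1" and \<eta>: "\<eta> > 0"
  shows "\<exists>A>0. \<forall>ds D \<Phi> G (l::nat).
    (\<forall>i<Suc n. ds i \<ge> 1) \<longrightarrow> (\<forall>i<Suc n. dyadic_grid (ds i) (D i)) \<longrightarrow> coordwise_nondecreasing n \<Phi> \<longrightarrow>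
    G \<subseteq> zygmund_rectangles (Suc n) ds D \<Phi> \<longrightarrow> finite G \<longrightarrow> sparse_family (lebesgue_prod (Suc n) ds) \<eta> G \<longrightarrow>
    emeasure (lebesgue_prod (Suc n) ds) {x\<in>\<Union>G. A * (real l + 2) ^ n < real (card {I\<in>G. x \<in> I})}
      \<le> ennreal ((1/2) ^ l) * emeasure (lebesgue_prod (Suc n) ds) (\<Union>G)"
proof -
  obtain A where A: "A > 0" "\<forall>(X :: nat \<Rightarrow> (nat \<Rightarrow> real) set set set) w (\<G> :: (nat \<Rightarrow> nat \<Rightarrow> real) set set) c
      (key :: (nat \<Rightarrow> nat \<Rightarrow> real) set \<Rightarrow> int) (l::nat).
    rectangles n X w \<G> c key \<longrightarrow>
    (\<forall>H\<subseteq>\<G>. (\<Sum>r\<in>H. psum {..n} X w (\<lambda>y. of_bool (\<forall>i\<le>n. y i \<in> c r i)))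
        \<le> (1 / \<eta>) * psum {..n} X w (\<lambda>y. of_bool (\<exists>r\<in>H. \<forall>i\<le>n. y i \<in> c r i))) \<longrightarrow>
    psum {..n} X w (\<lambda>y. of_bool (A * (real l + 2) ^ n < real (card {r\<in>\<G>. \<forall>i\<le>n. y i \<in> c r i})))
      \<le> (1/2) ^ l * psum {..n} X w (\<lambda>y. of_bool (\<exists>r\<in>\<G>. \<forall>i\<le>n. y i \<in> c r i))"
    using rectangles_tail[of "1 / \<eta>" n] \<eta> by auto
  show ?thesis
  proof (intro exI[of _ A] conjI allI impI)
    show "A > 0" by (rule A(1))
  next
    fix ds :: "nat \<Rightarrow> nat" and D :: "nat \<Rightarrow> (nat \<Rightarrow> real) set set" and \<Phi> :: "(nat \<Rightarrow> int) \<Rightarrow> int"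
      and G :: "(nat \<Rightarrow> nat \<Rightarrow> real) set set" and l :: nat
    assume ds: "\<forall>i<Suc n. ds i \<ge> 1" and D: "\<forall>i<Suc n. dyadic_grid (ds i) (D i)"
      and \<Phi>: "coordwise_nondecreasing n \<Phi>" and GZ: "G \<subseteq> zygmund_rectangles (Suc n) ds D \<Phi>"
      and finG: "finite G" and sparse: "sparse_family (lebesgue_prod (Suc n) ds) \<eta> G"
    have "\<forall>I\<in>G. \<exists>Q k. I = (\<Pi>\<^sub>E i\<in>{..<Suc n}. Q i) \<and> (\<forall>i<Suc n. Q i \<in> D i) \<and> k \<in> int_tuples n \<and>
        (\<forall>i<n. cube_of_side (ds i) (2 powi k i) (Q i)) \<and> cube_of_side (ds n) (2 powi \<Phi> k) (Q n)"
    proof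
      fix I assume "I \<in> G"
      then have "I \<in> zygmund_rectangles (Suc n) ds D \<Phi>" using GZ by blast
      then show "\<exists>Q k. I = (\<Pi>\<^sub>E i\<in>{..<Suc n}. Q i) \<and> (\<forall>i<Suc n. Q i \<in> D i) \<and> k \<in> int_tuples n \<and>
        (\<forall>i<n. cube_of_side (ds i) (2 powi k i) (Q i)) \<and> cube_of_side (ds n) (2 powi \<Phi> k) (Q n)"
        unfolding zygmund_rectangles_def diff_Suc_1 by blast
    qed
    then obtain Q k where Qk: "\<And>I. I \<in> G \<Longrightarrow> I = (\<Pi>\<^sub>E i\<in>{..<Suc n}. Q I i) \<and> (\<forall>i<Suc n. Q I i \<in> D i) \<and> k I \<in> int_tuples n \<and>
        (\<forall>i<n. cube_of_side (ds i) (2 powi k I i) (Q I i)) \<and> cube_of_side (ds n) (2 powi \<Phi> (k I)) (Q I n)"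
      by metis
    define e where "e = (\<lambda>I i. if i = n then \<Phi> (k I) else k I i)"
    have I_eq: "\<And>I. I \<in> G \<Longrightarrow> I = (\<Pi>\<^sub>E i\<in>{..<Suc n}. Q I i)" and QD: "\<And>I i. I \<in> G \<Longrightarrow> i \<le> n \<Longrightarrow> Q I i \<in> D i"
      and kI: "\<And>I. I \<in> G \<Longrightarrow> k I \<in> int_tuples n"
      and cube: "\<And>I i. I \<in> G \<Longrightarrow> i \<le> n \<Longrightarrow> cube_of_side (ds i) (2 powi e I i) (Q I i)"
      using Qk by (auto simp: e_def le_less)
    have ds': "ds i \<ge> 1" if "i \<le> n" for i using ds that by simp
    have D': "dyadic_grid (ds i) (D i)" if "i \<le> n" for i using D that by simp
    have memI: "x \<in> I \<longleftrightarrow> (\<forall>i\<le>n. x i \<in> Q I i)" if "I \<in> G" "x \<in> space (base_prod (Suc n) ds)" for I x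
    proof -
      have "x \<in> extensional {..<Suc n}" using that(2) by (auto simp: base_prod_def space_PiM PiE_iff)
      then show ?thesis by (subst I_eq[OF that(1)]) (auto simp: PiE_iff less_Suc_eq_le)
    qed
    define \<T> where "\<T> = (\<lambda>i. (\<lambda>I. Q I i) ` G)"
    define N where "N = (\<lambda>i. \<Pi>\<^sub>M j\<in>{..<ds i}. (lborel :: real measure))"
    interpret lb: product_sigma_finite "\<lambda>_::nat. lborel :: real measure" by (rule product_sigma_finite_lborel)
    have T_mass: "emeasure (N i) (Q I i) = ennreal ((2 powi e I i) ^ ds i)" if "I \<in> G" "i \<le> n" for I i
      unfolding N_def by (rule emeasure_cube_of_side[OF cube[OF that]]) simp
    have "product_sigma_finite N"
      unfolding product_sigma_finite_def N_def by (intro allI lb.sigma_finite) simp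
    then interpret test_sets N "{..n}" \<T>
    proof (rule test_sets.intro[OF _ test_sets_axioms.intro])
      fix i R assume "i \<in> {..n}" "R \<in> \<T> i"
      then show "R \<in> sets (N i)" using cube_of_side_sets[OF cube] by (auto simp: \<T>_def N_def)
    next
      fix i R assume "i \<in> {..n}" "R \<in> \<T> i"
      then show "emeasure (N i) R < \<infinity>" using T_mass by (auto simp: \<T>_def)
    qed (use finG in \<open>auto simp: \<T>_def\<close>)
    have base: "base_prod (Suc n) ds = PiM {..n} N"
      by (simp add: base_prod_def N_def lessThan_Suc_atMost)
    \<comment> \<open>A side becomes the set of patterns containing it. This keeps membership,
      inclusion and intersection, and by \<open>sum_mass\<close> also measure.\<close>
    define c where "c = (\<lambda>I i. {\<sigma>\<in>atoms i. Q I i \<in> \<sigma>})"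
    have QT: "Q I i \<in> \<T> i" if "I \<in> G" for I i using that by (simp add: \<T>_def)
    have c_sig: "signature (\<T> i) z \<in> c I i \<longleftrightarrow> z \<in> Q I i" if "I \<in> G" for I i z
      using QT[OF that, of i] by (auto simp: c_def atoms_def signature_def)
    have c_sub: "c I i \<subseteq> c J i" if "I \<in> G" "J \<in> G" "Q I i \<subseteq> Q J i" for I J i
      using that QT[OF that(2), of i] by (auto simp: c_def atoms_def signature_def)
    have c_int: "Q I i \<inter> Q J i \<noteq> {}" if IJ: "I \<in> G" "J \<in> G" "c I i \<inter> c J i \<noteq> {}" for I J i
    proof -
      obtain \<sigma> where "\<sigma> \<in> c I i" "\<sigma> \<in> c J i" using IJ(3) by auto
      then obtain z where "signature (\<T> i) z \<in> c I i" "signature (\<T> i) z \<in> c J i"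
        by (auto simp: c_def atoms_def)
      then show ?thesis using c_sig IJ(1,2) by auto
    qed
    have c_nested: "c I i \<subseteq> c J i" if "I \<in> G" "J \<in> G" "i \<le> n" "c I i \<inter> c J i \<noteq> {}" "e I i \<le> e J i" for I J i
      by (rule c_sub[OF that(1,2)], rule dyadic_grid_nested[OF D'[OF that(3)] QD[OF that(1,3)] cube[OF that(1,3)]
          QD[OF that(2,3)] cube[OF that(2,3)] c_int[OF that(1,2,4)] that(5) ds'[OF that(3)]])
    have c_pos: "sum (mass i) (c I i) > 0" if "I \<in> G" "i \<le> n" for I i
    proof -
      have "ennreal (sum (mass i) (c I i)) = ennreal ((2 powi e I i) ^ ds i)"
        using sum_mass[of i "Q I i"] that T_mass[OF that] QT[OF that(1)] by (simp add: c_def)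
      then have "sum (mass i) (c I i) = (2 powi e I i) ^ ds i"
        by (subst (asm) ennreal_inj) (auto intro: sum_nonneg mass_nonneg)
      then show ?thesis by simp
    qed
    \<comment> \<open>\<open>B\<close> exceeds all differences of \<open>\<Sigma>\<close>, so \<open>key\<close> is the lexicographic order of
      \<open>(- \<Phi> (k I), - \<Sigma> I)\<close>.\<close>
    define \<Sigma> where "\<Sigma> = (\<lambda>I. \<Sum>i<n. k I i)"
    define B where "B = 1 + 2 * (\<Sum>I\<in>G. \<bar>\<Sigma> I\<bar>)"
    define key where "key = (\<lambda>I. - \<Phi> (k I) * B - \<Sigma> I)"
    have key_le: "\<Phi> (k J) \<le> \<Phi> (k I) \<and> (\<Phi> (k I) = \<Phi> (k J) \<longrightarrow> \<Sigma> J \<le> \<Sigma> I)"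
      if "I \<in> G" "J \<in> G" "key I \<le> key J" for I J
    proof -
      have b: "\<bar>\<Sigma> I\<bar> \<le> (\<Sum>I\<in>G. \<bar>\<Sigma> I\<bar>)" if "I \<in> G" for I
        using finG that by (intro member_le_sum) auto
      have "(\<Phi> (k J) - \<Phi> (k I)) * B \<le> \<Sigma> I - \<Sigma> J" using that(3) by (simp add: key_def algebra_simps)
      also have "\<dots> < 1 * B" using b[OF that(1)] b[OF that(2)] by (simp add: B_def abs_le_iff)
      finally have "(\<Phi> (k J) - \<Phi> (k I)) * B < 1 * B" .
      moreover have "B > 0" using b[OF that(1)] by (simp add: B_def)
      ultimately have "\<Phi> (k J) - \<Phi> (k I) < 1" by (simp add: mult_less_cancel_right)
      then show ?thesis using that(3) by (auto simp: key_def)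
    qed
    have R: "rectangles n atoms mass G c key"
    proof
      show "1 \<le> n" by (rule n)
      show "weighted {..n} atoms mass" by (rule weighted_atoms)
      show "finite G" by (rule finG)
      show "c r i \<subseteq> atoms i" for r i by (auto simp: c_def)
      show "sum (mass i) (c r i) > 0" if "r \<in> G" "i \<le> n" for r i by (rule c_pos[OF that])
      show "laminar (c r i) (c s i)" if "r \<in> G" "s \<in> G" "i \<le> n" for r s i
        using c_nested[OF that] c_nested[OF that(2,1,3)] unfolding laminar_def by (metis inf_commute linear)
    next
      fix r s assume rs: "r \<in> G" "s \<in> G" and key: "key s \<le> key r"
        and int: "\<And>i. i \<le> n \<Longrightarrow> c s i \<inter> c r i \<noteq> {}"
      show "c r n \<subseteq> c s n"
        using c_nested[OF rs, of n] int[of n] key_le[OF rs(2,1) key] by (auto simp: e_def Int_commute)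
      show "\<exists>i<n. \<not> c s i \<subset> c r i"
      proof (rule ccontr)
        assume "\<not> ?thesis"
        then have sub: "c s i \<subset> c r i" if "i < n" for i using that by blast
        have less: "k s i < k r i" if "i < n" for i
        proof (rule ccontr)
          assume "\<not> k s i < k r i"
          then have "e r i \<le> e s i" using that by (simp add: e_def)
          then have "c r i \<subseteq> c s i" using c_nested[OF rs, of i] int[of i] that by (simp add: Int_commute)
          then show False using sub[OF that] by blast
        qed
        \<comment> \<open>Monotonicity of \<open>\<Phi>\<close> and the order
          \<open>key s \<le> key r\<close> force equal values of \<open>\<Phi>\<close>. The
          tie-break by sums of exponents then contradicts \<open>less\<close>.\<close>
        have "\<Phi> (k s) \<le> \<Phi> (k r)"
          using less by (intro coordwise_nondecreasing_mono[OF \<Phi> kI[OF rs(2)] kI[OF rs(1)]]) (auto intro: less_imp_le)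
        then have "\<Sigma> r \<le> \<Sigma> s" using key_le[OF rs(2,1) key] by auto
        moreover have "\<Sigma> s < \<Sigma> r"
          unfolding \<Sigma>_def using n less by (intro sum_strict_mono) (auto simp: lessThan_empty_iff)
        ultimately show False by simp
      qed
    qed
    have cov: "\<Union>G \<subseteq> space (PiM {..n} N)"
    proof (rule Union_least)
      fix I assume I: "I \<in> G"
      have "Q I i \<subseteq> space (N i)" if "i \<in> {..n}" for i
        using sets.sets_into_space[OF T_sets[OF that QT[OF I]]] .
      then have "(\<Pi>\<^sub>E i\<in>{..n}. Q I i) \<subseteq> space (PiM {..n} N)"
        unfolding space_PiM by (rule PiE_mono)
      then show "I \<subseteq> space (PiM {..n} N)" using I_eq[OF I] by (metis lessThan_Suc_atMost)
    qed
    have em: "B \<in> sets (base_prod (Suc n) ds)"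
      "emeasure (lebesgue_prod (Suc n) ds) B = ennreal (psum {..n} atoms mass (\<lambda>y. of_bool (P y)))"
      if B: "B \<subseteq> \<Union>G" and P: "\<And>x. x \<in> space (base_prod (Suc n) ds) \<Longrightarrow> x \<in> B \<longleftrightarrow> P (\<lambda>i\<in>{..n}. signature (\<T> i) (x i))" for B P
    proof -
      have sp: "B \<subseteq> space (PiM {..n} N)" using B cov by (rule subset_trans)
      have iff: "x \<in> B \<longleftrightarrow> (\<forall>i\<in>{..n}. x i \<in> \<Union> (\<T> i)) \<and> P (\<lambda>i\<in>{..n}. signature (\<T> i) (x i))"
        if x: "x \<in> space (PiM {..n} N)" for x
      proof -
        have "x i \<in> \<Union> (\<T> i)" if "x \<in> B" "i \<le> n" for i
        proof -
          obtain I where "I \<in> G" "x \<in> I" using \<open>x \<in> B\<close> B by auto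
          then show ?thesis using memI[of I x] x \<open>i \<le> n\<close> QT[of I i] unfolding base by blast
        qed
        then show ?thesis using P[of x] x base by auto
      qed
      show s: "B \<in> sets (base_prod (Suc n) ds)" unfolding base by (rule emeasure_psum(1)[OF sp iff])
      show "emeasure (lebesgue_prod (Suc n) ds) B = ennreal (psum {..n} atoms mass (\<lambda>y. of_bool (P y)))"
        unfolding emeasure_lebesgue_prod[OF s] unfolding base by (rule emeasure_psum(2)[OF sp iff])
    qed
    have sig_mem: "(\<forall>i\<le>n. (\<lambda>i\<in>{..n}. signature (\<T> i) (x i)) i \<in> c I i) \<longleftrightarrow> x \<in> I"
      if "I \<in> G" "x \<in> space (base_prod (Suc n) ds)" for I x
      using memI[OF that] c_sig[OF that(1)] by simp
    have un: "\<Union>H \<in> sets (base_prod (Suc n) ds)"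
      "emeasure (lebesgue_prod (Suc n) ds) (\<Union>H) = ennreal (psum {..n} atoms mass (\<lambda>y. of_bool (\<exists>r\<in>H. \<forall>i\<le>n. y i \<in> c r i)))"
      if H: "H \<subseteq> G" for H
    proof -
      let ?P = "\<lambda>y. \<exists>r\<in>H. \<forall>i\<le>n. y i \<in> c r i"
      have iff: "x \<in> \<Union>H \<longleftrightarrow> ?P (\<lambda>i\<in>{..n}. signature (\<T> i) (x i))"
        if x: "x \<in> space (base_prod (Suc n) ds)" for x
      proof -
        have "?P (\<lambda>i\<in>{..n}. signature (\<T> i) (x i)) \<longleftrightarrow> (\<exists>r\<in>H. x \<in> r)"
          by (intro bex_cong refl sig_mem[OF _ x]) (use H in blast)
        then show ?thesis by blast
      qed
      show "\<Union>H \<in> sets (base_prod (Suc n) ds)"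
        by (rule em(1)[where P = ?P, OF Union_mono[OF H] iff])
      show "emeasure (lebesgue_prod (Suc n) ds) (\<Union>H) = ennreal (psum {..n} atoms mass (\<lambda>y. of_bool (?P y)))"
        by (rule em(2)[where P = ?P, OF Union_mono[OF H] iff])
    qed
    have carl: "(\<Sum>r\<in>H. psum {..n} atoms mass (\<lambda>y. of_bool (\<forall>i\<le>n. y i \<in> c r i)))
        \<le> (1 / \<eta>) * psum {..n} atoms mass (\<lambda>y. of_bool (\<exists>r\<in>H. \<forall>i\<le>n. y i \<in> c r i))" if H: "H \<subseteq> G" for H
    proof -
      let ?\<mu> = "\<lambda>P. psum {..n} atoms mass (\<lambda>y. of_bool (P y))"
      have nn: "?\<mu> P \<ge> 0" for P by (intro psum_nonneg) (auto simp: mass_nonneg)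
      have finH: "finite H" using finite_subset[OF H finG] .
      have one: "emeasure (lebesgue_prod (Suc n) ds) r = ennreal (?\<mu> (\<lambda>y. \<forall>i\<le>n. y i \<in> c r i))" if "r \<in> H" for r
        using un(2)[of "{r}"] that H by auto
      have "ennreal (\<eta> * (\<Sum>r\<in>H. ?\<mu> (\<lambda>y. \<forall>i\<le>n. y i \<in> c r i)))
          = ennreal \<eta> * (\<Sum>r\<in>H. emeasure (lebesgue_prod (Suc n) ds) r)"
      proof -
        have "(\<Sum>r\<in>H. emeasure (lebesgue_prod (Suc n) ds) r) = (\<Sum>r\<in>H. ennreal (?\<mu> (\<lambda>y. \<forall>i\<le>n. y i \<in> c r i)))"
          by (rule sum.cong[OF refl]) (rule one)
        also have "\<dots> = ennreal (\<Sum>r\<in>H. ?\<mu> (\<lambda>y. \<forall>i\<le>n. y i \<in> c r i))" by (rule sum_ennreal) (rule nn)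
        finally show ?thesis using \<eta> by (simp add: ennreal_mult sum_nonneg nn)
      qed
      also have "\<dots> \<le> emeasure (lebesgue_prod (Suc n) ds) (\<Union>H)"
      proof (rule sparse_family_carleson[OF sparse H finH])
        show "\<Union>H \<in> sets (lebesgue_prod (Suc n) ds)" using un(1)[OF H] by (simp add: lebesgue_prod_eq)
      qed
      also have "\<dots> = ennreal (?\<mu> (\<lambda>y. \<exists>r\<in>H. \<forall>i\<le>n. y i \<in> c r i))" by (rule un(2)[OF H])
      finally have "\<eta> * (\<Sum>r\<in>H. ?\<mu> (\<lambda>y. \<forall>i\<le>n. y i \<in> c r i)) \<le> ?\<mu> (\<lambda>y. \<exists>r\<in>H. \<forall>i\<le>n. y i \<in> c r i)"
        by (simp only: ennreal_le_iff nn)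
      then show ?thesis using \<eta> by (simp add: field_simps)
    qed
    let ?B = "{x\<in>\<Union>G. A * (real l + 2) ^ n < real (card {I\<in>G. x \<in> I})}"
    have card_eq: "{r\<in>G. \<forall>i\<le>n. (\<lambda>i\<in>{..n}. signature (\<T> i) (x i)) i \<in> c r i} = {I\<in>G. x \<in> I}"
      if "x \<in> space (base_prod (Suc n) ds)" for x
      by (rule Collect_cong) (metis sig_mem[OF _ that])
    have B_iff: "x \<in> ?B \<longleftrightarrow> A * (real l + 2) ^ n < real (card {r\<in>G. \<forall>i\<le>n. (\<lambda>i\<in>{..n}. signature (\<T> i) (x i)) i \<in> c r i})"
      if "x \<in> space (base_prod (Suc n) ds)" for x
    proof -
      \<comment> \<open>The threshold is positive, so the bare overlap condition already confines
        \<open>x\<close> to the shadow, as \<open>em\<close> requires.\<close>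
      have "x \<in> \<Union>G" if "A * (real l + 2) ^ n < real (card {I\<in>G. x \<in> I})"
      proof (rule ccontr)
        assume "x \<notin> \<Union>G"
        then have "{I\<in>G. x \<in> I} = {}" by auto
        then have "A * (real l + 2) ^ n < 0" using that by (simp only: card.empty of_nat_0)
        moreover have "A * (real l + 2) ^ n > 0" using A(1) by simp
        ultimately show False by simp
      qed
      then show ?thesis unfolding card_eq[OF that] by blast
    qed
    have "emeasure (lebesgue_prod (Suc n) ds) ?B = ennreal (psum {..n} atoms mass
        (\<lambda>y. of_bool (A * (real l + 2) ^ n < real (card {r\<in>G. \<forall>i\<le>n. y i \<in> c r i}))))"
      by (rule em(2)[where P = "\<lambda>y. A * (real l + 2) ^ n < real (card {r\<in>G. \<forall>i\<le>n. y i \<in> c r i})", OF _ B_iff]) blast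
    also have "\<dots> \<le> ennreal ((1/2) ^ l * psum {..n} atoms mass (\<lambda>y. of_bool (\<exists>r\<in>G. \<forall>i\<le>n. y i \<in> c r i)))"
      using A(2)[rule_format, OF R carl] by (rule ennreal_leI)
    also have "\<dots> = ennreal ((1/2) ^ l) * emeasure (lebesgue_prod (Suc n) ds) (\<Union>G)"
      unfolding un(2)[OF order.refl] by (rule ennreal_mult) (auto intro!: psum_nonneg mass_nonneg)
    finally show "emeasure (lebesgue_prod (Suc n) ds) ?B \<le> ennreal ((1/2) ^ l) * emeasure (lebesgue_prod (Suc n) ds) (\<Union>G)" .
  qed
qed

section \<open>Infinite families and the exponential integral\<close>

text \<open>The coefficient is chosen so that \<open>h = A * t ^ n\<close> makes the exponent
  exactly \<open>t * ln q\<close>.\<close>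

lemma exp_root_le:
  assumes A: "A > 0" and n: "n \<ge> 1" and q: "q > 1" and h: "0 \<le> h" "h \<le> A * real t ^ n" and t: "t > 0"
  shows "exp (ln q / A powr (1 / real n) * h powr (1 / real n)) \<le> q ^ t"
proof -
  have "h powr (1 / real n) \<le> (A * real t ^ n) powr (1 / real n)"
    using h by (intro powr_mono2) auto
  also have "\<dots> = A powr (1 / real n) * (real t ^ n) powr (1 / real n)"
    by (rule powr_mult)
  also have "(real t ^ n) powr (1 / real n) = real t"
  proof -
    have "(real t ^ n) powr (1 / real n) = (real t powr real n) powr (1 / real n)"
      using t by (simp add: powr_realpow)
    also have "\<dots> = real t" using n t by (simp add: powr_powr)
    finally show ?thesis .
  qed
  finally have "ln q / A powr (1 / real n) * h powr (1 / real n)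
      \<le> ln q / A powr (1 / real n) * (A powr (1 / real n) * real t)"
    using q by (intro mult_left_mono) auto
  also have "\<dots> = real t * ln q" using A by simp
  finally have "exp (ln q / A powr (1 / real n) * h powr (1 / real n)) \<le> exp (real t * ln q)" by simp
  also have "\<dots> = q ^ t" using q by (simp add: exp_of_nat_mult)
  finally show ?thesis .
qed

text \<open>The base \<open>3/2\<close> could be any number in \<open>(1, 2)\<close>: it has to beat the decay \<open>2\<^sup>-\<^sup>l\<close> of the tail.\<close>

lemma nn_integral_exp_le:
  fixes h :: "'a \<Rightarrow> ennreal"
  assumes A: "A > 0" and n: "n \<ge> 1" and U: "U \<in> sets M"
    and T: "\<And>l::nat. T l \<in> sets M" "\<And>l. emeasure M (T l) \<le> ennreal ((1/2) ^ l) * emeasure M U"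
    and in_T: "\<And>x l. x \<in> U \<Longrightarrow> ennreal (A * (real l + 2) ^ n) < h x \<Longrightarrow> x \<in> T l"
  shows "(\<integral>\<^sup>+x\<in>U. exp_powr_minus_one (ln (3/2) / A powr (1 / real n)) (1 / real n) (h x) \<partial>M)
    \<le> ennreal 16 * emeasure M U"
proof -
  define c where "c = ln (3/2) / A powr (1 / real n)"
  define q :: real where "q = 3/2"
  \<comment> \<open>A majorant read off from the thresholds: below the first one the integrand is at
    most \<open>q ^ 2\<close>, and between the thresholds for \<open>p\<close> and
    \<open>p + 1\<close> at most \<open>q ^ (p + 3)\<close>, paid for by \<open>T p\<close>. At
    infinite height all \<open>T l\<close> contain the point and the series diverges.\<close>
  define g where "g = (\<lambda>x. ennreal (q ^ 2) * indicator U x + (\<Sum>l. ennreal (q ^ (l + 3)) * indicator (T l) x))"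
  have "f l \<le> suminf f" for f :: "nat \<Rightarrow> ennreal" and l
    using sum_le_suminf[of f "{l}"] by simp
  then have term_le: "ennreal (q ^ (l + 3)) * indicator (T l) x \<le> (\<Sum>l. ennreal (q ^ (l + 3)) * indicator (T l) x)" for l x .
  have bound: "exp_powr_minus_one c (1 / real n) (h x) \<le> g x" if x: "x \<in> U" for x
  proof (cases "h x = \<infinity>")
    case True
    have "(\<Sum>l. ennreal (q ^ (l + 3)) * indicator (T l) x) = \<infinity>"
    proof (rule ccontr)
      assume fin: "(\<Sum>l. ennreal (q ^ (l + 3)) * indicator (T l) x) \<noteq> \<infinity>"
      have "x \<in> T l" for l using in_T[OF x, of l] True by simp
      then have "ennreal (q ^ (l + 3)) \<le> (\<Sum>l. ennreal (q ^ (l + 3)) * indicator (T l) x)" for l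
        using term_le[of l x] by simp
      moreover obtain r where r: "r \<ge> 0" "(\<Sum>l. ennreal (q ^ (l + 3)) * indicator (T l) x) = ennreal r"
        using fin by (cases "\<Sum>l. ennreal (q ^ (l + 3)) * indicator (T l) x") auto
      ultimately have le: "q ^ (l + 3) \<le> r" for l by (metis ennreal_le_iff)
      obtain N where "r < q ^ N" using real_arch_pow[of q r] by (auto simp: q_def)
      also have "\<dots> \<le> q ^ (N + 3)" by (intro power_increasing) (auto simp: q_def)
      finally show False using le[of N] by simp
    qed
    then show ?thesis by (simp add: g_def)
  next
    case False
    then obtain r where r: "r \<ge> 0" "h x = ennreal r" by (cases "h x") auto
    have val: "exp_powr_minus_one c (1 / real n) (h x) = ennreal (exp (c * r powr (1 / real n)) - 1)"
      using r by (simp add: exp_powr_minus_one_def)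
    have le: "exp_powr_minus_one c (1 / real n) (h x) \<le> ennreal (q ^ t)" if "r \<le> A * real t ^ n" "t > 0" for t
    proof -
      have "exp (c * r powr (1 / real n)) \<le> q ^ t"
        unfolding c_def q_def by (rule exp_root_le[OF A n _ r(1) that]) simp
      then show ?thesis unfolding val by (intro ennreal_leI) simp
    qed
    have ex: "\<exists>l::nat. r \<le> A * (real l + 2) ^ n"
    proof -
      obtain l :: nat where l: "r / A \<le> real l" using real_arch_simple by blast
      have "real l \<le> (real l + 2) ^ 1" by simp
      also have "\<dots> \<le> (real l + 2) ^ n" by (intro power_increasing n) auto
      finally have "r / A \<le> (real l + 2) ^ n" using l by linarith
      then show ?thesis using A by (auto simp: field_simps)
    qed
    define l where "l = (LEAST l::nat. r \<le> A * (real l + 2) ^ n)"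
    have l: "r \<le> A * real (l + 2) ^ n" unfolding l_def using LeastI_ex[OF ex] by (simp add: add.commute)
    show ?thesis
    proof (cases l)
      case 0
      then have "exp_powr_minus_one c (1 / real n) (h x) \<le> ennreal (q ^ 2)" using le[of 2] l by simp
      also have "\<dots> \<le> g x" using x by (simp add: g_def)
      finally show ?thesis .
    next
      case (Suc p)
      then have "\<not> r \<le> A * (real p + 2) ^ n" using not_less_Least[of p "\<lambda>l. r \<le> A * (real l + 2) ^ n"] by (simp add: l_def)
      then have "x \<in> T p" using A r by (intro in_T[OF x]) (simp add: ennreal_less_iff)
      have "exp_powr_minus_one c (1 / real n) (h x) \<le> ennreal (q ^ (p + 3))"
        using le[of "p + 3"] l Suc by (simp add: numeral_3_eq_3)
      also have "\<dots> \<le> (\<Sum>l. ennreal (q ^ (l + 3)) * indicator (T l) x)" using term_le[of p x] \<open>x \<in> T p\<close> by simp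
      also have "\<dots> \<le> g x" by (simp add: g_def)
      finally show ?thesis .
    qed
  qed
  have "(\<integral>\<^sup>+x\<in>U. exp_powr_minus_one c (1 / real n) (h x) \<partial>M) \<le> (\<integral>\<^sup>+x. g x \<partial>M)"
    using bound by (intro nn_integral_mono) (auto split: split_indicator)
  also have "\<dots> = ennreal (q ^ 2) * emeasure M U + (\<Sum>l. ennreal (q ^ (l + 3)) * emeasure M (T l))"
  proof -
    have "(\<integral>\<^sup>+x. g x \<partial>M) = (\<integral>\<^sup>+x. ennreal (q ^ 2) * indicator U x \<partial>M)
        + (\<integral>\<^sup>+x. (\<Sum>l. ennreal (q ^ (l + 3)) * indicator (T l) x) \<partial>M)"
      unfolding g_def using U T(1) by (intro nn_integral_add) auto
    also have "(\<integral>\<^sup>+x. (\<Sum>l. ennreal (q ^ (l + 3)) * indicator (T l) x) \<partial>M)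
        = (\<Sum>l. \<integral>\<^sup>+x. ennreal (q ^ (l + 3)) * indicator (T l) x \<partial>M)"
      using T(1) by (intro nn_integral_suminf) auto
    finally show ?thesis using U T(1) by (simp add: nn_integral_cmult_indicator)
  qed
  also have "\<dots> \<le> ennreal (q ^ 2) * emeasure M U + (\<Sum>l. ennreal (q ^ 3 * (3/4) ^ l) * emeasure M U)"
  proof (intro add_left_mono suminf_le summableI)
    fix l
    have "ennreal (q ^ (l + 3)) * emeasure M (T l) \<le> ennreal (q ^ (l + 3)) * (ennreal ((1/2) ^ l) * emeasure M U)"
      by (intro mult_left_mono T(2)) simp
    also have "\<dots> = ennreal (q ^ (l + 3) * (1/2) ^ l) * emeasure M U"
      by (simp add: ennreal_mult q_def mult.assoc)
    also have "q ^ (l + 3) * (1/2) ^ l = q ^ 3 * (3/4) ^ l"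
      by (simp add: q_def power_add power_mult_distrib[symmetric])
    finally show "ennreal (q ^ (l + 3)) * emeasure M (T l) \<le> ennreal (q ^ 3 * (3/4) ^ l) * emeasure M U" .
  qed
  also have "\<dots> = ennreal (q ^ 2 + q ^ 3 * 4) * emeasure M U"
  proof -
    have "(\<lambda>l. q ^ 3 * (3/4) ^ l) sums (q ^ 3 * 4)"
      using sums_mult[OF geometric_sums[of "3/4::real"], of "q ^ 3"] by simp
    then have "(\<Sum>l. ennreal (q ^ 3 * (3/4) ^ l)) = ennreal (q ^ 3 * 4)"
      by (intro sums_unique[symmetric] sums_ennreal[THEN iffD2]) (auto simp: q_def)
    then show ?thesis
      by (simp add: ennreal_suminf_multc ennreal_plus q_def distrib_right)
  qed
  \<comment> \<open>With \<open>q = 3/2\<close> the constant is \<open>9/4 + 27/2\<close>, just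
    below 16.\<close>
  also have "\<dots> \<le> ennreal 16 * emeasure M U"
    by (intro mult_right_mono ennreal_leI) (auto simp: q_def power2_eq_square power3_eq_cube)
  finally show ?thesis by (simp add: c_def)
qed

section \<open>From finite to infinite families\<close>

lemma countable_dyadic_grid:
  assumes D: "dyadic_grid n D"
  shows "countable D"
proof -
  let ?D = "\<lambda>k. {Q\<in>D. cube_of_side n (2 powi k) Q}"
  have "countable (?D k)" for k
  proof -
    \<comment> \<open>Every cube contains a rational point, and cubes of one size are disjoint, so
      choosing such a point is injective.\<close>
    have ex: "\<exists>x. x \<in> Q \<and> x \<in> ({..<n} \<rightarrow>\<^sub>E \<rat>)" if Q: "Q \<in> ?D k" for Q
    proof -
      obtain a where a: "Q = (\<Pi>\<^sub>E j\<in>{..<n}. {a j ..< a j + 2 powi k})"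
        using Q unfolding cube_of_side_def by blast
      have "\<exists>r\<in>\<rat>. a j < r \<and> r < a j + 2 powi k" for j by (intro Rats_dense_in_real) simp
      then obtain r where r: "\<And>j. r j \<in> \<rat> \<and> a j < r j \<and> r j < a j + 2 powi k" by metis
      then have "restrict r {..<n} \<in> Q" "restrict r {..<n} \<in> ({..<n} \<rightarrow>\<^sub>E \<rat>)"
        unfolding a by (auto simp: less_imp_le)
      then show ?thesis by blast
    qed
    then have "\<forall>Q\<in>?D k. \<exists>x. x \<in> Q \<and> x \<in> ({..<n} \<rightarrow>\<^sub>E \<rat>)" by (rule ballI)
    from bchoice[OF this] obtain f where f: "\<And>Q. Q \<in> ?D k \<Longrightarrow> f Q \<in> Q \<and> f Q \<in> ({..<n} \<rightarrow>\<^sub>E \<rat>)"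
      by (elim exE) (rule that, erule bspec)
    have part: "partition_on ({..<n} \<rightarrow>\<^sub>E UNIV) (?D k)" using D unfolding dyadic_grid_def by blast
    have "inj_on f (?D k)"
    proof (rule inj_onI)
      fix Q R assume Q: "Q \<in> ?D k" and R: "R \<in> ?D k" and "f Q = f R"
      then have "Q \<inter> R \<noteq> {}" using f[OF Q] f[OF R] by auto
      then show "Q = R" using disjointD[OF partition_onD2[OF part] Q R] by blast
    qed
    moreover have "countable (f ` ?D k)"
    proof (rule countable_subset)
      show "f ` ?D k \<subseteq> {..<n} \<rightarrow>\<^sub>E \<rat>" using f by blast
      show "countable ({..<n} \<rightarrow>\<^sub>E (\<rat>::real set))" by (intro countable_PiE) (auto simp: countable_rat)
    qed
    ultimately show ?thesis by (rule countable_image_inj_on[rotated])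
  qed
  then have "countable (\<Union>k. ?D k)" by (intro countable_UN) auto
  moreover have "D \<subseteq> (\<Union>k. ?D k)" using D unfolding dyadic_grid_def by blast
  ultimately show ?thesis by (rule countable_subset[rotated])
qed

lemma countable_zygmund_rectangles:
  assumes "\<And>i. i < m \<Longrightarrow> dyadic_grid (ds i) (D i)"
  shows "countable (zygmund_rectangles m ds D \<Phi>)"
proof (rule countable_subset)
  show "countable ((\<lambda>Q. \<Pi>\<^sub>E i\<in>{..<m}. Q i) ` Pi\<^sub>E {..<m} D)"
    using countable_dyadic_grid[OF assms] by (intro countable_image countable_PiE) auto
  show "zygmund_rectangles m ds D \<Phi> \<subseteq> (\<lambda>Q. \<Pi>\<^sub>E i\<in>{..<m}. Q i) ` Pi\<^sub>E {..<m} D"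
  proof
    fix I assume "I \<in> zygmund_rectangles m ds D \<Phi>"
    then obtain Q where Q: "I = (\<Pi>\<^sub>E i\<in>{..<m}. Q i)" "\<forall>i<m. Q i \<in> D i"
      unfolding zygmund_rectangles_def by blast
    have "I = (\<Pi>\<^sub>E i\<in>{..<m}. restrict Q {..<m} i)" unfolding Q(1) by (rule PiE_cong) simp
    moreover have "restrict Q {..<m} \<in> Pi\<^sub>E {..<m} D" using Q(2) by auto
    ultimately show "I \<in> (\<lambda>Q. \<Pi>\<^sub>E i\<in>{..<m}. Q i) ` Pi\<^sub>E {..<m} D" by blast
  qed
qed

lemma zygmund_rectangles_sets:
  assumes "I \<in> zygmund_rectangles m ds D \<Phi>" "m \<ge> 1"
  shows "I \<in> sets (\<Pi>\<^sub>M i\<in>{..<m}. (\<Pi>\<^sub>M j\<in>{..<ds i}. (lborel :: real measure)))"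
proof -
  obtain Q k where Q: "I = (\<Pi>\<^sub>E i\<in>{..<m}. Q i)" "\<forall>i<m - 1. cube_of_side (ds i) (2 powi k i) (Q i)"
    "cube_of_side (ds (m - 1)) (2 powi \<Phi> k) (Q (m - 1))"
    using assms(1) unfolding zygmund_rectangles_def by blast
  have "Q i \<in> sets (\<Pi>\<^sub>M j\<in>{..<ds i}. (lborel :: real measure))" if "i < m" for i
  proof (cases "i = m - 1")
    case True
    then show ?thesis using cube_of_side_sets[OF Q(3)] by simp
  next
    case False
    then have "i < m - 1" using that by simp
    then show ?thesis using Q(2) cube_of_side_sets by blast
  qed
  then show ?thesis unfolding Q(1) by (intro sets_PiM_I_finite) auto
qed

text \<open>An infinite sum of nonnegative terms is the supremum of its finite partial sums, so a
  strict threshold is already passed by a finite subfamily. This is why all tails use strict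
  inequality.\<close>

lemma less_height_iff:
  assumes "a \<ge> 0"
  shows "ennreal a < height G x \<longleftrightarrow> (\<exists>F\<subseteq>G. finite F \<and> a < real (card {I\<in>F. x \<in> I}))"
proof -
  have *: "(\<Sum>I\<in>F. indicator I x) = ennreal (real (card {I\<in>F. x \<in> I}))" if "finite F" for F :: "'a set set"
    using that by (simp add: indicator_def sum.If_cases Int_def ennreal_of_nat_eq_real_of_nat)
  have "height G x = (SUP F\<in>{F. finite F \<and> F \<subseteq> G}. (\<Sum>I\<in>F. indicator I x))"
    unfolding height_def by (rule nonneg_infsum_complete) simp
  then have "ennreal a < height G x \<longleftrightarrow> (\<exists>F\<in>{F. finite F \<and> F \<subseteq> G}. ennreal a < (\<Sum>I\<in>F. indicator I x))"
    by (simp only: less_SUP_iff)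
  also have "\<dots> \<longleftrightarrow> (\<exists>F\<in>{F. finite F \<and> F \<subseteq> G}. a < real (card {I\<in>F. x \<in> I}))"
    by (intro bex_cong refl) (simp add: * ennreal_less_iff[OF assms])
  finally show ?thesis by blast
qed

lemma exhausting_finite_subfamilies:
  assumes "countable G"
  obtains F :: "nat \<Rightarrow> 'a set" where "incseq F" "\<And>k. finite (F k)" "(\<Union>k. F k) = G"
proof
  let ?F = "\<lambda>k. {I\<in>G. to_nat_on G I \<le> k}"
  show "incseq ?F" by (auto simp: incseq_def)
  show "finite (?F k)" for k
  proof (rule inj_on_finite)
    show "inj_on (to_nat_on G) (?F k)" using inj_on_to_nat_on[OF assms] by (rule inj_on_subset) auto
    show "to_nat_on G ` ?F k \<subseteq> {..k}" by auto
  qed simp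
  show "(\<Union>k. ?F k) = G" by auto
qed

text \<open>The tail sets grow with the family, so that of \<open>G\<close> is the increasing union
  of those of finite subfamilies, and continuity from below preserves a bound uniform in the
  subfamily.\<close>

lemma height_tail_limit:
  assumes G: "countable G" "\<And>I. I \<in> G \<Longrightarrow> I \<in> sets M" and a: "a \<ge> 0"
    and fin: "\<And>H. H \<subseteq> G \<Longrightarrow> finite H \<Longrightarrow> emeasure M {x\<in>\<Union>H. a < real (card {I\<in>H. x \<in> I})} \<le> c * emeasure M (\<Union>H)"
  shows "{x\<in>\<Union>G. ennreal a < height G x} \<in> sets M"
    and "emeasure M {x\<in>\<Union>G. ennreal a < height G x} \<le> c * emeasure M (\<Union>G)"
proof -
  obtain F :: "nat \<Rightarrow> 'a set set" where F: "incseq F" "\<And>k. finite (F k)" "(\<Union>k. F k) = G"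
    using exhausting_finite_subfamilies[OF G(1)] by blast
  let ?B = "\<lambda>H. {x\<in>\<Union>H. a < real (card {I\<in>H. x \<in> I})}"
  have mono: "?B H \<subseteq> ?B K" if "H \<subseteq> K" "finite K" for H K
  proof
    fix x assume x: "x \<in> ?B H"
    have "card {I\<in>H. x \<in> I} \<le> card {I\<in>K. x \<in> I}" using that by (intro card_mono) auto
    then show "x \<in> ?B K" using x that by auto
  qed
  have UG: "\<Union>G \<in> sets M" using G by (intro sets.countable_Union) auto
  have B_sets: "?B H \<in> sets M" if "H \<subseteq> G" "finite H" for H
  proof -
    have m: "(\<lambda>x. \<Sum>I\<in>H. indicator I x :: real) \<in> borel_measurable M"
      using that G(2) by (intro borel_measurable_sum borel_measurable_indicator) auto
    have "\<Union>H \<in> sets M" using that G(2) by (intro sets.finite_Union) auto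
    moreover have "?B H = \<Union>H \<inter> {x\<in>space M. a < (\<Sum>I\<in>H. indicator I x)}"
      using sets.sets_into_space[OF UG] that
      by (auto simp: indicator_def sum.If_cases Int_def)
    ultimately show ?thesis using m by simp
  qed
  have eq: "{x\<in>\<Union>G. ennreal a < height G x} = (\<Union>k. ?B (F k))"
  proof (intro set_eqI iffI)
    fix x assume "x \<in> {x\<in>\<Union>G. ennreal a < height G x}"
    then have "ennreal a < height G x" by simp
    then obtain H where H: "H \<subseteq> G" "finite H" "a < real (card {I\<in>H. x \<in> I})"
      unfolding less_height_iff[OF a] by (elim exE conjE)
    have "\<exists>k. H \<subseteq> F k"
      using H(2,1)
    proof (induction H)
      case (insert I H)
      then obtain k k' where "H \<subseteq> F k" "I \<in> F k'" using F(3) by blast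
      moreover have "F k \<subseteq> F (max k k')" "F k' \<subseteq> F (max k k')" by (intro incseqD[OF F(1)]; simp)+
      ultimately show ?case by blast
    qed simp
    then obtain k where k: "H \<subseteq> F k" by blast
    have "{I\<in>H. x \<in> I} \<noteq> {}" using H(3) a by (metis card.empty of_nat_0 not_less)
    then have "x \<in> ?B H" using H(3) by blast
    then show "x \<in> (\<Union>k. ?B (F k))" using mono[OF k F(2)] by blast
  next
    fix x assume "x \<in> (\<Union>k. ?B (F k))"
    then obtain k where k: "x \<in> ?B (F k)" by blast
    have sub: "F k \<subseteq> G" using F(3) by blast
    moreover have "a < real (card {I\<in>F k. x \<in> I})" using k by simp
    ultimately have "ennreal a < height G x" unfolding less_height_iff[OF a] using F(2)[of k] by (intro exI conjI)
    moreover have "x \<in> \<Union>(F k)" using k by simp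
    ultimately show "x \<in> {x\<in>\<Union>G. ennreal a < height G x}" using sub by blast
  qed
  have sub: "F k \<subseteq> G" for k using F(3) by blast
  have B_sets': "?B (F k) \<in> sets M" for k by (rule B_sets[OF sub F(2)])
  show "{x\<in>\<Union>G. ennreal a < height G x} \<in> sets M"
    unfolding eq by (rule sets.countable_UN) (use B_sets' in blast)
  have "emeasure M (\<Union>k. ?B (F k)) = (SUP k. emeasure M (?B (F k)))"
  proof (rule SUP_emeasure_incseq[symmetric])
    show "range (\<lambda>k. ?B (F k)) \<subseteq> sets M" using B_sets' by blast
    show "incseq (\<lambda>k. ?B (F k))" using F(1,2) by (intro incseq_SucI mono) (auto dest: incseq_SucD)
  qed
  also have "\<dots> \<le> c * emeasure M (\<Union>G)"
  proof (rule SUP_least)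
    fix k
    have "emeasure M (?B (F k)) \<le> c * emeasure M (\<Union>(F k))" by (rule fin[OF sub F(2)])
    also have "\<dots> \<le> c * emeasure M (\<Union>G)"
      using sub by (intro mult_left_mono emeasure_mono UG) auto
    finally show "emeasure M (?B (F k)) \<le> c * emeasure M (\<Union>G)" .
  qed
  finally show "emeasure M {x\<in>\<Union>G. ennreal a < height G x} \<le> c * emeasure M (\<Union>G)" unfolding eq .
qed

theorem corollary7p1:
  fixes m d :: nat and \<eta> :: real
  assumes "m \<ge> 3" and "0 < \<eta>" and "\<eta> \<le> 1"
  shows "\<exists>c C :: real. c > 0 \<and> C > 0 \<and>
    (\<forall>(ds :: nat \<Rightarrow> nat) (D :: nat \<Rightarrow> (nat \<Rightarrow> real) set set)
       (\<Phi> :: (nat \<Rightarrow> int) \<Rightarrow> int) (G :: (nat \<Rightarrow> nat \<Rightarrow> real) set set).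
       (\<forall>i<m. ds i \<ge> 1) \<longrightarrow>
       (\<Sum>i<m. ds i) = d \<longrightarrow>
       (\<forall>i<m. dyadic_grid (ds i) (D i)) \<longrightarrow>
       coordwise_nondecreasing (m - 1) \<Phi> \<longrightarrow>
       G \<subseteq> zygmund_rectangles m ds D \<Phi> \<longrightarrow>
       sparse_family (lebesgue_prod m ds) \<eta> G \<longrightarrow>
       emeasure (lebesgue_prod m ds) (\<Union>G) < \<infinity> \<longrightarrow>
       (\<integral>\<^sup>+x\<in>\<Union>G. exp_powr_minus_one c (1 / real (m - 1)) (height G x) \<partial>lebesgue_prod m ds)
         \<le> ennreal C * emeasure (lebesgue_prod m ds) (\<Union>G))"
proof -
  define n where "n = m - 1"
  have n: "n \<ge> 1" and m: "m = Suc n" using assms(1) by (auto simp: n_def)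
  obtain A where A: "A > 0" "\<forall>ds D \<Phi> G (l::nat).
    (\<forall>i<Suc n. ds i \<ge> 1) \<longrightarrow> (\<forall>i<Suc n. dyadic_grid (ds i) (D i)) \<longrightarrow> coordwise_nondecreasing n \<Phi> \<longrightarrow>
    G \<subseteq> zygmund_rectangles (Suc n) ds D \<Phi> \<longrightarrow> finite G \<longrightarrow> sparse_family (lebesgue_prod (Suc n) ds) \<eta> G \<longrightarrow>
    emeasure (lebesgue_prod (Suc n) ds) {x\<in>\<Union>G. A * (real l + 2) ^ n < real (card {I\<in>G. x \<in> I})}
      \<le> ennreal ((1/2) ^ l) * emeasure (lebesgue_prod (Suc n) ds) (\<Union>G)"
    using finite_zygmund_tail[OF n assms(2)] by (elim exE conjE) (rule that)
  show ?thesis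
  proof (rule exI[of _ "ln (3/2) / A powr (1 / real n)"], rule exI[of _ 16], intro conjI allI impI)
    show "0 < ln (3/2) / A powr (1 / real n)" using A(1) by simp
    show "(0::real) < 16" by simp
  next
    fix ds :: "nat \<Rightarrow> nat" and D :: "nat \<Rightarrow> (nat \<Rightarrow> real) set set" and \<Phi> :: "(nat \<Rightarrow> int) \<Rightarrow> int"
      and G :: "(nat \<Rightarrow> nat \<Rightarrow> real) set set"
    assume ds: "\<forall>i<m. ds i \<ge> 1" and D: "\<forall>i<m. dyadic_grid (ds i) (D i)"
      and \<Phi>: "coordwise_nondecreasing (m - 1) \<Phi>" and GZ: "G \<subseteq> zygmund_rectangles m ds D \<Phi>"
      and sparse: "sparse_family (lebesgue_prod m ds) \<eta> G"
    let ?M = "lebesgue_prod m ds"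
    have count: "countable G"
      using countable_subset[OF GZ countable_zygmund_rectangles] D by blast
    have G_sets: "I \<in> sets ?M" if "I \<in> G" for I
    proof -
      have "I \<in> zygmund_rectangles m ds D \<Phi>" using GZ that by blast
      then show ?thesis unfolding lebesgue_prod_def
        using m by (intro sets_completionI_sets zygmund_rectangles_sets) auto
    qed
    have a: "A * (real l + 2) ^ n \<ge> 0" for l using A(1) by simp
    \<comment> \<open>Finite subfamilies stay sparse with the same \<open>\<eta>\<close>, so one
      \<open>A\<close> serves all of them.\<close>
    have fin: "emeasure ?M {x\<in>\<Union>H. A * (real l + 2) ^ n < real (card {I\<in>H. x \<in> I})}
        \<le> ennreal ((1/2) ^ l) * emeasure ?M (\<Union>H)" if H: "H \<subseteq> G" "finite H" for H and l :: nat
      using A(2)[rule_format, of ds D \<Phi> H l] ds D \<Phi> subset_trans[OF H(1) GZ] H(2) sparse_family_subset[OF sparse H(1)]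
      unfolding m by simp
    let ?T = "\<lambda>l::nat. {x\<in>\<Union>G. ennreal (A * (real l + 2) ^ n) < height G x}"
    have "(\<integral>\<^sup>+x\<in>\<Union>G. exp_powr_minus_one (ln (3/2) / A powr (1 / real n)) (1 / real n) (height G x) \<partial>?M)
        \<le> ennreal 16 * emeasure ?M (\<Union>G)"
    proof (rule nn_integral_exp_le[OF A(1) n, where T = ?T])
      show "\<Union>G \<in> sets ?M" using count G_sets by (intro sets.countable_Union) auto
      show "?T l \<in> sets ?M" for l
        by (rule height_tail_limit(1)[OF count G_sets a fin])
      show "emeasure ?M (?T l) \<le> ennreal ((1/2) ^ l) * emeasure ?M (\<Union>G)" for l
        by (rule height_tail_limit(2)[OF count G_sets a fin])
    qed simp
    then show "(\<integral>\<^sup>+x\<in>\<Union>G. exp_powr_minus_one (ln (3/2) / A powr (1 / real n)) (1 / real (m - 1)) (height G x) \<partial>?M)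
        \<le> ennreal 16 * emeasure ?M (\<Union>G)"
      unfolding n_def .
  qed
qed

end
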